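(* Let $\mathbb{E}$ be the (positive entropy, loosely Bernoulli) odometer-based system constructed as described in the context with parameters $|\Sigma|,(\varepsilon_n),(k_n)$, let $(l_n)_{n\ge 0}$ be integers with $l_n>2^{n+10}$, and let $\mathcal F$ be the map from odometer-based systems to circular systems determined by the circular coefficients $(k_n,l_n)$. If $|\Sigma|$ is sufficiently large and each $k_n$ is chosen sufficiently large depending on the previously chosen parameters (that is: there exist a number $S_0$ and, for every $n\ge 0$, a threshold $\kappa_n$ depending only on $|\Sigma|,\varepsilon_0,\dots,\varepsilon_n,l_0,\dots,l_n,k_0,\dots,k_{n-1}$, such that the following holds whenever $|\Sigma|\ge S_0$ and $k_n\ge\kappa_n$ for all $n$), then $\mathcal F(\mathbb E)$ is not loosely Bernoulli.
   Context: **The $\overline f$ distance.** A match between two strings of symbols $a_1\cdots a_n$ and $b_1\cdots b_m$ is a collection $I$ of pairs $(i_s,j_s)$, $s=1,\dots,r$, with $1\le i_1<\cdots<i_r\le n$, $1\le j_1<\cdots<j_r\le m$ and $a_{i_s}=b_{j_s}$ for all $s$. Put $\overline f(a_1\cdots a_n,b_1\cdots b_m)=1-\frac{2\sup\{|I|: I\text{ a match}\}}{n+m}$. **Loosely Bernoulli.** Let $T$ be a measurable automorphism of a measurable space $(\Omega,\mathcal M)$ and $\mathcal P=\{P_\sigma\}$ a finite measurable partition. For $x,y\in\Omega$ with $T^i(x)\in P_{a_i}$, $T^i(y)\in P_{b_i}$ ($i=1,\dots,K$) put $\overline f_K(x,y)=\overline f(a_1\cdots a_K,b_1\cdots b_K)$.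 For probability measures $\nu,\omega$ write $\overline f_K(\nu,\omega)<\varepsilon$ if there is an invertible measure-preserving map $\phi:(\Omega,\mathcal M,\nu)\to(\Omega,\mathcal M,\omega)$ and a set $G$ with $\nu(G)>1-\varepsilon$ and $\overline f_K(x,\phi(x))<\varepsilon$ for all $x\in G$. A measure-preserving process $(T,\mathcal P,\nu)$ is loosely Bernoulli if for every $\varepsilon>0$ there is a positive integer $K$ such that for every positive integer $M$ there is a collection $\mathcal G$ of atoms of $\bigvee_{i=-M}^0T^{-i}\mathcal P$ with union of measure greater than $1-\varepsilon$ such that $\overline f_K(\nu_A,\nu_B)<\varepsilon$ for each pair $A,B\in\mathcal G$ of positive measure, where $\nu_A=\nu(\cdot|A)$. In the case of zero entropy (every circular system has zero entropy) this reduces to: for every $\varepsilon>0$ there are a positive integer $K$ and a collection $\mathcal G$ of atoms of $\bigvee_{i=1}^KT^{-i}\mathcal P$ of total measure greater than $1-\varepsilon$ such that $\overline f_K(x,y)<\varepsilon$ for $x\in A$, $y\in B$, $A,B\in\mathcal G$. A transformation is loosely Bernoulli if the process is loosely Bernoulli for every finite partition (equivalently, for one generating partition). **Odometer-based systems.** Let $\Sigma$ be a finite alphabet and $k_n\ge 2$ integers. An odometer-based construction sequence is a sequence of finite sets of words $\mathtt W_0=\Sigma$, $\mathtt W_{n+1}\subseteq(\mathtt W_n)^{k_n}$ such that every $w\in\mathtt W_n$ occurs in every $w'\in\mathtt W_{n+1}$ and each $\mathtt W_n$ is uniquely readable (whenever $u,v,w\in \mathtt W_n$ and $uv=pws$,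 then $p$ or $s$ is empty). Words in $\mathtt W_n$ are called $n$-blocks. The associated system is the set of bi-infinite sequences all of whose finite substrings occur inside words of the construction sequence, with the left shift. If the construction sequence is uniform (each $n$-block occurs the same number of times in each $(n+1)$-block), the system (odometer-based, or circular as below) is equipped with the shift-invariant probability measure giving a cylinder $\{x:x_0\cdots x_{k-1}=u\}$ the limiting frequency of $u$ in the $n$-blocks as $n\to\infty$. **Circular systems and $\mathcal F$.** Circular coefficients are pairs of integers $(k_n,l_n)$, $k_n\ge2$, $\sum 1/l_n<\infty$. Set $p_0=0$, $q_0=1$, $q_{n+1}=k_nl_nq_n^2$, $p_{n+1}=p_nk_nl_nq_n+1$. Let $b,e$ be two new symbols. For words $w_0,\dots,w_{k_n-1}$ of length $q_n$ define $$\mathcal C_n(w_0,\dots,w_{k_n-1})=\prod_{i=0}^{q_n-1}\prod_{j=0}^{k_n-1}\left(b^{q_n-j_i}w_j^{l_n-1}e^{j_i}\right),$$ where $j_0=0$ if $n=0$ and, for $n>0$, $j_i\in\{0,\dots,q_n-1\}$ with $j_i\equiv (p_n)^{-1}i \bmod q_n$. Given an odometer-based construction sequence $(\mathtt W_n)$ with coefficients $(k_n)$, let $\mathcal W_0=\Sigma$, $c_0=\mathrm{id}$, and inductively $c_{n+1}(\mathtt w_0\cdots\mathtt w_{k_n-1})=\mathcal C_n(c_n(\mathtt w_0),\dots,c_n(\mathtt w_{k_n-1}))$ for $\mathtt w_0\cdots\mathtt w_{k_n-1}\in\mathtt W_{n+1}$, $\mathcal W_{n+1}=c_{n+1}(\mathtt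 W_{n+1})$. The circular system with construction sequence $(\mathcal W_n)$ is the image under $\mathcal F$ of the odometer-based system of $(\mathtt W_n)$. **Construction of $\mathbb E$.** Let $\mathtt W_0=\Sigma$ and $N(n)=|\mathtt W_n|$. Choose, for each $n\ge0$, a positive rational $\varepsilon_n<2^{-(n+12)}$ with $\varepsilon_nN(n)>2$, and then an integer $k_n$ such that $\varepsilon_nk_n$ is an integer and $k_n$ is a multiple of $N(n)$; put $k_n'=(1-\varepsilon_n)k_n$. Let $\tau_n$ be the probability that, when $k_n'$ symbols are chosen independently and uniformly from $\{1,\dots,N(n)-1\}$, some symbol is chosen more than $k_n/N(n)$ times. The $k_n$ are chosen large enough that $\sum_{n=1}^\infty N(n)^2/(\varepsilon_n^2k_n)<1/8$ and $\sum_{n=1}^\infty\tau_n^{(2^{-n})}<\infty$. Enumerate $\mathtt W_n=\{\mathtt y_1,\dots,\mathtt y_{N(n)}\}$. Then $\mathtt W_{n+1}$ consists of all words $\mathtt w_1\cdots\mathtt w_{k_n}$ with $\mathtt w_j\in\mathtt W_n$ such that: (1) for each $i\in\{1,\dots,N(n)-1\}$, $\#\{j\le k_n':\mathtt w_j=\mathtt y_i\}\le k_n/N(n)$, and $\mathtt w_j\ne\mathtt y_{N(n)}$ for $j\le k_n'$; (2) $\mathtt w_j=\mathtt y_{N(n)}$ for the last $k_n/N(n)$ indices $j$; (3) the remaining middle part $\mathtt w_{k_n'+1}\cdots\mathtt w_{k_n-k_n/N(n)}$ consists of a finite (possibly empty) string of $\mathtt y_1$'s, followed by a finite string of $\mathtt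 y_2$'s, etc., ending with a finite string of $\mathtt y_{N(n)-1}$'s, such that $\#\{j\le k_n:\mathtt w_j=\mathtt y_i\}=k_n/N(n)$ for every $i\in\{1,\dots,N(n)\}$. The sequence $(\mathtt W_n)$ is uniform and uniquely readable, and $\mathbb E$ is the associated odometer-based system. *)

theory Defs
  imports
    "HOL-Probability.Probability"
    "HOL-Library.Sublist"
    "HOL-Number_Theory.Modular_Inverse"
begin

section \<open>The f-bar distance\<close>

text \<open>A match is listed as its pairs in increasing order; positions are counted from 0.\<close>

definition is_match :: "'s list \<Rightarrow> 's list \<Rightarrow> (nat \<times> nat) list \<Rightarrow> bool" where
  "is_match a b I \<longleftrightarrow>
     sorted_wrt (\<lambda>u v. fst u < fst v \<and> snd u < snd v) I \<and>
     (\<forall>(i, j) \<in> set I. i < length a \<and> j < length b \<and> a ! i = b ! j)"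

definition fbar :: "'s list \<Rightarrow> 's list \<Rightarrow> real" where
  "fbar a b = 1 - 2 * real (Sup (length ` {I. is_match a b I})) / real (length a + length b)"

section \<open>Loosely Bernoulli transformations\<close>

text \<open>
  A partition is given by its labelling function \<open>P\<close>; its elements are the nonempty fibres of \<open>P\<close>.
\<close>

definition finite_partition :: "'x measure \<Rightarrow> ('x \<Rightarrow> 'b) \<Rightarrow> bool" where
  "finite_partition M P \<longleftrightarrow> P \<in> measurable M (count_space UNIV) \<and> finite (P ` space M)"

definition iterate :: "'x measure \<Rightarrow> ('x \<Rightarrow> 'x) \<Rightarrow> int \<Rightarrow> 'x \<Rightarrow> 'x" where
  "iterate M T i = (if i \<ge> 0 then T ^^ nat i else inv_into (space M) T ^^ nat (- i))"

definition fbar_name :: "('x \<Rightarrow> 'x) \<Rightarrow> ('x \<Rightarrow> 'b) \<Rightarrow> nat \<Rightarrow> 'x \<Rightarrow> 'x \<Rightarrow> real" where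
  "fbar_name T P K x y =
     fbar (map (\<lambda>i. P ((T ^^ i) x)) [1..<Suc K]) (map (\<lambda>i. P ((T ^^ i) y)) [1..<Suc K])"

text \<open>As usual in ergodic theory, an invertible map need only be defined off null sets.\<close>

definition invertible_measure_preserving :: "'x measure \<Rightarrow> 'y measure \<Rightarrow> ('x \<Rightarrow> 'y) \<Rightarrow> bool" where
  "invertible_measure_preserving M N \<phi> \<longleftrightarrow>
     (\<exists>X \<in> sets M. \<exists>Y \<in> sets N.
        (AE x in M. x \<in> X) \<and> (AE y in N. y \<in> Y) \<and> bij_betw \<phi> X Y \<and>
        \<phi> \<in> measurable (restrict_space M X) (restrict_space N Y) \<and>
        inv_into X \<phi> \<in> measurable (restrict_space N Y) (restrict_space M X) \<and>
        (\<forall>B \<in> sets N. emeasure M (\<phi> -` B \<inter> X) = emeasure N B))"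

definition fbar_measures_less ::
    "('x \<Rightarrow> 'x) \<Rightarrow> ('x \<Rightarrow> 'b) \<Rightarrow> nat \<Rightarrow> 'x measure \<Rightarrow> 'x measure \<Rightarrow> real \<Rightarrow> bool" where
  "fbar_measures_less T P K \<nu> \<omega> \<epsilon> \<longleftrightarrow>
     (\<exists>\<phi>. invertible_measure_preserving \<nu> \<omega> \<phi> \<and>
        (\<exists>G \<in> sets \<nu>. measure \<nu> G > 1 - \<epsilon> \<and> (\<forall>x \<in> G. fbar_name T P K x (\<phi> x) < \<epsilon>)))"

text \<open>The atoms of the join of \<open>T\<^sup>-\<^sup>i P\<close> over \<open>-m \<le> i \<le> 0\<close>, with
  \<open>T\<^sup>-\<^sup>i P\<close> having the elements \<open>{x. T\<^sup>i x \<in> P\<^sub>\<sigma>}\<close>.\<close>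

definition past_atoms :: "'x measure \<Rightarrow> ('x \<Rightarrow> 'x) \<Rightarrow> ('x \<Rightarrow> 'b) \<Rightarrow> nat \<Rightarrow> 'x set set" where
  "past_atoms M T P m =
     {A. A \<noteq> {} \<and> (\<exists>c. A = {x \<in> space M. \<forall>i \<in> {- int m..0}. P (iterate M T i x) = c i})}"

definition loosely_Bernoulli_process :: "'x measure \<Rightarrow> ('x \<Rightarrow> 'x) \<Rightarrow> ('x \<Rightarrow> 'b) \<Rightarrow> bool" where
  "loosely_Bernoulli_process M T P \<longleftrightarrow>
     (\<forall>\<epsilon>>0. \<exists>K>0. \<forall>m>0. \<exists>\<G> \<subseteq> past_atoms M T P m.
        measure M (\<Union>\<G>) > 1 - \<epsilon> \<and>
        (\<forall>A \<in> \<G>. \<forall>B \<in> \<G>. measure M A > 0 \<and> measure M B > 0 \<longrightarrow>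
           fbar_measures_less T P K (uniform_measure M A) (uniform_measure M B) \<epsilon>))"

text \<open>Labelling by natural numbers loses no generality, as the partitions are finite.\<close>

definition loosely_Bernoulli :: "'x measure \<Rightarrow> ('x \<Rightarrow> 'x) \<Rightarrow> bool" where
  "loosely_Bernoulli M T \<longleftrightarrow>
     (\<forall>P :: 'x \<Rightarrow> nat. finite_partition M P \<longrightarrow> loosely_Bernoulli_process M T P)"

section \<open>Symbolic systems of construction sequences\<close>

definition left_shift :: "(int \<Rightarrow> 's) \<Rightarrow> (int \<Rightarrow> 's)" where
  "left_shift x = (\<lambda>i. x (i + 1))"

definition symbolic_system :: "(nat \<Rightarrow> 's list set) \<Rightarrow> (int \<Rightarrow> 's) set" where
  "symbolic_system W =
     {x. \<forall>a m. \<exists>n. \<exists>w \<in> W n. sublist (map (\<lambda>i. x (a + int i)) [0..<m]) w}"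

definition frequency :: "'s list \<Rightarrow> 's list \<Rightarrow> real" where
  "frequency u w =
     real (card {i. i + length u \<le> length w \<and> take (length u) (drop i w) = u}) / real (length w)"

text \<open>
  The invariant measure of a uniform construction sequence: the limiting frequency is the same
  along every choice of blocks \<open>w n \<in> W n\<close>.
\<close>

definition system_measure :: "(nat \<Rightarrow> 's list set) \<Rightarrow> (int \<Rightarrow> 's) measure \<Rightarrow> bool" where
  "system_measure W \<nu> \<longleftrightarrow>
     prob_space \<nu> \<and>
     sets \<nu> = sets (restrict_space (\<Pi>\<^sub>M i\<in>UNIV. count_space UNIV) (symbolic_system W)) \<and>
     left_shift \<in> measurable \<nu> \<nu> \<and> distr \<nu> \<nu> left_shift = \<nu> \<and>
     (\<forall>u w. (\<forall>n. w n \<in> W n) \<longrightarrow>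
        (\<lambda>n. frequency u (w n)) \<longlonglongrightarrow>
          measure \<nu> {x \<in> space \<nu>. map (\<lambda>i. x (int i)) [0..<length u] = u})"

section \<open>Circular systems\<close>

datatype 'a circ_symbol = Letter 'a | Spacer_b | Spacer_e

fun circ_q :: "(nat \<Rightarrow> nat) \<Rightarrow> (nat \<Rightarrow> nat) \<Rightarrow> nat \<Rightarrow> nat" where
  "circ_q k l 0 = 1"
| "circ_q k l (Suc n) = k n * l n * (circ_q k l n)\<^sup>2"

fun circ_p :: "(nat \<Rightarrow> nat) \<Rightarrow> (nat \<Rightarrow> nat) \<Rightarrow> nat \<Rightarrow> nat" where
  "circ_p k l 0 = 0"
| "circ_p k l (Suc n) = circ_p k l n * k n * l n * circ_q k l n + 1"

definition j_index :: "(nat \<Rightarrow> nat) \<Rightarrow> (nat \<Rightarrow> nat) \<Rightarrow> nat \<Rightarrow> nat \<Rightarrow> nat" where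
  "j_index k l n i =
     (if n = 0 then 0
      else nat ((modular_inverse (int (circ_q k l n)) (int (circ_p k l n)) * int i) mod int (circ_q k l n)))"

definition circ_op ::
    "(nat \<Rightarrow> nat) \<Rightarrow> (nat \<Rightarrow> nat) \<Rightarrow> nat \<Rightarrow> 'a circ_symbol list list \<Rightarrow> 'a circ_symbol list" where
  "circ_op k l n ws =
     concat (map (\<lambda>i. concat (map (\<lambda>j.
         replicate (circ_q k l n - j_index k l n i) Spacer_b @
         concat (replicate (l n - 1) (ws ! j)) @
         replicate (j_index k l n i) Spacer_e)
       [0..<k n])) [0..<circ_q k l n])"

text \<open>
  Words of \<open>W (Suc n)\<close> are flat strings over the alphabet, and all words of \<open>W n\<close> have length
  \<open>k 0 * \<dots> * k (n - 1)\<close>; \<open>circ_map\<close> recovers the \<open>n\<close>-blocks by cutting at multiples of this length.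
\<close>

fun circ_map :: "(nat \<Rightarrow> nat) \<Rightarrow> (nat \<Rightarrow> nat) \<Rightarrow> nat \<Rightarrow> 'a list \<Rightarrow> 'a circ_symbol list" where
  "circ_map k l 0 w = map Letter w"
| "circ_map k l (Suc n) w =
     (let h = (\<Prod>i<n. k i)
      in circ_op k l n (map (\<lambda>j. circ_map k l n (take h (drop (j * h) w))) [0..<k n]))"

definition circular_sequence ::
    "(nat \<Rightarrow> nat) \<Rightarrow> (nat \<Rightarrow> nat) \<Rightarrow> (nat \<Rightarrow> 'a list set) \<Rightarrow> nat \<Rightarrow> 'a circ_symbol list set" where
  "circular_sequence k l W n = circ_map k l n ` W n"

section \<open>The odometer-based construction sequence\<close>

text \<open>\<open>\<epsilon> * k\<close> is an integer and \<open>\<epsilon> < 1\<close> in all uses, so \<open>k_prime \<epsilon> k\<close> is exactly \<open>(1 - \<epsilon>) * k\<close>.\<close>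

definition k_prime :: "real \<Rightarrow> nat \<Rightarrow> nat" where
  "k_prime \<epsilon> k = nat \<lfloor>(1 - \<epsilon>) * real k\<rfloor>"

text \<open>
  The probability that among \<open>k_prime \<epsilon> k\<close> independent uniform choices from \<open>{1..N - 1}\<close> some symbol is
  chosen more than \<open>k / N\<close> times; \<open>N\<close> divides \<open>k\<close> in all uses.
\<close>

definition overflow_prob :: "real \<Rightarrow> nat \<Rightarrow> nat \<Rightarrow> real" where
  "overflow_prob \<epsilon> N k = measure_pmf.prob (replicate_pmf (k_prime \<epsilon> k) (pmf_of_set {1..N - 1}))
     {s. \<exists>i \<in> {1..N - 1}. count_list s i > k div N}"

text \<open>
  The concatenations of \<open>ws = u @ v @ t\<close>, where \<open>u\<close> is the list of the first \<open>k_prime \<epsilon> k\<close> blocks,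
  \<open>v\<close> the sorted middle part with \<open>r i \<ge> 0\<close> copies of \<open>y i\<close>, and \<open>t\<close> the list of the last
  \<open>k / N\<close> blocks.
\<close>

definition next_words :: "(nat \<Rightarrow> 'a list) \<Rightarrow> nat \<Rightarrow> real \<Rightarrow> nat \<Rightarrow> 'a list set" where
  "next_words y N \<epsilon> k =
     {concat ws | ws u r.
        length ws = k \<and>
        ws = u @ concat (map (\<lambda>i. replicate (r i) (y i)) [1..<N]) @ replicate (k div N) (y N) \<and>
        length u = k_prime \<epsilon> k \<and> set u \<subseteq> y ` {1..N - 1} \<and>
        (\<forall>i \<in> {1..N - 1}. count_list u (y i) \<le> k div N) \<and>
        (\<forall>i \<in> {1..N}. count_list ws (y i) = k div N)}"

text \<open>\<open>y n\<close> enumerates the \<open>n\<close>-blocks.\<close>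

definition E_sequence ::
    "'a set \<Rightarrow> (nat \<Rightarrow> real) \<Rightarrow> (nat \<Rightarrow> nat) \<Rightarrow> (nat \<Rightarrow> nat \<Rightarrow> 'a list) \<Rightarrow> (nat \<Rightarrow> 'a list set) \<Rightarrow> bool" where
  "E_sequence \<Sigma> \<epsilon> k y W \<longleftrightarrow>
     W 0 = (\<lambda>a. [a]) ` \<Sigma> \<and>
     (\<forall>n. bij_betw (y n) {1..card (W n)} (W n) \<and>
          W (Suc n) = next_words (y n) (card (W n)) (\<epsilon> n) (k n))"

text \<open>The conditions on \<open>\<epsilon> n\<close> and \<open>k n\<close>, with \<open>N n\<close> the number of \<open>n\<close>-blocks; both series start at
  index 1.\<close>

definition E_parameters :: "(nat \<Rightarrow> real) \<Rightarrow> (nat \<Rightarrow> nat) \<Rightarrow> (nat \<Rightarrow> nat) \<Rightarrow> bool" where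
  "E_parameters \<epsilon> k N \<longleftrightarrow>
     (\<forall>n. \<epsilon> n \<in> \<rat> \<and> 0 < \<epsilon> n \<and> \<epsilon> n < 1 / 2 ^ (n + 12) \<and> \<epsilon> n * real (N n) > 2) \<and>
     (\<forall>n. k n \<ge> 2 \<and> \<epsilon> n * real (k n) \<in> \<int> \<and> N n dvd k n) \<and>
     summable (\<lambda>n. (real (N (Suc n)))\<^sup>2 / ((\<epsilon> (Suc n))\<^sup>2 * real (k (Suc n)))) \<and>
     (\<Sum>n. (real (N (Suc n)))\<^sup>2 / ((\<epsilon> (Suc n))\<^sup>2 * real (k (Suc n)))) < 1 / 8 \<and>
     summable (\<lambda>n. overflow_prob (\<epsilon> (Suc n)) (N (Suc n)) (k (Suc n)) powr (1 / 2 ^ Suc n))"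

end

(*
  Two n-blocks are well separated if all long pieces of periodic repetitions of their circular
  images are at f-bar distance near 1. By induction on n, every n-block w is well separated from all
  but a tiny proportion of the n-blocks v. Up to spacers, the circular image of an (n+1)-block is a
  repeated pass through the runs of its n-blocks, so a common subsequence of two such images is a
  staircase of cells, each comparing two runs. Cells of separated n-blocks contribute little, and the
  other cells form chains, whose lengths are governed by a longest common subsequence of the two
  sequences of n-blocks with respect to the relation "not separated". As the first k' entries of v are
  almost free, a union bound over lattice paths shows that a long chain is exponentially unlikely.
  Together with l_n > 2^(n+10) this keeps the total loss below 1/16.

  Hence, for K between 16 q_n and 17 q_n, the average f-bar distance of two K-names is at least 1/2.
  Conversely, if the system were loosely Bernoulli, then, since x_i = x_(i - q_n) holds with
  probability close to 1, the K-name is almost determined by the past, so most K-names would be pairwise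
  f-bar close for some K. Concatenation transfers this to all multiples rK of K, a contradiction.
*)

theory Submission
  imports Defs
begin

section \<open>Longest common subsequences with respect to a relation\<close>

text \<open>The losses of all levels must be summable, so level \<open>n\<close> may tolerate only
  chains of length about \<open>k n / 2 ^ (n + 7)\<close>. Against exponentially many lattice paths
  such a short chain is unlikely only if a single bad pair has probability exponentially small in
  \<open>2 ^ (n + 7)\<close>. The induction therefore carries the proportion
  \<open>1 / 54 ^ (2 ^ (n + 7))\<close>: raised to the chain length it is at most
  \<open>1 / 54 ^ k n\<close>, which beats the factor \<open>9 ^ k n\<close> of the path count and
  the factor \<open>3 ^ k n\<close> by which the condition of equal counts may reduce the number of
  (n+1)-blocks. The surplus \<open>2 ^ k n\<close> pays for the proportion at the next level once
  \<open>k n \<ge> 2 ^ (n + 12)\<close>; at level 0, where only equal letters are bad, the alphabet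
  needs \<open>54 ^ 128 + 1\<close> letters. Separation is asked of periodic repetitions because a
  run of an n-block is one, and with an additive constant \<open>q n\<close>, which makes it void
  for pieces shorter than a period. For windows longer than \<open>16 * q n\<close> this constant
  costs only a further 1/16, and the interval up to \<open>17 * q n\<close> contains a multiple of
  every positive \<open>K \<le> q n\<close>.\<close>

fun rlcs :: "('a \<Rightarrow> 'b \<Rightarrow> bool) \<Rightarrow> 'a list \<Rightarrow> 'b list \<Rightarrow> nat" where
  "rlcs R [] ys = 0"
| "rlcs R (x # xs) [] = 0"
| "rlcs R (x # xs) (y # ys) =
     max (if R x y then Suc (rlcs R xs ys) else 0) (max (rlcs R xs (y # ys)) (rlcs R (x # xs) ys))"

lemma rlcs_Nil2 [simp]: "rlcs R xs [] = 0"
  by (cases xs) auto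

lemma rlcs_le_Cons1: "rlcs R xs ys \<le> rlcs R (x # xs) ys"
  by (cases ys) auto

lemma rlcs_le_Cons2: "rlcs R xs ys \<le> rlcs R xs (y # ys)"
  by (cases xs) auto

lemma rlcs_ge:
  assumes "subseq as xs" "subseq bs ys" "list_all2 R as bs"
  shows "length as \<le> rlcs R xs ys"
  using assms
proof (induction R xs ys arbitrary: as bs rule: rlcs.induct)
  case (1 R ys)
  then show ?case by simp
next
  case (2 R x xs)
  then show ?case by (auto dest: list_emb_Nil2)
next
  case (3 R x xs y ys)
  show ?case
  proof (cases as)
    case Nil
    then show ?thesis by simp
  next
    case (Cons a as')
    then obtain b bs' where bs: "bs = b # bs'"
      using "3.prems"(3) by (cases bs) auto
    show ?thesis
    proof (cases "subseq as xs \<or> subseq bs ys")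
      case True
      then show ?thesis
        using "3.IH"(2,3)[of as bs] "3.prems" by (auto simp: max_def)
    next
      case False
      then have "a = x" "subseq as' xs" "b = y" "subseq bs' ys"
        using "3.prems"(1,2) Cons bs by (auto split: if_splits)
      then show ?thesis
        using "3.IH"(1)[of as' bs'] "3.prems"(3) Cons bs by (auto simp: max_def)
    qed
  qed
qed

text \<open>Together with \<open>rlcs_ge\<close> this replaces the recursion by an optimal pair of
  subsequences, the form in which monotonicity and cutting are proved. The recursion itself serves
  the counting in \<open>card_rlcs_ge\<close>.\<close>

lemma rlcs_witness:
  obtains as bs where "subseq as xs" "subseq bs ys" "list_all2 R as bs" "length as = rlcs R xs ys"
proof -
  have "\<exists>as bs. subseq as xs \<and> subseq bs ys \<and> list_all2 R as bs \<and> length as = rlcs R xs ys"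
  proof (induction R xs ys rule: rlcs.induct)
    case (1 R ys)
    then show ?case by (intro exI[of _ "[]"]) auto
  next
    case (2 R x xs)
    then show ?case by (intro exI[of _ "[]"]) auto
  next
    case (3 R x xs y ys)
    let ?B = "rlcs R xs (y # ys)" and ?C = "rlcs R (x # xs) ys"
    consider "R x y" "max ?B ?C < Suc (rlcs R xs ys)"
      | "\<not> (R x y \<and> max ?B ?C < Suc (rlcs R xs ys))" "?C \<le> ?B"
      | "\<not> (R x y \<and> max ?B ?C < Suc (rlcs R xs ys))" "?B \<le> ?C"
      by linarith
    then show ?case
    proof cases
      case 1
      then have "rlcs R (x # xs) (y # ys) = Suc (rlcs R xs ys)" by simp
      moreover obtain as bs where "subseq as xs" "subseq bs ys" "list_all2 R as bs"
          "length as = rlcs R xs ys"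
        using "3.IH"(1) 1 by blast
      ultimately show ?thesis using 1 by (intro exI[of _ "x # as"] exI[of _ "y # bs"]) simp
    next
      case 2
      then have "rlcs R (x # xs) (y # ys) = ?B" by auto
      then show ?thesis using "3.IH"(2) by (metis list_emb_Cons)
    next
      case 3
      then have "rlcs R (x # xs) (y # ys) = ?C" by auto
      then show ?thesis using "3.IH"(3) by (metis list_emb_Cons)
    qed
  qed
  then show ?thesis using that by blast
qed

lemma rlcs_mono:
  assumes "subseq xs xs'" "subseq ys ys'"
  shows "rlcs R xs ys \<le> rlcs R xs' ys'"
  by (metis assms rlcs_ge rlcs_witness subseq_order.order_trans)

lemma rlcs_rel_mono:
  assumes "\<And>x y. x \<in> set xs \<Longrightarrow> y \<in> set ys \<Longrightarrow> R x y \<Longrightarrow> R' x y"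
  shows "rlcs R xs ys \<le> rlcs R' xs ys"
proof -
  obtain as bs where *: "subseq as xs" "subseq bs ys" "list_all2 R as bs" "length as = rlcs R xs ys"
    using rlcs_witness .
  have "set as \<subseteq> set xs" "set bs \<subseteq> set ys"
    using * by (auto dest: list_emb_set)
  then have "list_all2 R' as bs"
    using *(3) assms by (auto simp: list_all2_conv_all_nth subset_iff)
  then show ?thesis using rlcs_ge * by metis
qed

lemma rlcs_map: "rlcs R (map f xs) (map g ys) = rlcs (\<lambda>x y. R (f x) (g y)) xs ys"
  by (induction "\<lambda>x y. R (f x) (g y)" xs ys rule: rlcs.induct) auto

lemma rlcs_commute: "rlcs R xs ys = rlcs (\<lambda>y x. R x y) ys xs"
  by (induction R xs ys rule: rlcs.induct) auto

lemma rlcs_le_length1: "rlcs R xs ys \<le> length xs"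
  by (metis list_emb_length rlcs_witness)

lemma rlcs_le_length2: "rlcs R xs ys \<le> length ys"
  using rlcs_le_length1 rlcs_commute by metis

lemma rlcs_eq_0:
  assumes "\<And>x y. x \<in> set xs \<Longrightarrow> y \<in> set ys \<Longrightarrow> \<not> R x y"
  shows "rlcs R xs ys = 0"
proof -
  have "rlcs R xs ys \<le> rlcs (\<lambda>_ _. False) xs ys"
    by (rule rlcs_rel_mono) (use assms in auto)
  also have "rlcs (\<lambda>_ _. False) xs ys = 0"
    by (induction "\<lambda>(_::'a) (_::'b). False" xs ys rule: rlcs.induct) auto
  finally show ?thesis by simp
qed

lemma rlcs_append_ge: "rlcs R xs ys + rlcs R xs' ys' \<le> rlcs R (xs @ xs') (ys @ ys')"
proof -
  obtain as bs where 1: "subseq as xs" "subseq bs ys" "list_all2 R as bs" "length as = rlcs R xs ys"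
    using rlcs_witness .
  obtain cs ds where 2: "subseq cs xs'" "subseq ds ys'" "list_all2 R cs ds" "length cs = rlcs R xs' ys'"
    using rlcs_witness .
  have "length (as @ cs) \<le> rlcs R (xs @ xs') (ys @ ys')"
    by (rule rlcs_ge[of _ _ "bs @ ds"]) (use 1 2 in \<open>auto intro: list_emb_append_mono list_all2_appendI\<close>)
  then show ?thesis using 1 2 by simp
qed

lemma rlcs_Cons1_le: "rlcs R (x # xs) ys \<le> Suc (rlcs R xs ys)"
proof -
  obtain as bs where *: "subseq as (x # xs)" "subseq bs ys" "list_all2 R as bs"
      "length as = rlcs R (x # xs) ys"
    using rlcs_witness .
  have "subseq (tl as) xs" using *(1) by (cases as) (auto split: if_splits dest: subseq_Cons')
  moreover have "subseq (tl bs) ys" using *(2) by (cases bs) (auto dest: subseq_Cons')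
  moreover have "list_all2 R (tl as) (tl bs)" using *(3) by (cases as; cases bs) auto
  ultimately have "length (tl as) \<le> rlcs R xs ys" by (rule rlcs_ge)
  then show ?thesis using * by simp
qed

text \<open>Each deleted entry takes part in at most one matched pair. This is the price of
  discarding spacers and the completed parts of blocks.\<close>

lemma rlcs_delete1:
  assumes "subseq xs' xs"
  shows "rlcs R xs ys \<le> rlcs R xs' ys + (length xs - length xs')"
  using assms
proof (induction arbitrary: ys)
  case (list_emb_Nil xs)
  then show ?case using rlcs_le_length1[of R] by simp
next
  case (list_emb_Cons xs' xs x)
  then show ?case
    using rlcs_Cons1_le[of R x xs ys] list_emb_length[OF list_emb_Cons.hyps]
      list_emb_Cons.IH[of ys] unfolding length_Cons by linarith
next
  case (list_emb_Cons2 x y xs' xs)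
  show ?case
  proof (induction ys)
    case (Cons z ys)
    show ?case
      using list_emb_Cons2.IH[of ys] list_emb_Cons2.IH[of "z # ys"] list_emb_Cons2.hyps(1) Cons
      by auto
  qed simp
qed

lemma rlcs_delete2:
  assumes "subseq ys' ys"
  shows "rlcs R xs ys \<le> rlcs R xs ys' + (length ys - length ys')"
  using rlcs_delete1[OF assms, of "\<lambda>y x. R x y" xs] by (metis rlcs_commute)

section \<open>Staircase decomposition of common subsequences of concatenations\<close>

lemma rlcs_append_cases:
  obtains (left) b1 b2 where "b = b1 @ b2"
      "rlcs R (a @ as) (b @ bs) \<le> rlcs R a b1 + rlcs R as (b2 @ bs)"
  | (right) a1 a2 where "a = a1 @ a2"
      "rlcs R (a @ as) (b @ bs) \<le> rlcs R a1 b + rlcs R (a2 @ as) bs"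
proof -
  obtain us vs where *: "subseq us (a @ as)" "subseq vs (b @ bs)" "list_all2 R us vs"
      "length us = rlcs R (a @ as) (b @ bs)"
    using rlcs_witness .
  obtain u1 u2 where u: "us = u1 @ u2" "subseq u1 a" "subseq u2 as"
    using *(1) by (metis subseq_appendE)
  obtain v1 v2 where v: "vs = v1 @ v2" "subseq v1 b" "subseq v2 bs"
    using *(2) by (metis subseq_appendE)
  have len: "length us = length vs" using *(3) by (rule list_all2_lengthD)
  \<comment> \<open>\<open>u1\<close> and \<open>v1\<close> are the matched entries lying in
    \<open>a\<close> and in \<open>b\<close>. The shorter list shows which of the two blocks is left
    first; the other block is cut where the partners of that list end.\<close>
  show ?thesis
  proof (cases "length u1 \<le> length v1")
    case True
    define p z where "p = take (length u1) v1" and "z = drop (length u1) v1"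
    have pz: "v1 = p @ z" "length p = length u1" using True by (auto simp: p_def z_def)
    obtain b1 b2 where b: "b = b1 @ b2" "subseq p b1" "subseq z b2"
      using v(2) pz(1) by (metis list_emb_appendD)
    have R: "list_all2 R u1 p" "list_all2 R u2 (z @ v2)"
      using *(3) u(1) v(1) pz by (auto simp: list_all2_append)
    have "length u1 \<le> rlcs R a b1" using rlcs_ge u(2) b(2) R(1) by metis
    moreover have "length u2 \<le> rlcs R as (b2 @ bs)"
      by (rule rlcs_ge[OF u(3) _ R(2)]) (use b v in \<open>auto intro: list_emb_append_mono\<close>)
    ultimately show ?thesis using left[OF b(1)] *(4) u(1) by simp
  next
    case False
    define p z where "p = take (length v1) u1" and "z = drop (length v1) u1"
    have pz: "u1 = p @ z" "length p = length v1" using False by (auto simp: p_def z_def)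
    obtain a1 a2 where a: "a = a1 @ a2" "subseq p a1" "subseq z a2"
      using u(2) pz(1) by (metis list_emb_appendD)
    have R: "list_all2 R p v1" "list_all2 R (z @ u2) v2"
      using *(3) u(1) v(1) pz by (auto simp: list_all2_append)
    have "length p \<le> rlcs R a1 b" using rlcs_ge v(2) a(2) R(1) by metis
    moreover have "length (z @ u2) \<le> rlcs R (a2 @ as) bs"
      by (rule rlcs_ge[OF _ v(3) R(2)]) (use a u in \<open>auto intro: list_emb_append_mono\<close>)
    ultimately show ?thesis using right[OF a(1)] *(4) u(1) pz by simp
  qed
qed

text \<open>Asking the bound of all sublists lets the relation pass to the remainders of blocks that
  \<open>rlcs_append_cases\<close> leaves behind. The constant \<open>c\<close> is the price of one
  cell of the staircase, however small the pieces in it.\<close>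

definition separated :: "('a \<Rightarrow> 'b \<Rightarrow> bool) \<Rightarrow> real \<Rightarrow> real \<Rightarrow> 'a list \<Rightarrow> 'b list \<Rightarrow> bool" where
  "separated R g c a b \<longleftrightarrow> (\<forall>a' b'. sublist a' a \<longrightarrow> sublist b' b \<longrightarrow>
     real (rlcs R a' b') \<le> g * real (length a' + length b') + c)"

lemma separated_sublist:
  "separated R g c a b \<Longrightarrow> sublist a' a \<Longrightarrow> sublist b' b \<Longrightarrow> separated R g c a' b'"
  unfolding separated_def by (meson sublist_order.order_trans)

text \<open>Follow the staircase of cells visited by a common subsequence. At a cell whose blocks are not
  separated, drop both blocks: this costs at most \<open>2 * h\<close> and extends a chain in the block sequences.\<close>

lemma rlcs_concat_le:
  fixes g c h :: real
  assumes "g \<ge> 0" "c \<ge> 0" "h \<ge> 0"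
    and "\<And>a. a \<in> set As \<Longrightarrow> real (length a) \<le> h" "\<And>b. b \<in> set Bs \<Longrightarrow> real (length b) \<le> h"
  shows "real (rlcs R (concat As) (concat Bs)) \<le>
    g * real (length (concat As) + length (concat Bs)) + c * real (length As + length Bs) +
    2 * h * real (rlcs (\<lambda>a b. \<not> separated R g c a b) As Bs)"
  using assms(4,5)
proof (induction "length As + length Bs" arbitrary: As Bs rule: less_induct)
  case less
  note nn = assms(1-3)
  let ?S = "\<lambda>a b. \<not> separated R g c a b"
  let ?bd = "\<lambda>As Bs. g * real (length (concat As) + length (concat Bs)) + c * real (length As + length Bs) +
    2 * h * real (rlcs ?S As Bs)"
  have bd_nonneg: "?bd As Bs \<ge> 0"
    using nn by (intro add_nonneg_nonneg mult_nonneg_nonneg) auto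
  show ?case
  proof (cases "As = [] \<or> Bs = []")
    case True
    then show ?thesis using bd_nonneg by auto
  next
    case False
    then obtain a As' b Bs' where A: "As = a # As'" and B: "Bs = b # Bs'" by (meson neq_Nil_conv)
    show ?thesis
    proof (cases "separated R g c a b")
      case False
      have "rlcs R (concat As) (concat Bs) \<le> rlcs R (concat As') (concat Bs) + length a"
        using rlcs_delete1[of "concat As'" "concat As" R "concat Bs"] A by (simp add: list_emb_append2)
      also have "rlcs R (concat As') (concat Bs) \<le> rlcs R (concat As') (concat Bs') + length b"
        using rlcs_delete2[of "concat Bs'" "concat Bs" R "concat As'"] B by (simp add: list_emb_append2)
      finally have 1: "real (rlcs R (concat As) (concat Bs)) \<le>
          real (rlcs R (concat As') (concat Bs')) + real (length a) + real (length b)"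
        by linarith
      have 2: "real (rlcs R (concat As') (concat Bs')) \<le> ?bd As' Bs'"
        by (rule less.hyps) (use A B less.prems in auto)
      have "rlcs ?S As Bs \<ge> Suc (rlcs ?S As' Bs')"
        using False A B by auto
      then have "real (rlcs ?S As Bs) \<ge> 1 + real (rlcs ?S As' Bs')" by simp
      then have "2 * h * real (rlcs ?S As Bs) \<ge> 2 * h * (1 + real (rlcs ?S As' Bs'))"
        using nn by (intro mult_left_mono) auto
      moreover have "g * real (length (concat As) + length (concat Bs)) \<ge>
          g * real (length (concat As') + length (concat Bs'))"
        using nn A B by (intro mult_left_mono) auto
      moreover have "c * real (length As + length Bs) \<ge> c * real (length As' + length Bs')"
        using nn A B by (intro mult_left_mono) auto
      moreover have "real (length a) \<le> h" "real (length b) \<le> h"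
        using less.prems A B by auto
      ultimately show ?thesis using 1 2 by (simp add: distrib_left)
    next
      case sep: True
      show ?thesis
      proof (cases rule: rlcs_append_cases[of b R a "concat As'" "concat Bs'"])
        case (left b1 b2)
        have "real (rlcs R (concat As') (concat (b2 # Bs'))) \<le> ?bd As' (b2 # Bs')"
        proof (rule less.hyps)
          fix b' assume "b' \<in> set (b2 # Bs')"
          then show "real (length b') \<le> h"
            using less.prems(2)[of b] less.prems(2)[of b'] B left(1) by auto
        qed (use A B less.prems in auto)
        moreover have "real (rlcs R a b1) \<le> g * real (length a + length b1) + c"
          using sep left(1) unfolding separated_def by auto
        moreover have "rlcs ?S As' (b2 # Bs') \<le> rlcs ?S As Bs"
        proof -
          have "rlcs ?S As' (b2 # Bs') \<le> rlcs ?S As' (b # Bs')"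
          proof -
            \<comment> \<open>Pairing \<open>b\<close> with its remainder \<open>b2\<close> turns
              the exchange of a list entry into a change of relation, to which
              \<open>rlcs_rel_mono\<close> applies.\<close>
            have "rlcs ?S As' (map snd ((b, b2) # map (\<lambda>x. (x, x)) Bs')) \<le>
                rlcs ?S As' (map fst ((b, b2) # map (\<lambda>x. (x, x)) Bs'))"
              unfolding rlcs_map[of _ id, simplified]
              by (rule rlcs_rel_mono) (auto simp: left(1) intro: separated_sublist)
            then show ?thesis by (simp add: comp_def)
          qed
          also have "\<dots> \<le> rlcs ?S As Bs" unfolding A B by (rule rlcs_le_Cons1)
          finally show ?thesis .
        qed
        then have "2 * h * real (rlcs ?S As' (b2 # Bs')) \<le> 2 * h * real (rlcs ?S As Bs)"
          using nn by (intro mult_left_mono) auto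
        ultimately have "real (rlcs R a b1) + real (rlcs R (concat As') (concat (b2 # Bs'))) \<le> ?bd As Bs"
          using A B left(1) by (simp add: algebra_simps)
        moreover have "real (rlcs R (concat As) (concat Bs)) \<le>
            real (rlcs R a b1) + real (rlcs R (concat As') (concat (b2 # Bs')))"
          using left(2) A B by simp
        ultimately show ?thesis by linarith
      next
        case (right a1 a2)
        have "real (rlcs R (concat (a2 # As')) (concat Bs')) \<le> ?bd (a2 # As') Bs'"
        proof (rule less.hyps)
          fix a' assume "a' \<in> set (a2 # As')"
          then show "real (length a') \<le> h"
            using less.prems(1)[of a] less.prems(1)[of a'] A right(1) by auto
        qed (use A B less.prems in auto)
        moreover have "real (rlcs R a1 b) \<le> g * real (length a1 + length b) + c"
          using sep right(1) unfolding separated_def by auto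
        moreover have "rlcs ?S (a2 # As') Bs' \<le> rlcs ?S As Bs"
        proof -
          have "rlcs ?S (a2 # As') Bs' \<le> rlcs ?S (a # As') Bs'"
          proof -
            have "rlcs ?S (map snd ((a, a2) # map (\<lambda>x. (x, x)) As')) Bs' \<le>
                rlcs ?S (map fst ((a, a2) # map (\<lambda>x. (x, x)) As')) Bs'"
              unfolding rlcs_map[of _ _ _ id, simplified]
              by (rule rlcs_rel_mono) (auto simp: right(1) intro: separated_sublist)
            then show ?thesis by (simp add: comp_def)
          qed
          also have "\<dots> \<le> rlcs ?S As Bs" unfolding A B by (rule rlcs_le_Cons2)
          finally show ?thesis .
        qed
        then have "2 * h * real (rlcs ?S (a2 # As') Bs') \<le> 2 * h * real (rlcs ?S As Bs)"
          using nn by (intro mult_left_mono) auto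
        ultimately have "real (rlcs R a1 b) + real (rlcs R (concat (a2 # As')) (concat Bs')) \<le> ?bd As Bs"
          using A B right(1) by (simp add: algebra_simps)
        moreover have "real (rlcs R (concat As) (concat Bs)) \<le>
            real (rlcs R a1 b) + real (rlcs R (concat (a2 # As')) (concat Bs'))"
          using right(2) A B by simp
        ultimately show ?thesis by linarith
      qed
    qed
  qed
qed

lemma length_le_length_concat: "a \<in> set As \<Longrightarrow> length a \<le> length (concat As)"
  by (induction As) auto

text \<open>A staircase visits at most \<open>length As + length Bs\<close> cells. This is
  \<open>rlcs_concat_le\<close> with rate 0, for which no cell is bad.\<close>

lemma rlcs_concat_le_uniform:
  fixes c :: real
  assumes "c \<ge> 0" "\<And>a b. a \<in> set As \<Longrightarrow> b \<in> set Bs \<Longrightarrow> real (rlcs R a b) \<le> c"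
  shows "real (rlcs R (concat As) (concat Bs)) \<le> c * real (length As + length Bs)"
proof -
  have "separated R 0 c a b" if "a \<in> set As" "b \<in> set Bs" for a b
    unfolding separated_def using assms(2)[OF that]
    by (auto intro!: order_trans[OF _ assms(2)[OF that]] rlcs_mono sublist_imp_subseq)
  then have "rlcs (\<lambda>a b. \<not> separated R 0 c a b) As Bs = 0"
    by (intro rlcs_eq_0) auto
  \<comment> \<open>Any bound on the block lengths will do, as it gets multiplied by 0.\<close>
  moreover define h where "h = real (length (concat As) + length (concat Bs))"
  have "real (rlcs R (concat As) (concat Bs)) \<le>
      0 * real (length (concat As) + length (concat Bs)) + c * real (length As + length Bs) +
      2 * h * real (rlcs (\<lambda>a b. \<not> separated R 0 c a b) As Bs)"
    by (rule rlcs_concat_le) (use assms(1) in \<open>auto simp: h_def dest!: length_le_length_concat\<close>)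
  ultimately show ?thesis by simp
qed

section \<open>Matches and counting\<close>

lemma subseq_map_nth:
  assumes "sorted_wrt (<) is" "\<forall>i \<in> set is. m \<le> i \<and> i < length a"
  shows "subseq (map ((!) a) is) (drop m a)"
  using assms
proof (induction "is" arbitrary: m)
  case (Cons i "is")
  have "subseq (map ((!) a) is) (drop (Suc i) a)"
    by (rule Cons.IH) (use Cons.prems in auto)
  then have "subseq (map ((!) a) (i # is)) (drop i a)"
    using Cons.prems by (simp add: Cons_nth_drop_Suc[symmetric])
  also have "drop i a = drop (i - m) (drop m a)"
    using Cons.prems by simp
  also have "subseq (drop (i - m) (drop m a)) (drop m a)"
    by (metis append_take_drop_id list_emb_append2 subseq_order.order_refl)
  finally show ?case .
qed simp

lemma match_le_rlcs:
  assumes "is_match a b I"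
  shows "length I \<le> rlcs (=) a b"
proof -
  have sorted: "sorted_wrt (\<lambda>u v. fst u < fst v \<and> snd u < snd v) I"
    and I: "\<forall>(i, j) \<in> set I. i < length a \<and> j < length b \<and> a ! i = b ! j"
    using assms by (auto simp: is_match_def)
  have "sorted_wrt (<) (map fst I)" "sorted_wrt (<) (map snd I)"
    using sorted by (auto simp: sorted_wrt_map elim: sorted_wrt_mono_rel[rotated])
  then have "subseq (map ((!) a) (map fst I)) (drop 0 a)" "subseq (map ((!) b) (map snd I)) (drop 0 b)"
    using I by (intro subseq_map_nth; auto)+
  moreover have "list_all2 (=) (map ((!) a) (map fst I)) (map ((!) b) (map snd I))"
    using I by (auto simp: list_all2_conv_all_nth split: prod.splits) (metis nth_mem surjective_pairing)
  ultimately have "length (map ((!) a) (map fst I)) \<le> rlcs (=) (drop 0 a) (drop 0 b)"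
    by (rule rlcs_ge)
  then show ?thesis by simp
qed

lemma ex_match_rlcs: "\<exists>I. is_match a b I \<and> length I = rlcs (=) a b"
proof (induction "(=) :: 'a \<Rightarrow> 'a \<Rightarrow> bool" a b rule: rlcs.induct)
  case (1 ys)
  then show ?case by (intro exI[of _ "[]"]) (auto simp: is_match_def)
next
  case (2 x xs)
  then show ?case by (intro exI[of _ "[]"]) (auto simp: is_match_def)
next
  case (3 x xs y ys)
  let ?B = "rlcs (=) xs (y # ys)" and ?C = "rlcs (=) (x # xs) ys"
  consider "x = y" "max ?B ?C < Suc (rlcs (=) xs ys)"
    | "\<not> (x = y \<and> max ?B ?C < Suc (rlcs (=) xs ys))" "?C \<le> ?B"
    | "\<not> (x = y \<and> max ?B ?C < Suc (rlcs (=) xs ys))" "?B \<le> ?C"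
    by linarith
  then show ?case
  proof cases
    case 1
    then obtain I where "is_match xs ys I" "length I = rlcs (=) xs ys"
      using 3(1) by blast
    then show ?thesis using 1
      by (intro exI[of _ "(0, 0) # map (\<lambda>(i, j). (Suc i, Suc j)) I"])
        (auto simp: is_match_def sorted_wrt_map case_prod_beta)
  next
    case 2
    moreover obtain I where "is_match xs (y # ys) I" "length I = rlcs (=) xs (y # ys)"
      using 3(2) by blast
    ultimately show ?thesis
      by (intro exI[of _ "map (\<lambda>(i, j). (Suc i, j)) I"])
        (auto simp: is_match_def sorted_wrt_map case_prod_beta)
  next
    case 3
    moreover obtain I where "is_match (x # xs) ys I" "length I = rlcs (=) (x # xs) ys"
      using "3.hyps"(3) by blast
    ultimately show ?thesis
      by (intro exI[of _ "map (\<lambda>(i, j). (i, Suc j)) I"])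
        (auto simp: is_match_def sorted_wrt_map case_prod_beta)
  qed
qed

lemma fbar_eq_rlcs: "fbar a b = 1 - 2 * real (rlcs (=) a b) / real (length a + length b)"
proof -
  have "Sup (length ` {I. is_match a b I}) = rlcs (=) a b"
    by (rule cSup_eq_maximum) (use ex_match_rlcs[of a b] match_le_rlcs in \<open>force+\<close>)
  then show ?thesis by (simp add: fbar_def)
qed

lemma fbar_le_1: "fbar a b \<le> 1"
  by (simp add: fbar_eq_rlcs)

lemma fbar_nonneg: "fbar a b \<ge> 0"
proof -
  have "2 * rlcs (=) a b \<le> length a + length b"
    using rlcs_le_length1[of "(=)" a b] rlcs_le_length2[of "(=)" a b] by linarith
  then have "2 * real (rlcs (=) a b) / real (length a + length b) \<le> 1"
    by (cases "length a + length b = 0") (simp_all add: field_simps flip: of_nat_add)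
  then show ?thesis by (simp add: fbar_eq_rlcs)
qed

lemma fbar_map_inj:
  assumes "inj f"
  shows "fbar (map f a) (map f b) = fbar a b"
proof -
  have "rlcs (=) (map f a) (map f b) = rlcs (\<lambda>x y. f x = f y) a b"
    by (rule rlcs_map)
  also have "(\<lambda>x y. f x = f y) = (=)"
    using assms by (auto simp: inj_def fun_eq_iff)
  finally show ?thesis by (simp add: fbar_eq_rlcs)
qed

lemma rlcs_blocks_ge:
  assumes "length u = r * K" "length v = r * K"
  shows "(\<Sum>i<r. rlcs R (take K (drop (i * K) u)) (take K (drop (i * K) v))) \<le> rlcs R u v"
  using assms
proof (induction r arbitrary: u v)
  case (Suc r)
  have "(\<Sum>i<Suc r. rlcs R (take K (drop (i * K) u)) (take K (drop (i * K) v))) =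
      rlcs R (take K u) (take K v) +
      (\<Sum>i<r. rlcs R (take K (drop (i * K) (drop K u))) (take K (drop (i * K) (drop K v))))"
    by (subst sum.lessThan_Suc_shift) (simp add: add.commute)
  also have "\<dots> \<le> rlcs R (take K u) (take K v) + rlcs R (drop K u) (drop K v)"
    by (intro add_left_mono Suc.IH) (use Suc.prems in auto)
  also have "\<dots> \<le> rlcs R u v"
    using rlcs_append_ge[of R "take K u" "take K v" "drop K u" "drop K v"] by simp
  finally show ?case .
qed simp

text \<open>Matching corresponding blocks separately is one way of matching the whole
  strings.\<close>

lemma fbar_le_average:
  assumes "length u = r * K" "length v = r * K" "K > 0" "r > 0"
  shows "fbar u v \<le> (\<Sum>i<r. fbar (take K (drop (i * K) u)) (take K (drop (i * K) v))) / real r"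
proof -
  have len: "length (take K (drop (i * K) u)) = K" "length (take K (drop (i * K) v)) = K" if "i < r" for i
  proof -
    have "Suc i * K \<le> r * K" using that by (intro mult_right_mono) auto
    then show "length (take K (drop (i * K) u)) = K" "length (take K (drop (i * K) v)) = K"
      using assms by auto
  qed
  let ?c = "\<lambda>i. real (rlcs (=) (take K (drop (i * K) u)) (take K (drop (i * K) v)))"
  have "(\<Sum>i<r. fbar (take K (drop (i * K) u)) (take K (drop (i * K) v))) =
      (\<Sum>i<r. 1 - ?c i / real K)"
    using assms(3) by (intro sum.cong refl) (simp add: fbar_eq_rlcs len del: length_take)
  also have "\<dots> = real r - (\<Sum>i<r. ?c i) / real K"
    by (simp add: sum_subtractf sum_divide_distrib)
  also have "(\<Sum>i<r. ?c i) \<le> real (rlcs (=) u v)"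
    using rlcs_blocks_ge[OF assms(1,2), of "(=)"] by (simp flip: of_nat_sum)
  then have "real r - (\<Sum>i<r. ?c i) / real K \<ge> real r - real (rlcs (=) u v) / real K"
    by (simp add: divide_right_mono)
  finally have "real r - real (rlcs (=) u v) / real K \<le>
      (\<Sum>i<r. fbar (take K (drop (i * K) u)) (take K (drop (i * K) v)))" .
  then have "(real r - real (rlcs (=) u v) / real K) / real r \<le>
      (\<Sum>i<r. fbar (take K (drop (i * K) u)) (take K (drop (i * K) v))) / real r"
    by (rule divide_right_mono) simp
  moreover have "(real r - real (rlcs (=) u v) / real K) / real r = fbar u v"
    using assms by (simp add: fbar_eq_rlcs field_simps)
  ultimately show ?thesis by simp
qed

text \<open>Since \<open>rlcs\<close> is a maximum of three terms at each step, the union bound amounts to a sum over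
  the at most \<open>3 ^ (length xs + q)\<close> lattice paths.\<close>

lemma card_rlcs_ge:
  assumes "finite Y" "\<And>x. x \<in> set xs \<Longrightarrow> card {y \<in> Y. R x y} \<le> d"
  shows "card {us. set us \<subseteq> Y \<and> length us = q \<and> m \<le> rlcs R xs us} * card Y ^ m
    \<le> 3 ^ (length xs + q) * d ^ m * card Y ^ q"
  using assms(2)
proof (induction xs arbitrary: q m)
  case Nil
  show ?case
  proof (cases m)
    case 0
    then show ?thesis using assms(1) by (simp add: card_lists_length_eq)
  qed simp
next
  case (Cons x xs)
  note IH_xs = Cons.IH[OF Cons.prems[OF list.set_intros(2)]]
  let ?S = "\<lambda>xs q m. {us. set us \<subseteq> Y \<and> length us = q \<and> m \<le> rlcs R xs us}"
  have fin: "finite (?S xs q m)" for xs q m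
    by (rule finite_subset[OF _ finite_lists_length_eq[OF assms(1), of q]]) auto
  show ?case
  proof (induction q arbitrary: m)
    case 0
    show ?case
    proof (cases m)
      case 0
      have "?S (x # xs) 0 0 = {[]}" by auto
      then show ?thesis unfolding 0 by simp
    next
      case (Suc m')
      have "?S (x # xs) 0 m = {}" unfolding Suc by auto
      then show ?thesis by (simp only: card.empty mult_zero_left le0)
    qed
  next
    case (Suc q)
    show ?case
    proof (cases m)
      case 0
      then show ?thesis using assms(1) by (simp add: card_lists_length_eq)
    next
      case (Suc m')
      let ?A = "(\<lambda>(y, us). y # us) ` ({y \<in> Y. R x y} \<times> ?S xs q m')"
      let ?B = "?S xs (Suc q) m"
      let ?C = "(\<lambda>(y, us). y # us) ` (Y \<times> ?S (x # xs) q m)"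
      have "?S (x # xs) (Suc q) m \<subseteq> ?A \<union> ?B \<union> ?C"
      proof
        fix us assume us: "us \<in> ?S (x # xs) (Suc q) m"
        then obtain y vs where "us = y # vs" by (cases us) auto
        then show "us \<in> ?A \<union> ?B \<union> ?C"
          using us Suc by (auto simp: le_max_iff_disj split: if_splits)
      qed
      then have "card (?S (x # xs) (Suc q) m) \<le> card (?A \<union> ?B \<union> ?C)"
        using fin assms(1) by (intro card_mono) auto
      also have "\<dots> \<le> card ?A + card ?B + card ?C"
        by (meson add_le_mono1 card_Un_le order_trans)
      also have "card ?A \<le> card {y \<in> Y. R x y} * card (?S xs q m')"
        using card_image_le[of "{y \<in> Y. R x y} \<times> ?S xs q m'"] fin[of q m' xs] assms(1)
        by (simp add: card_cartesian_product)
      also have "\<dots> \<le> d * card (?S xs q m')"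
        by (intro mult_right_mono Cons.prems) auto
      also have "card ?C \<le> card Y * card (?S (x # xs) q m)"
        using card_image_le[of "Y \<times> ?S (x # xs) q m"] fin[of q m "x # xs"] assms(1)
        by (simp add: card_cartesian_product)
      finally have "card (?S (x # xs) (Suc q) m) * card Y ^ m \<le>
          (d * card (?S xs q m') + card ?B + card Y * card (?S (x # xs) q m)) * card Y ^ m"
        by (rule mult_right_mono) auto
      also have "\<dots> = d * card Y * (card (?S xs q m') * card Y ^ m') + card ?B * card Y ^ m +
          card Y * (card (?S (x # xs) q m) * card Y ^ m)"
        by (simp add: Suc algebra_simps)
      also have "\<dots> \<le> d * card Y * (3 ^ (length xs + q) * d ^ m' * card Y ^ q) +
          3 ^ (length xs + Suc q) * d ^ m * card Y ^ Suc q +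
          card Y * (3 ^ (length (x # xs) + q) * d ^ m * card Y ^ q)"
        by (intro add_mono mult_left_mono IH_xs Suc.IH) auto
      \<comment> \<open>The move that matches \<open>x\<close> contributes 1 and each of the two
        moves that drop a head contributes 3; the target allows \<open>3 ^ 2\<close>, as both
        lengths grow by one.\<close>
      also have "\<dots> = 7 * (3 ^ (length xs + q) * d ^ m * card Y ^ Suc q)"
        by (simp add: Suc algebra_simps)
      also have "\<dots> \<le> 9 * (3 ^ (length xs + q) * d ^ m * card Y ^ Suc q)"
        by simp
      also have "\<dots> = 3 ^ (length (x # xs) + Suc q) * d ^ m * card Y ^ Suc q"
        by simp
      finally show ?thesis .
    qed
  qed
qed

section \<open>Words with bounded letter counts\<close>

lemma power_self_le_fact: "n ^ n \<le> 3 ^ n * fact n"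
proof (induction n)
  case (Suc n)
  have "(n + 1) ^ n \<le> 3 * n ^ n"
  proof (cases "n = 0")
    case False
    have "(1 + 1 / real n) ^ n \<le> exp (1 / real n) ^ n"
      by (intro power_mono) (auto simp: exp_ge_add_one_self)
    also have "\<dots> = exp 1"
      using False by (simp flip: exp_of_nat_mult)
    also have "\<dots> \<le> 3" by (rule exp_le)
    finally have "(1 + 1 / real n) ^ n * real n ^ n \<le> 3 * real n ^ n"
      by (intro mult_right_mono) auto
    moreover have "(1 + 1 / real n) ^ n * real n ^ n = (real n + 1) ^ n"
      using False by (simp flip: power_mult_distrib add: field_simps)
    ultimately have "real ((n + 1) ^ n) \<le> real (3 * n ^ n)" by (simp add: add.commute)
    then show ?thesis by (simp only: of_nat_le_iff)
  qed simp
  then have "(n + 1) * (n + 1) ^ n \<le> (n + 1) * (3 * n ^ n)" by (rule mult_left_mono) simp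
  also have "\<dots> \<le> (n + 1) * (3 * (3 ^ n * fact n))"
    using Suc by (intro mult_left_mono) auto
  finally show ?case by (simp add: algebra_simps)
qed simp

lemma card_below_capacity:
  assumes "finite S" "set u \<subseteq> S" "q > 0"
  shows "card S - length u div q \<le> card {a \<in> S. count_list u a < q}"
proof -
  let ?F = "{a \<in> S. q \<le> count_list u a}"
  have "card ?F * q = (\<Sum>a\<in>?F. q)" by simp
  also have "\<dots> \<le> (\<Sum>a\<in>?F. count_list u a)" by (rule sum_mono) auto
  also have "\<dots> \<le> (\<Sum>a\<in>S. count_list u a)" by (rule sum_mono2) (use assms in auto)
  also have "\<dots> = length u" using assms by (simp add: sum_count_set)
  finally have "card ?F \<le> length u div q"
    using assms(3) by (simp add: less_eq_div_iff_mult_less_eq)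
  moreover have "card ?F + card {a \<in> S. count_list u a < q} = card S"
    using assms(1) by (subst card_Un_disjoint[symmetric]) (auto intro: arg_cong[where f = card])
  ultimately show ?thesis by linarith
qed

lemma prod_falling_div: "(\<Prod>s<n * q. Y - s div q) = (\<Prod>i<n. (Y - i :: nat)) ^ q"
proof (induction n)
  case (Suc n)
  have "{..<Suc n * q} = {..<n * q} \<union> {n * q..<n * q + q}" by auto
  then have "(\<Prod>s<Suc n * q. Y - s div q) =
      (\<Prod>s<n * q. Y - s div q) * (\<Prod>s\<in>{n * q..<n * q + q}. Y - s div q)"
    by (simp add: prod.union_disjoint ivl_disj_int)
  also have "(\<Prod>s\<in>{n * q..<n * q + q}. Y - s div q) = (\<Prod>s\<in>{n * q..<n * q + q}. Y - n)"
    by (intro prod.cong refl arg_cong[of _ n "(-) Y"] div_nat_eqI) (auto simp: mult.commute)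
  finally show ?case by (simp add: Suc power_mult_distrib)
qed simp

text \<open>Build the word letter by letter: after \<open>s\<close> letters at most
  \<open>s div q\<close> of the symbols are full, which leaves at least
  \<open>card S - s div q\<close> choices. Over the maximal length \<open>card S * q\<close> these
  numbers multiply to \<open>fact (card S) ^ q\<close>, and the crude Stirling bound turns this into
  a loss of at most \<open>3 ^ (card S * q)\<close>.\<close>

lemma card_bounded_counts_ge:
  assumes "finite S" "q > 0" "t \<le> card S * q"
  shows "card S ^ t \<le>
    card {u. set u \<subseteq> S \<and> length u = t \<and> (\<forall>a \<in> S. count_list u a \<le> q)} * 3 ^ (card S * q)"
proof -
  let ?Y = "card S"
  let ?A = "\<lambda>t. {u. set u \<subseteq> S \<and> length u = t \<and> (\<forall>a \<in> S. count_list u a \<le> q)}"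
  have fin: "finite (?A t)" for t
    by (rule finite_subset[OF _ finite_lists_length_eq[OF assms(1), of t]]) auto
  have falling: "(\<Prod>s<t. ?Y - s div q) \<le> card (?A t)" for t
  proof (induction t)
    case 0
    have "?A 0 = {[]}" by auto
    then show ?case by simp
  next
    case (Suc t)
    let ?B = "Sigma (?A t) (\<lambda>u. {a \<in> S. count_list u a < q})"
    have "(\<Prod>s<Suc t. ?Y - s div q) \<le> card (?A t) * (?Y - t div q)"
      using Suc by simp
    also have "\<dots> = (\<Sum>u\<in>?A t. ?Y - t div q)" by simp
    also have "\<dots> \<le> (\<Sum>u\<in>?A t. card {a \<in> S. count_list u a < q})"
      using card_below_capacity[OF assms(1) _ assms(2)] by (intro sum_mono) auto
    also have "\<dots> = card ?B"
      using fin assms(1) by (subst card_SigmaI) auto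
    also have "\<dots> = card ((\<lambda>(u, a). a # u) ` ?B)"
      by (rule card_image[symmetric]) (auto simp: inj_on_def)
    also have "\<dots> \<le> card (?A (Suc t))"
      by (rule card_mono) (use fin[of "Suc t"] in auto)
    finally show ?case .
  qed
  show ?thesis
  proof (cases "?Y = 0")
    case True
    then show ?thesis using falling[of t] assms(3) by simp
  next
    case False
    have "?Y ^ (?Y * q) = (?Y ^ ?Y) ^ q" by (rule power_mult)
    also have "\<dots> \<le> (3 ^ ?Y * fact ?Y) ^ q" by (rule power_mono[OF power_self_le_fact]) simp
    also have "\<dots> = 3 ^ (?Y * q) * (fact ?Y) ^ q" by (simp add: power_mult_distrib power_mult)
    also have "(fact ?Y :: nat) ^ q = (\<Prod>s<?Y * q. ?Y - s div q)"
      unfolding prod_falling_div by (simp add: fact_prod_rev lessThan_atLeast0)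
    also have "{..<?Y * q} = {..<t} \<union> {t..<?Y * q}" using assms(3) by auto
    then have "(\<Prod>s<?Y * q. ?Y - s div q) =
        (\<Prod>s<t. ?Y - s div q) * (\<Prod>s\<in>{t..<?Y * q}. ?Y - s div q)"
      by (simp add: prod.union_disjoint ivl_disj_int)
    \<comment> \<open>The factors from position \<open>t\<close> on are at most
      \<open>card S\<close> each and cancel against the surplus powers on the left.\<close>
    also have "\<dots> \<le> card (?A t) * (\<Prod>s\<in>{t..<?Y * q}. ?Y)"
      by (intro mult_mono falling prod_mono) auto
    finally have "?Y ^ (?Y * q) \<le> 3 ^ (?Y * q) * card (?A t) * ?Y ^ (?Y * q - t)"
      by (simp add: mult.assoc)
    moreover have "?Y ^ (?Y * q) = ?Y ^ t * ?Y ^ (?Y * q - t)"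
      using assms(3) by (simp flip: power_add)
    ultimately show ?thesis using False by (simp add: mult.commute)
  qed
qed

section \<open>The words of the construction sequence\<close>

lemma count_list_concat: "count_list (concat xss) x = (\<Sum>xs\<leftarrow>xss. count_list xs x)"
  by (induction xss) auto

lemma count_list_replicate_if: "count_list (replicate n x) y = (if x = y then n else 0)"
  by (induction n) auto

lemma sum_list_map_eq_sum_count_list:
  fixes f :: "'a \<Rightarrow> real"
  assumes "finite X" "set xs \<subseteq> X"
  shows "(\<Sum>x\<leftarrow>xs. f x) = (\<Sum>x\<in>X. real (count_list xs x) * f x)"
  using assms(2)
proof (induction xs)
  case (Cons a xs)
  have "(\<Sum>x\<in>X. real (count_list (a # xs) x) * f x) =
      (\<Sum>x\<in>X. real (count_list xs x) * f x + (if a = x then f x else 0))"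
    by (intro sum.cong refl) (auto simp: algebra_simps)
  then show ?case using Cons assms(1) by (simp add: sum.distrib sum.delta)
qed simp

definition sorted_runs :: "(nat \<Rightarrow> 'b) \<Rightarrow> nat \<Rightarrow> (nat \<Rightarrow> nat) \<Rightarrow> 'b list" where
  "sorted_runs y N r = concat (map (\<lambda>i. replicate (r i) (y i)) [1..<N])"

lemma length_sorted_runs: "length (sorted_runs y N r) = (\<Sum>i\<in>{1..<N}. r i)"
  by (simp add: sorted_runs_def length_concat comp_def sum_list_distinct_conv_sum_set)

lemma count_sorted_runs:
  assumes "inj_on y {1..N}" "i \<in> {1..N}"
  shows "count_list (sorted_runs y N r) (y i) = (if i < N then r i else 0)"
proof -
  have "count_list (sorted_runs y N r) (y i) = (\<Sum>j\<in>{1..<N}. if y j = y i then r j else 0)"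
    by (simp add: sorted_runs_def count_list_concat comp_def count_list_replicate_if
        sum_list_distinct_conv_sum_set)
  also have "\<dots> = (\<Sum>j\<in>{1..<N}. if j = i then r j else 0)"
    by (intro sum.cong refl) (use assms in \<open>simp add: inj_on_eq_iff[OF assms(1)]\<close>)
  also have "\<dots> = (if i < N then r i else 0)" using assms(2) by auto
  finally show ?thesis .
qed

definition completion :: "(nat \<Rightarrow> 'b) \<Rightarrow> nat \<Rightarrow> nat \<Rightarrow> 'b list \<Rightarrow> 'b list" where
  "completion y N k u =
     sorted_runs y N (\<lambda>i. k div N - count_list u (y i)) @ replicate (k div N) (y N)"

text \<open>The words \<open>u\<close> of \<open>next_words\<close>; they determine the remaining blocks.\<close>

definition free_parts :: "(nat \<Rightarrow> 'b) \<Rightarrow> nat \<Rightarrow> real \<Rightarrow> nat \<Rightarrow> 'b list set" where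
  "free_parts y N \<epsilon> k = {u. set u \<subseteq> y ` {1..N - 1} \<and> length u = k_prime \<epsilon> k \<and>
     (\<forall>a \<in> y ` {1..N - 1}. count_list u a \<le> k div N)}"

text \<open>Equal counts force \<open>r i\<close> to be \<open>k div N\<close> minus the count in
  \<open>u\<close>. This removes the existential run lengths and parametrises the (n+1)-blocks by
  their free parts.\<close>

lemma next_words_eq:
  assumes inj: "inj_on y {1..N}" and N: "N \<ge> 1" "N dvd k"
  shows "next_words y N \<epsilon> k = (\<lambda>u. concat (u @ completion y N k u)) ` free_parts y N \<epsilon> k"
    and "u \<in> free_parts y N \<epsilon> k \<Longrightarrow> length (u @ completion y N k u) = k"
    and "u \<in> free_parts y N \<epsilon> k \<Longrightarrow> a \<in> y ` {1..N} \<Longrightarrow>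
      count_list (u @ completion y N k u) a = k div N"
proof -
  let ?q = "k div N"
  have ivl: "{1..<N} = {1..N - 1}" using N(1) by auto
  have yN: "y N \<notin> y ` {1..N - 1}"
    using inj_on_image_mem_iff[OF inj, of N "{1..N - 1}"] N(1) by auto
  have len: "length (u @ completion y N k u) = k" if u: "u \<in> free_parts y N \<epsilon> k" for u
  proof -
    have "(\<Sum>i\<in>{1..N-1}. count_list u (y i)) = (\<Sum>a\<in>y ` {1..N-1}. count_list u a)"
      by (rule sum.reindex[symmetric, unfolded comp_def]) (rule inj_on_subset[OF inj], auto)
    also have "\<dots> = length u" using u by (intro sum_count_set) (auto simp: free_parts_def)
    finally have counts: "(\<Sum>i\<in>{1..N-1}. count_list u (y i)) = length u" .
    have "length (u @ completion y N k u) =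
        (\<Sum>i\<in>{1..N-1}. count_list u (y i)) + (\<Sum>i\<in>{1..N-1}. ?q - count_list u (y i)) + ?q"
      unfolding counts completion_def length_append length_sorted_runs length_replicate ivl by simp
    also have "\<dots> = (\<Sum>i\<in>{1..N-1}. count_list u (y i) + (?q - count_list u (y i))) + ?q"
      by (simp add: sum.distrib)
    also have "\<dots> = (\<Sum>i\<in>{1..N-1}. ?q) + ?q"
      by (intro arg_cong2[of _ _ _ _ "(+)"] sum.cong refl) (use u in \<open>auto simp: free_parts_def\<close>)
    also have "\<dots> = (N - 1 + 1) * ?q" unfolding add_mult_distrib by simp
    also have "\<dots> = k" using N by simp
    finally show ?thesis .
  qed
  have cnt: "count_list (u @ completion y N k u) a = ?q"
    if u: "u \<in> free_parts y N \<epsilon> k" and a: "a \<in> y ` {1..N}" for u a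
  proof -
    obtain i where i: "i \<in> {1..N}" "a = y i" using a by auto
    have yy: "y N = y i \<longleftrightarrow> i = N" using inj_on_eq_iff[OF inj] i N(1) by auto
    have eq: "count_list (u @ completion y N k u) a =
        count_list u (y i) + (if i < N then ?q - count_list u (y i) else 0) + (if i = N then ?q else 0)"
      using count_sorted_runs[OF inj i(1)] yy
      by (simp add: i(2) completion_def count_list_replicate_if)
    show ?thesis
    proof (cases "i = N")
      case True
      then have "y i \<notin> set u" using yN u by (auto simp: free_parts_def)
      then show ?thesis using eq True by (simp add: count_list_0_iff)
    next
      case False
      then have "count_list u (y i) \<le> ?q" using u i by (auto simp: free_parts_def)
      then show ?thesis using eq False i by auto
    qed
  qed
  show "u \<in> free_parts y N \<epsilon> k \<Longrightarrow> length (u @ completion y N k u) = k" by (rule len)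
  show "u \<in> free_parts y N \<epsilon> k \<Longrightarrow> a \<in> y ` {1..N} \<Longrightarrow>
      count_list (u @ completion y N k u) a = k div N" by (rule cnt)
  show "next_words y N \<epsilon> k = (\<lambda>u. concat (u @ completion y N k u)) ` free_parts y N \<epsilon> k"
  proof (intro equalityI subsetI)
    fix w assume "w \<in> next_words y N \<epsilon> k"
    then obtain ws u r where w: "w = concat ws"
      and ws: "ws = u @ sorted_runs y N r @ replicate ?q (y N)"
      and u: "length u = k_prime \<epsilon> k" "set u \<subseteq> y ` {1..N - 1}"
        "\<forall>i \<in> {1..N - 1}. count_list u (y i) \<le> ?q"
      and c: "\<forall>i \<in> {1..N}. count_list ws (y i) = ?q"
      unfolding next_words_def sorted_runs_def mem_Collect_eq by blast
    have "r i = ?q - count_list u (y i)" if "i \<in> {1..<N}" for i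
    proof -
      have "y N \<noteq> y i" using inj_on_eq_iff[OF inj, of N i] that by auto
      then have "count_list u (y i) + r i = ?q"
        using bspec[OF c, of i] that count_sorted_runs[OF inj, of i r] unfolding ws
        by (auto simp: count_list_replicate_if)
      then show ?thesis by simp
    qed
    then have "sorted_runs y N r = sorted_runs y N (\<lambda>i. ?q - count_list u (y i))"
      unfolding sorted_runs_def by (intro arg_cong[where f = concat] map_cong) auto
    then have "w = concat (u @ completion y N k u)"
      unfolding w ws completion_def by simp
    moreover have "u \<in> free_parts y N \<epsilon> k" using u by (auto simp: free_parts_def)
    ultimately show "w \<in> (\<lambda>u. concat (u @ completion y N k u)) ` free_parts y N \<epsilon> k" by blast
  next
    fix w assume "w \<in> (\<lambda>u. concat (u @ completion y N k u)) ` free_parts y N \<epsilon> k"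
    then obtain u where u: "u \<in> free_parts y N \<epsilon> k" and w: "w = concat (u @ completion y N k u)"
      by auto
    then show "w \<in> next_words y N \<epsilon> k"
      unfolding next_words_def using len[OF u] cnt[OF u]
      by (intro CollectI exI[of _ "u @ completion y N k u"] exI[of _ u]
          exI[of _ "\<lambda>i. k div N - count_list u (y i)"])
        (auto simp: completion_def sorted_runs_def free_parts_def)
  qed
qed

lemma set_completion:
  assumes "N \<ge> 1"
  shows "set (completion y N k u) \<subseteq> y ` {1..N}"
  using assms by (auto simp: completion_def sorted_runs_def)

text \<open>All blocks have the same length, so a concatenation can be cut back into its blocks, and
  \<open>u\<close> is an initial part of known length.\<close>

lemma inj_on_concat_completion:
  assumes "N \<ge> 1" "\<And>a. a \<in> y ` {1..N} \<Longrightarrow> length a = h" "h > 0"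
    "\<And>u. u \<in> free_parts y N \<epsilon> k \<Longrightarrow> length (u @ completion y N k u) = k"
  shows "inj_on (\<lambda>u. concat (u @ completion y N k u)) (free_parts y N \<epsilon> k)"
proof (rule inj_onI)
  fix u v
  assume uv: "u \<in> free_parts y N \<epsilon> k" "v \<in> free_parts y N \<epsilon> k"
    and eq: "concat (u @ completion y N k u) = concat (v @ completion y N k v)"
  have len: "length a = h" if "a \<in> set (u @ completion y N k u)" "u \<in> free_parts y N \<epsilon> k" for a u
  proof -
    have "y ` {1..N - 1} \<subseteq> y ` {1..N}" by (intro image_mono) auto
    then have "a \<in> y ` {1..N}"
      using that set_completion[OF assms(1), of y k u] unfolding free_parts_def set_append by blast
    then show ?thesis using assms(2) by blast
  qed
  have "u @ completion y N k u = v @ completion y N k v"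
  proof (rule concat_injective[OF eq])
    show "length (u @ completion y N k u) = length (v @ completion y N k v)"
      using assms(4) uv by simp
    show "\<forall>(x, y) \<in> set (zip (u @ completion y N k u) (v @ completion y N k v)). length x = length y"
      using len uv by (metis (mono_tags, lifting) case_prodI2 set_zip_leftD set_zip_rightD)
  qed
  moreover have "length u = length v" using uv by (simp add: free_parts_def)
  ultimately show "u = v" by simp
qed

lemma take_drop_concat:
  assumes "\<And>w. w \<in> set ws \<Longrightarrow> length w = h"
  shows "map (\<lambda>j. take h (drop (j * h) (concat ws))) [0..<length ws] = ws"
  using assms
proof (induction ws)
  case (Cons w ws)
  have "map (\<lambda>j. take h (drop (j * h) (concat (w # ws)))) [0..<length (w # ws)] =
      take h (concat (w # ws)) # map (\<lambda>j. take h (drop (Suc j * h) (concat (w # ws)))) [0..<length ws]"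
    by (simp add: map_upt_Suc del: upt_Suc)
  also have "\<dots> = w # map (\<lambda>j. take h (drop (j * h) (concat ws))) [0..<length ws]"
    using Cons.prems by auto
  finally show ?case using Cons by simp
qed simp

lemma length_concat_const:
  assumes "\<And>w. w \<in> set ws \<Longrightarrow> length w = h"
  shows "length (concat ws) = length ws * h"
  using assms by (induction ws) auto

section \<open>The construction with its thresholds, and the sizes of its block sets\<close>

locale E_system =
  fixes \<Sigma> :: "'a set" and \<epsilon> :: "nat \<Rightarrow> real" and k l :: "nat \<Rightarrow> nat"
    and y :: "nat \<Rightarrow> nat \<Rightarrow> 'a list" and W :: "nat \<Rightarrow> 'a list set"
  assumes fin_alphabet: "finite \<Sigma>"
    and E_seq: "E_sequence \<Sigma> \<epsilon> k y W"
    and E_par: "E_parameters \<epsilon> k (\<lambda>n. card (W n))"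
    and l_large: "l n > 2 ^ (n + 10)"
    and alphabet_large: "card \<Sigma> \<ge> 54 ^ 128 + 1"
    and k_large: "k n \<ge> 2 ^ (n + 12)"
begin

abbreviation N :: "nat \<Rightarrow> nat" where "N n \<equiv> card (W n)"
abbreviation q :: "nat \<Rightarrow> nat" where "q n \<equiv> circ_q k l n"
abbreviation c :: "nat \<Rightarrow> 'a list \<Rightarrow> 'a circ_symbol list" where "c n \<equiv> circ_map k l n"
abbreviation block_length :: "nat \<Rightarrow> nat" where "block_length n \<equiv> (\<Prod>i<n. k i)"
abbreviation free_length :: "nat \<Rightarrow> nat" where "free_length n \<equiv> k_prime (\<epsilon> n) (k n)"
abbreviation free_blocks :: "nat \<Rightarrow> 'a list set" where "free_blocks n \<equiv> y n ` {1..N n - 1}"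

lemma eps_bounds: "0 < \<epsilon> n" "\<epsilon> n < 1 / 2 ^ (n + 12)" "\<epsilon> n < 1" "\<epsilon> n * real (N n) > 2"
proof -
  show *: "0 < \<epsilon> n" "\<epsilon> n < 1 / 2 ^ (n + 12)" "\<epsilon> n * real (N n) > 2"
    using E_par by (auto simp: E_parameters_def)
  have "(1::real) / 2 ^ (n + 12) \<le> 1" by simp
  then show "\<epsilon> n < 1" using * by linarith
qed

lemma N_ge: "N n \<ge> 3"
proof -
  have "\<epsilon> n * real (N n) \<le> 1 * real (N n)"
    using eps_bounds(3)[of n] by (intro mult_right_mono) auto
  then show ?thesis using eps_bounds(4)[of n] by linarith
qed

lemma finite_W [simp]: "finite (W n)"
  using N_ge[of n] card_ge_0_finite[of "W n"] by simp

lemma W_nonempty: "W n \<noteq> {}"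
  using N_ge[of n] by auto

lemma k_pos: "k n > 0"
  using k_large[of n] by (metis gr0I not_one_le_zero one_le_numeral one_le_power order_trans)

lemma l_ge: "l n \<ge> 2" "l n > 0"
proof -
  have "(2::nat) ^ (n + 10) \<ge> 2 ^ 1" by (rule power_increasing) auto
  then show "l n \<ge> 2" using l_large[of n] by simp
  then show "l n > 0" by simp
qed

lemma N_dvd: "N n dvd k n"
  using E_par by (auto simp: E_parameters_def)

lemma q_pos: "q n > 0"
  by (induction n) (auto simp: k_pos l_ge)

lemma block_length_pos: "block_length n > 0"
  by (auto simp: prod_pos k_pos)

lemma bij_y: "bij_betw (y n) {1..N n} (W n)"
  using E_seq by (auto simp: E_sequence_def)

lemma inj_y: "inj_on (y n) {1..N n}"
  using bij_y by (rule bij_betw_imp_inj_on)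

lemma y_image: "y n ` {1..N n} = W n"
  using bij_y by (rule bij_betw_imp_surj_on)

lemma free_blocks_subset: "free_blocks n \<subseteq> W n"
proof -
  have "free_blocks n \<subseteq> y n ` {1..N n}" by (intro image_mono) auto
  then show ?thesis by (simp only: y_image)
qed

lemma card_free_blocks: "card (free_blocks n) = N n - 1"
  using card_image[OF inj_on_subset[OF inj_y, of "{1..N n - 1}" n]] by simp

lemma W_Suc: "W (Suc n) = next_words (y n) (N n) (\<epsilon> n) (k n)"
  using E_seq by (auto simp: E_sequence_def)

abbreviation free :: "nat \<Rightarrow> 'a list list set" where
  "free n \<equiv> free_parts (y n) (N n) (\<epsilon> n) (k n)"
abbreviation full :: "nat \<Rightarrow> 'a list list \<Rightarrow> 'a list list" where
  "full n u \<equiv> u @ completion (y n) (N n) (k n) u"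

lemma N_ge_1: "N n \<ge> 1"
  using N_ge[of n] by simp

lemma W_Suc_eq: "W (Suc n) = (\<lambda>u. concat (full n u)) ` free n"
  unfolding W_Suc by (rule next_words_eq(1)[OF inj_y N_ge_1 N_dvd])

lemma length_full: "u \<in> free n \<Longrightarrow> length (full n u) = k n"
  by (rule next_words_eq(2)[OF inj_y N_ge_1 N_dvd])

lemma count_full: "u \<in> free n \<Longrightarrow> w \<in> W n \<Longrightarrow> count_list (full n u) w = k n div N n"
  by (rule next_words_eq(3)[OF inj_y N_ge_1 N_dvd]) (assumption, simp only: y_image)

lemma set_full: "u \<in> free n \<Longrightarrow> set (full n u) \<subseteq> W n"
  using set_completion[where N = "N n" and y = "y n" and k = "k n" and u = u, OF N_ge_1]
    free_blocks_subset[of n]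
  unfolding y_image free_parts_def set_append by blast

lemma length_W: "w \<in> W n \<Longrightarrow> length w = block_length n"
proof (induction n arbitrary: w)
  case 0
  then show ?case using E_seq by (auto simp: E_sequence_def)
next
  case (Suc n)
  then obtain u where u: "u \<in> free n" "w = concat (full n u)" unfolding W_Suc_eq by blast
  have "length (concat (full n u)) = length (full n u) * block_length n"
    by (rule length_concat_const) (use Suc.IH set_full[OF u(1)] in blast)
  then show ?case using u length_full[OF u(1)] by simp
qed

lemma inj_full: "inj_on (\<lambda>u. concat (full n u)) (free n)"
  by (rule inj_on_concat_completion[where h = "block_length n", OF N_ge_1 _ block_length_pos length_full],
      rule length_W, simp only: y_image)

lemma card_W_Suc: "N (Suc n) = card (free n)"
  unfolding W_Suc_eq using inj_full by (rule card_image)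

lemma real_free_length: "real (free_length n) = (1 - \<epsilon> n) * real (k n)"
proof -
  have "\<epsilon> n * real (k n) \<in> \<int>" using E_par by (auto simp: E_parameters_def)
  then have "(1 - \<epsilon> n) * real (k n) \<in> \<int>" by (simp add: left_diff_distrib)
  moreover have "(1 - \<epsilon> n) * real (k n) \<ge> 0" using eps_bounds[of n] by simp
  ultimately show ?thesis by (auto simp: k_prime_def Ints_def)
qed

lemma free_length_le: "free_length n \<le> k n"
proof -
  have "real (free_length n) \<le> 1 * real (k n)"
    unfolding real_free_length using eps_bounds[of n] by (intro mult_right_mono) auto
  then show ?thesis by simp
qed

text \<open>This amounts to \<open>1 / N n \<le> \<epsilon> n\<close>, a consequence of
  \<open>\<epsilon> n * N n > 2\<close>. It is what \<open>card_bounded_counts_ge\<close>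
  needs.\<close>

lemma free_length_le_capacity: "free_length n \<le> (N n - 1) * (k n div N n)"
proof -
  obtain r where r: "k n = N n * r" using N_dvd by (auto simp: dvd_def)
  have N: "real (N n) > 0" using N_ge[of n] by simp
  have "r \<le> \<epsilon> n * real (N n) * r"
    using eps_bounds(4)[of n] by (simp add: mult_le_cancel_right1)
  then have "real (free_length n) \<le> (real (N n) - 1) * r"
    unfolding real_free_length by (simp add: r algebra_simps)
  also have "\<dots> = real ((N n - 1) * r)" using N_ge[of n] by (simp add: of_nat_diff)
  finally show ?thesis using r N by (simp add: of_nat_le_iff del: of_nat_mult)
qed

text \<open>Lets the union bound count all words over the free blocks instead of only those with
  bounded counts, at the price of the factor \<open>3 ^ k n\<close>.\<close>

lemma N_Suc_ge: "(N n - 1) ^ free_length n \<le> N (Suc n) * 3 ^ k n"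
proof -
  have q: "k n div N n > 0"
    using N_dvd[of n] k_pos[of n] N_ge[of n] by (simp add: dvd_imp_le div_greater_zero_iff)
  have "(N n - 1) ^ free_length n \<le> card (free n) * 3 ^ (card (free_blocks n) * (k n div N n))"
    using card_bounded_counts_ge[of "free_blocks n" "k n div N n" "free_length n"]
      free_length_le_capacity[of n] q
    unfolding free_parts_def card_free_blocks by auto
  also have "card (free_blocks n) * (k n div N n) \<le> N n * (k n div N n)"
    unfolding card_free_blocks by (intro mult_right_mono) auto
  also have "\<dots> = k n" using N_dvd by simp
  finally show ?thesis unfolding card_W_Suc by (simp add: power_increasing)
qed

lemma c_Suc:
  assumes "u \<in> free n"
  shows "c (Suc n) (concat (full n u)) = circ_op k l n (map (c n) (full n u))"
proof -
  define ws where "ws = full n u"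
  let ?f = "\<lambda>j. take (block_length n) (drop (j * block_length n) (concat ws))"
  have "\<And>w. w \<in> set ws \<Longrightarrow> length w = block_length n"
    using set_full[OF assms] length_W unfolding ws_def by blast
  then have f: "map ?f [0..<length ws] = ws" by (rule take_drop_concat)
  have "length ws = k n" using length_full[OF assms] by (simp only: ws_def)
  then have "map (\<lambda>j. c n (?f j)) [0..<k n] = map (c n) (map ?f [0..<length ws])"
    by (simp add: comp_def)
  then have "map (\<lambda>j. c n (?f j)) [0..<k n] = map (c n) ws" by (simp only: f)
  then show ?thesis unfolding ws_def[symmetric] by (simp add: Let_def)
qed

end

section \<open>Separation of circular words\<close>

lemma prefix_concat_const:
  assumes "prefix A (concat Ps)" "\<And>p. p \<in> set Ps \<Longrightarrow> length p = h"
  shows "\<exists>Qs. set Qs \<subseteq> set Ps \<and> prefix A (concat Qs) \<and> length Qs * h \<le> length A + h"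
  using assms
proof (induction Ps arbitrary: A)
  case Nil
  then show ?case by (intro exI[of _ "[]"]) auto
next
  case (Cons p Ps)
  then consider "prefix A p" | B where "A = p @ B" "prefix B (concat Ps)"
    by (auto simp: prefix_append)
  then show ?case
  proof cases
    case 1
    then show ?thesis using Cons.prems(2) by (intro exI[of _ "[p]"]) auto
  next
    case 2
    obtain Qs where "set Qs \<subseteq> set Ps" "prefix B (concat Qs)" "length Qs * h \<le> length B + h"
      using Cons.IH[OF 2(2)] Cons.prems(2) by auto
    then show ?thesis using 2 Cons.prems(2) by (intro exI[of _ "p # Qs"]) auto
  qed
qed

text \<open>The two extra blocks are the ones cut at either end of \<open>A\<close>. Only membership
  of the blocks is recorded, since all passes will be treated alike.\<close>

lemma sublist_concat_const:
  assumes "sublist A (concat Ps)" "\<And>p. p \<in> set Ps \<Longrightarrow> length p = h"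
  shows "\<exists>Qs. set Qs \<subseteq> set Ps \<and> sublist A (concat Qs) \<and> length Qs * h \<le> length A + 2 * h"
  using assms
proof (induction Ps arbitrary: A)
  case Nil
  then show ?case by (intro exI[of _ "[]"]) auto
next
  case (Cons p Ps)
  then consider "sublist A p" | "sublist A (concat Ps)"
    | B C where "A = B @ C" "suffix B p" "prefix C (concat Ps)"
    by (auto simp: sublist_append)
  then show ?case
  proof cases
    case 1
    then show ?thesis using Cons.prems(2) by (intro exI[of _ "[p]"]) auto
  next
    case 2
    obtain Qs where "set Qs \<subseteq> set Ps" "sublist A (concat Qs)" "length Qs * h \<le> length A + 2 * h"
      using Cons.IH[OF 2] Cons.prems(2) by auto
    then show ?thesis by (intro exI[of _ Qs]) auto
  next
    case 3
    obtain Qs where "set Qs \<subseteq> set Ps" "prefix C (concat Qs)" "length Qs * h \<le> length C + h"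
      using prefix_concat_const[OF 3(3), of h] Cons.prems(2) by auto
    then show ?thesis using 3 Cons.prems(2)
      by (intro exI[of _ "p # Qs"]) (auto simp: sublist_append)
  qed
qed

lemma subseq_concat_map:
  assumes "\<And>x. x \<in> set xs \<Longrightarrow> subseq (f x) (g x)"
  shows "subseq (concat (map f xs)) (concat (map g xs))"
  using assms by (induction xs) (auto intro: list_emb_append_mono)

lemma concat_replicate_concat_map:
  "concat (replicate a (concat (map f xs))) = concat (map f (concat (replicate a xs)))"
  by (induction a) auto

text \<open>The factor of the circular operator with fixed outer index \<open>i\<close>. Passes
  differ only in how the \<open>circ_q k l n\<close> spacers belonging to each run are divided into
  b and e, so they all have the same length.\<close>

definition circ_pass ::
    "(nat \<Rightarrow> nat) \<Rightarrow> (nat \<Rightarrow> nat) \<Rightarrow> nat \<Rightarrow> nat \<Rightarrow> 'a circ_symbol list list \<Rightarrow> 'a circ_symbol list" where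
  "circ_pass k l n i ws = concat (map (\<lambda>w.
     replicate (circ_q k l n - j_index k l n i) Spacer_b @
     concat (replicate (l n - 1) w) @
     replicate (j_index k l n i) Spacer_e) ws)"

lemma circ_op_eq_passes:
  assumes "length ws = k n"
  shows "circ_op k l n ws = concat (map (\<lambda>i. circ_pass k l n i ws) [0..<circ_q k l n])"
proof -
  have *: "map (\<lambda>j. f (ws ! j)) [0..<k n] = map f ws" for f :: "_ \<Rightarrow> 'a circ_symbol list"
  proof -
    have "map (\<lambda>j. f (ws ! j)) [0..<k n] = map f (map ((!) ws) [0..<length ws])"
      by (simp add: assms)
    then show ?thesis by (simp only: map_nth)
  qed
  show ?thesis unfolding circ_op_def circ_pass_def
    by (intro arg_cong[where f = concat] map_cong refl) (rule *)
qed

section \<open>Passes, runs and good pairs of blocks\<close>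

context E_system
begin

abbreviation pass_length :: "nat \<Rightarrow> nat" where "pass_length n \<equiv> k n * (l n * q n)"

lemma q_Suc: "q (Suc n) = q n * pass_length n"
  by (simp add: power2_eq_square)

lemma j_index_le: "j_index k l n i \<le> q n"
proof -
  have "nat (x mod int (q n)) \<le> q n" for x
    using q_pos[of n] pos_mod_bound[of "int (q n)" x] by linarith
  then show ?thesis by (auto simp: j_index_def)
qed

lemma length_circ_pass:
  fixes ws :: "'b circ_symbol list list"
  assumes "\<And>w. w \<in> set ws \<Longrightarrow> length w = q n" "length ws = k n"
  shows "length (circ_pass k l n i ws) = pass_length n"
proof -
  have "length (replicate (q n - j_index k l n i) (Spacer_b :: 'b circ_symbol) @ concat (replicate (l n - 1) w) @
      replicate (j_index k l n i) Spacer_e) = l n * q n" if "w \<in> set ws" for w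
  proof -
    have "length (concat (replicate (l n - 1) w)) = (l n - 1) * q n"
      using length_concat_const[of "replicate (l n - 1) w" "q n"] assms(1)[OF that] by auto
    moreover have "q n + (l n - 1) * q n = l n * q n"
      using l_ge(2)[of n] by (metis Suc_diff_1 mult_Suc)
    ultimately show ?thesis using j_index_le[of n i] by simp
  qed
  then have "length (circ_pass k l n i ws) = length ws * (l n * q n)"
    unfolding circ_pass_def by (subst length_concat_const[where h = "l n * q n"]) auto
  then show ?thesis using assms(2) by simp
qed

lemma length_c: "w \<in> W n \<Longrightarrow> length (c n w) = q n"
proof (induction n arbitrary: w)
  case 0
  then show ?case using length_W[of w 0] by simp
next
  case (Suc n)
  then obtain u where u: "u \<in> free n" "w = concat (full n u)" unfolding W_Suc_eq by blast
  have len: "length (circ_pass k l n i (map (c n) (full n u))) = pass_length n" for i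
    by (rule length_circ_pass) (use Suc.IH set_full[OF u(1)] length_full[OF u(1)] in auto)
  let ?Ps = "map (\<lambda>i. circ_pass k l n i (map (c n) (full n u))) [0..<q n]"
  have "c (Suc n) w = concat ?Ps"
    unfolding u(2) c_Suc[OF u(1)] by (rule circ_op_eq_passes) (use length_full[OF u(1)] in simp)
  moreover have "length (concat ?Ps) = length ?Ps * pass_length n"
    by (rule length_concat_const) (use len in auto)
  ultimately show ?case by (simp add: power2_eq_square)
qed

text \<open>Rises from 0 to 1/16. The increment \<open>1 / (32 * 2 ^ n)\<close> between the levels
  \<open>n\<close> and \<open>n + 1\<close> is the budget of \<open>good_Suc\<close>.\<close>

definition sep_rate :: "nat \<Rightarrow> real" where "sep_rate n = (1 - 1 / 2 ^ n) / 16"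

definition good :: "nat \<Rightarrow> 'a list \<Rightarrow> 'a list \<Rightarrow> bool" where
  "good n w v \<longleftrightarrow> (\<forall>t s. separated (=) (sep_rate n) (q n)
     (concat (replicate t (c n w))) (concat (replicate s (c n v))))"

lemma sep_rate_bounds: "0 \<le> sep_rate n" "sep_rate n \<le> 1 / 16"
  by (auto simp: sep_rate_def field_simps)

abbreviation run :: "nat \<Rightarrow> 'a list \<Rightarrow> 'a circ_symbol list" where
  "run n w \<equiv> concat (replicate (l n - 1) (c n w))"

lemma length_run: "w \<in> W n \<Longrightarrow> length (run n w) = (l n - 1) * q n"
  using length_concat_const[of "replicate (l n - 1) (c n w)" "q n"] length_c[of w n] by auto

lemma subseq_circ_pass: "subseq (concat (map (run n) ws)) (circ_pass k l n i (map (c n) (ws @ vs)))"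
proof -
  have "subseq (concat (map (run n) ws)) (circ_pass k l n i (map (c n) ws))"
    unfolding circ_pass_def map_map comp_def by (rule subseq_concat_map) auto
  then show ?thesis unfolding circ_pass_def by auto
qed

text \<open>Extending \<open>A\<close> to whole passes costs at most two of them; deleting the
  spacers and the runs of \<open>vs\<close> leaves a repetition of the runs of \<open>ws\<close>.
  The split serves two uses: one block is kept entirely, while of the other only the free part
  remains, whose entries can be counted.\<close>

lemma cover_by_passes:
  assumes u: "u \<in> free n"
    and A: "sublist A (concat (replicate t (c (Suc n) (concat (full n u)))))"
    and full: "full n u = ws @ vs"
  obtains a As where "sublist A As" "a * pass_length n \<le> length A + 2 * pass_length n"
    "subseq (concat (replicate a (concat (map (run n) ws)))) As" "length As = a * pass_length n"
proof -
  let ?Ps = "concat (replicate t (map (\<lambda>i. circ_pass k l n i (map (c n) (full n u))) [0..<q n]))"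
  have "concat (replicate t (c (Suc n) (concat (full n u)))) = concat ?Ps"
    unfolding c_Suc[OF u]
    by (subst circ_op_eq_passes) (use length_full[OF u] concat_replicate_concat_map[where f = id] in auto)
  then have "sublist A (concat ?Ps)" using A by simp
  moreover have passes: "p \<in> (\<lambda>i. circ_pass k l n i (map (c n) (full n u))) ` UNIV" if "p \<in> set ?Ps" for p
    using that by (auto split: if_splits)
  have len: "length p = pass_length n" if "p \<in> set ?Ps" for p
  proof -
    from passes[OF that] obtain i where "p = circ_pass k l n i (map (c n) (full n u))" by blast
    then show ?thesis
      using length_circ_pass[of "map (c n) (full n u)" n i] set_full[OF u] length_full[OF u] length_c[of _ n]
      by auto
  qed
  ultimately obtain Qs where Qs: "set Qs \<subseteq> set ?Ps" "sublist A (concat Qs)"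
      "length Qs * pass_length n \<le> length A + 2 * pass_length n"
    using sublist_concat_const by blast
  have "subseq (concat (map (\<lambda>_. concat (map (run n) ws)) Qs)) (concat (map id Qs))"
  proof (rule subseq_concat_map)
    fix p assume "p \<in> set Qs"
    then obtain i where "p = circ_pass k l n i (map (c n) (full n u))" using passes Qs(1) by blast
    then show "subseq (concat (map (run n) ws)) (id p)"
      unfolding full id_apply using subseq_circ_pass by blast
  qed
  then have "subseq (concat (replicate (length Qs) (concat (map (run n) ws)))) (concat Qs)"
    by (simp add: map_replicate_const)
  moreover have "length (concat Qs) = length Qs * pass_length n"
    by (rule length_concat_const) (use Qs(1) len in blast)
  ultimately show ?thesis using that[of "concat Qs" "length Qs"] Qs by blast
qed

text \<open>Besides the loss \<open>sep_rate n\<close> inherited from the cells, the loss consists of the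
  additive constants of the cells and the spacers (each of order \<open>1 / l n\<close>), of the blocks of \<open>v\<close> outside its free
  part (\<open>\<epsilon> n\<close>) and of the cells that are not good (\<open>2 / 2 ^ (n + 7)\<close>).\<close>

lemma good_Suc:
  assumes u: "u \<in> free n" and v: "v \<in> free n"
    and few: "rlcs (\<lambda>x y. \<not> good n x y) (full n u) v * 2 ^ (n + 7) \<le> k n"
  shows "good (Suc n) (concat (full n u)) (concat (full n v))"
  unfolding good_def separated_def
proof (intro allI impI)
  fix t s A B
  assume A: "sublist A (concat (replicate t (c (Suc n) (concat (full n u)))))"
    and B: "sublist B (concat (replicate s (c (Suc n) (concat (full n v)))))"
  let ?P = "pass_length n" and ?kp = "free_length n"
  let ?X = "concat (map (run n) (full n u))" and ?Y = "concat (map (run n) v)"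
  define m where "m = rlcs (\<lambda>x y. \<not> good n x y) (full n u) v"
  obtain a As where As: "sublist A As" "a * ?P \<le> length A + 2 * ?P"
      "subseq (concat (replicate a ?X)) As" "length As = a * ?P"
    using cover_by_passes[OF u A append_Nil2[symmetric]] by blast
  obtain b Bs where Bs: "sublist B Bs" "b * ?P \<le> length B + 2 * ?P"
      "subseq (concat (replicate b ?Y)) Bs" "length Bs = b * ?P"
    using cover_by_passes[OF v B refl] by blast
  let ?xs = "concat (replicate a (full n u))" and ?ys = "concat (replicate b v)"
  have vW: "set v \<subseteq> W n" using set_full[OF v] by simp
  have xsW: "set ?xs \<subseteq> W n" using set_full[OF u] by (induction a) auto
  have ysW: "set ?ys \<subseteq> W n" using vW by (induction b) auto
  have runs: "length w = (l n - 1) * q n" if "w \<in> set (map (run n) (full n u)) \<or> w \<in> set (map (run n) v)" for w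
    using that set_full[OF u] vW length_run[of _ n] by auto
  have lv: "length v = ?kp" using v by (simp add: free_parts_def)
  have lX: "length ?X = k n * ((l n - 1) * q n)"
    using length_concat_const[of "map (run n) (full n u)"] runs length_full[OF u] by auto
  have lY: "length ?Y = ?kp * ((l n - 1) * q n)"
    using length_concat_const[of "map (run n) v"] runs lv by auto
  have lXs: "length (concat (replicate a ?X)) = a * length ?X"
    using length_concat_const[of "replicate a ?X" "length ?X"] by auto
  have lYs: "length (concat (replicate b ?Y)) = b * length ?Y"
    using length_concat_const[of "replicate b ?Y" "length ?Y"] by auto
  have lxs: "length ?xs = a * k n"
    using length_concat_const[of "replicate a (full n u)" "k n"] length_full[OF u] by auto
  have lys: "length ?ys = b * ?kp"
    using length_concat_const[of "replicate b v" "?kp"] lv by auto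
  \<comment> \<open>Two staircases are nested. The inner one has runs as blocks, of length
    \<open>(l n - 1) * q n\<close>; the outer one has whole passes as blocks and bounds the chain of
    bad cells across all passes by \<open>m * (a + b)\<close>.\<close>
  have cells: "real (rlcs (=) (concat (replicate a ?X)) (concat (replicate b ?Y))) \<le>
      sep_rate n * real (a * length ?X + b * length ?Y) + q n * real (a * k n + b * ?kp) +
      2 * real ((l n - 1) * q n) * (real m * real (a + b))"
  proof -
    have "real (rlcs (=) (concat (map (run n) ?xs)) (concat (map (run n) ?ys))) \<le>
        sep_rate n * real (length (concat (map (run n) ?xs)) + length (concat (map (run n) ?ys))) +
        real (q n) * real (length (map (run n) ?xs) + length (map (run n) ?ys)) +
        2 * real ((l n - 1) * q n) *
        real (rlcs (\<lambda>x y. \<not> separated (=) (sep_rate n) (q n) x y) (map (run n) ?xs) (map (run n) ?ys))"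
    proof (rule rlcs_concat_le)
      fix a assume "a \<in> set (map (run n) ?xs)"
      then obtain x where "x \<in> set ?xs" "a = run n x" unfolding set_map by blast
      then show "real (length a) \<le> real ((l n - 1) * q n)" using xsW length_run[of x n] by auto
    next
      fix b assume "b \<in> set (map (run n) ?ys)"
      then obtain x where "x \<in> set ?ys" "b = run n x" unfolding set_map by blast
      then show "real (length b) \<le> real ((l n - 1) * q n)" using ysW length_run[of x n] by auto
    qed (use sep_rate_bounds in auto)
    also have "rlcs (\<lambda>x y. \<not> separated (=) (sep_rate n) (q n) x y) (map (run n) ?xs) (map (run n) ?ys) \<le>
        rlcs (\<lambda>x y. \<not> good n x y) ?xs ?ys"
      unfolding rlcs_map by (rule rlcs_rel_mono) (auto simp: good_def)
    also have "real (rlcs (\<lambda>x y. \<not> good n x y) ?xs ?ys) \<le>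
        real m * real (length (replicate a (full n u)) + length (replicate b v))"
      by (rule rlcs_concat_le_uniform) (auto simp: m_def)
    finally show ?thesis
      unfolding concat_replicate_concat_map[symmetric] lXs lYs length_map lxs lys length_replicate
      by (simp add: mult_left_mono)
  qed
  have "rlcs (=) A B \<le> rlcs (=) As Bs"
    by (intro rlcs_mono sublist_imp_subseq As Bs)
  also have "\<dots> \<le> rlcs (=) (concat (replicate a ?X)) Bs + (a * ?P - a * length ?X)"
    using rlcs_delete1[OF As(3), of "(=)" Bs] As(4) lXs by simp
  also have "rlcs (=) (concat (replicate a ?X)) Bs \<le>
      rlcs (=) (concat (replicate a ?X)) (concat (replicate b ?Y)) + (b * ?P - b * length ?Y)"
    using rlcs_delete2[OF Bs(3), of "(=)" "concat (replicate a ?X)"] Bs(4) lYs by simp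
  finally have del: "real (rlcs (=) A B) \<le> real (rlcs (=) (concat (replicate a ?X)) (concat (replicate b ?Y)))
      + real (a * ?P - a * length ?X) + real (b * ?P - b * length ?Y)"
    by linarith
  define K L Q E where "K = real (k n)" and "L = real (l n)" and "Q = real (q n)" and "E = \<epsilon> n"
  have pos: "K > 0" "L > 0" "Q > 0" "E > 0" "L \<ge> 1"
    using k_pos[of n] l_ge[of n] q_pos[of n] eps_bounds[of n] by (auto simp: K_def L_def Q_def E_def)
  have l1: "real (l n - 1) = L - 1" using l_ge[of n] by (simp add: L_def of_nat_diff)
  have P: "real ?P = K * (L * Q)" by (simp add: K_def L_def Q_def)
  have kp: "real ?kp = (1 - E) * K" by (simp add: real_free_length K_def E_def)
  have X: "real (length ?X) = K * ((L - 1) * Q)" using lX l1 by (simp add: K_def Q_def)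
  have Y: "real (length ?Y) = (1 - E) * K * ((L - 1) * Q)" using lY l1 kp by (simp add: Q_def)
  have E1: "E \<le> 1" using eps_bounds[of n] by (simp add: E_def)
  have XP: "length ?X \<le> ?P" unfolding lX by (intro mult_left_mono mult_right_mono) auto
  have YX: "length ?Y \<le> length ?X" unfolding lX lY by (intro mult_right_mono free_length_le) auto
  have diff: "real (a * p - a * x) = real a * (real p - real x)" if "x \<le> p" for a p x :: nat
    using that by (simp flip: diff_mult_distrib2 add: of_nat_diff)
  have dX: "real (a * ?P - a * length ?X) = real a * (K * Q)"
    unfolding diff[OF XP] P X by (simp add: algebra_simps)
  have dY: "real (b * ?P - b * length ?Y) \<le> real b * (K * Q + E * (K * (L * Q)))"
  proof -
    have "real (b * ?P - b * length ?Y) = real b * (K * (L * Q) - (1 - E) * K * ((L - 1) * Q))"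
      unfolding diff[OF order_trans[OF YX XP]] P Y ..
    also have "K * (L * Q) - (1 - E) * K * ((L - 1) * Q) = K * Q + E * (K * (L * Q)) - E * (K * Q)"
      by (simp add: algebra_simps)
    also have "real b * \<dots> \<le> real b * (K * Q + E * (K * (L * Q)))"
      using pos by (intro mult_left_mono) auto
    finally show ?thesis .
  qed
  have m: "real m * 2 ^ (n + 7) \<le> K"
  proof -
    have "real (m * 2 ^ (n + 7)) \<le> real (k n)" using few unfolding m_def of_nat_le_iff .
    then show ?thesis by (simp add: K_def)
  qed
  define z :: real where "z = 1 / 2 ^ n"
  have z: "z > 0" by (simp add: z_def)
  have mz: "real m \<le> K * z / 128"
    using m by (simp add: z_def field_simps power_add)
  have Ez: "E \<le> z / 4096"
    using eps_bounds(2)[of n] by (simp add: E_def z_def field_simps power_add)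
  have Lz: "1 \<le> L * z / 1024"
  proof -
    have "2 ^ (n + 10) \<le> L" using l_large[of n] unfolding L_def
      by (metis less_imp_le of_nat_le_iff of_nat_numeral of_nat_power)
    then show ?thesis by (simp add: z_def field_simps power_add)
  qed
  \<comment> \<open>\<open>D\<close> is the total length of the passes covering \<open>A\<close> and
    \<open>B\<close>. All losses are measured in \<open>D * z\<close>; together they stay below
    \<open>D * z / 32\<close>, which is \<open>D\<close> times the increment of
    \<open>sep_rate\<close>.\<close>
  define D where "D = real (a + b) * (K * (L * Q))"
  have D: "D \<ge> 0" using pos by (simp add: D_def)
  have t1: "sep_rate n * real (a * length ?X + b * length ?Y) \<le> sep_rate n * D"
  proof -
    have "real (a * length ?X + b * length ?Y) \<le> real (a * ?P + b * ?P)"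
      using XP YX by (intro of_nat_mono add_mono mult_left_mono) auto
    also have "\<dots> = D" by (simp add: D_def P[symmetric] algebra_simps)
    finally show ?thesis using sep_rate_bounds by (intro mult_left_mono) auto
  qed
  have KQ: "real (a + b) * (K * Q) \<le> D * z / 1024"
  proof -
    have "real (a + b) * (K * Q) * 1 \<le> real (a + b) * (K * Q) * (L * z / 1024)"
      using pos Lz by (intro mult_left_mono) auto
    then show ?thesis by (simp add: D_def algebra_simps)
  qed
  have t2: "q n * real (a * k n + b * ?kp) \<le> D * z / 1024"
  proof -
    have "q n * real (a * k n + b * ?kp) \<le> q n * real (a * k n + b * k n)"
      using free_length_le[of n] by (intro mult_left_mono of_nat_mono add_mono) auto
    also have "\<dots> = real (a + b) * (K * Q)" by (simp add: K_def Q_def algebra_simps)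
    finally show ?thesis using KQ by linarith
  qed
  have t3: "2 * real ((l n - 1) * q n) * (real m * real (a + b)) \<le> D * z / 64"
  proof -
    have "2 * real ((l n - 1) * q n) * (real m * real (a + b)) \<le>
        2 * (L * Q) * (K * z / 128 * real (a + b))"
      using pos mz l1 by (intro mult_mono) (auto simp: Q_def)
    also have "\<dots> = D * z / 64" by (simp add: D_def)
    finally show ?thesis .
  qed
  have t4: "real a * (K * Q) + real b * (K * Q + E * (K * (L * Q))) \<le> D * z / 1024 + D * z / 4096"
  proof -
    have "real b * (E * (K * (L * Q))) \<le> real (a + b) * (z / 4096 * (K * (L * Q)))"
      using pos Ez by (intro mult_mono) auto
    then show ?thesis using KQ by (simp add: D_def algebra_simps)
  qed
  have "real (rlcs (=) A B) \<le> sep_rate n * D + D * z / 1024 + D * z / 64 + (D * z / 1024 + D * z / 4096)"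
    using del cells t1 t2 t3 t4 dX dY by linarith
  also have "\<dots> \<le> sep_rate n * D + D * z / 32"
    using mult_nonneg_nonneg[OF D less_imp_le[OF z]] by simp
  also have "\<dots> = sep_rate (Suc n) * D"
    by (simp add: sep_rate_def z_def field_simps)
  \<comment> \<open>The covering added up to four passes. At a rate of at most 1/16 they cost no
    more than one pass, which fits into the additive constant \<open>q (Suc n)\<close>.\<close>
  also have "\<dots> \<le> sep_rate (Suc n) * (real (length A + length B) + 4 * real ?P)"
  proof (intro mult_left_mono sep_rate_bounds)
    have "real (a * ?P + b * ?P) \<le> real (length A + length B + 4 * ?P)"
      using As(2) Bs(2) by (intro of_nat_mono) linarith
    moreover have "real (a * ?P + b * ?P) = D" by (simp add: D_def P[symmetric] algebra_simps)
    ultimately show "D \<le> real (length A + length B) + 4 * real ?P"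
      by simp
  qed
  also have "\<dots> = sep_rate (Suc n) * real (length A + length B) + sep_rate (Suc n) * 4 * real ?P"
    by (simp only: distrib_left mult.assoc)
  also have "sep_rate (Suc n) * 4 * real ?P \<le> 1 * real ?P"
    using sep_rate_bounds(2)[of "Suc n"] by (intro mult_right_mono) auto
  also have "1 * real ?P \<le> real (q n) * real ?P"
    using q_pos[of n] by (intro mult_right_mono) auto
  also have "\<dots> = real (q (Suc n))" by (simp only: q_Suc of_nat_mult)
  finally show "real (rlcs (=) A B) \<le> sep_rate (Suc n) * real (length A + length B) + real (q (Suc n))"
    by simp
qed

lemma good_0:
  assumes "w \<in> W 0" "v \<in> W 0" "w \<noteq> v"
  shows "good 0 w v"
proof -
  obtain a b where w: "w = [a]" and v: "v = [b]" and "a \<noteq> b"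
    using assms E_seq by (auto simp: E_sequence_def)
  have "rlcs (=) A B = 0"
    if "sublist A (concat (replicate t (c 0 w)))" "sublist B (concat (replicate s (c 0 v)))" for A B s t
  proof (rule rlcs_eq_0)
    fix x y assume "x \<in> set A" "y \<in> set B"
    then have "x \<in> set (c 0 w)" "y \<in> set (c 0 v)"
      using set_mono_sublist[OF that(1)] set_mono_sublist[OF that(2)] by (auto split: if_splits)
    then show "x \<noteq> y" using \<open>a \<noteq> b\<close> by (auto simp: w v)
  qed
  then show ?thesis using sep_rate_bounds[of 0] unfolding good_def separated_def by simp
qed

text \<open>By \<open>good_Suc\<close> a bad (n+1)-block has a free part with a long chain against
  \<open>full n u\<close>, and \<open>card_rlcs_ge\<close> counts such free parts. The comparison is
  with \<open>N n - 1\<close>, the number of blocks open to the free part, so the hypothesis bounds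
  the probability that a free entry is bad.\<close>

lemma card_bad_le:
  assumes "w \<in> W n"
  shows "card {v \<in> W n. \<not> good n w v} * 54 ^ (2 ^ (n + 7)) \<le> N n - 1"
  using assms
proof (induction n arbitrary: w)
  case 0
  have "{v \<in> W 0. \<not> good 0 w v} \<subseteq> {w}" using good_0 0 by auto
  then have "card {v \<in> W 0. \<not> good 0 w v} \<le> 1"
    using card_mono[of "{w}"] by fastforce
  then have "card {v \<in> W 0. \<not> good 0 w v} * 54 ^ (2 ^ (0 + 7)) \<le> 1 * 54 ^ (2 ^ (0 + 7))"
    by (rule mult_right_mono) simp
  also have "W 0 = (\<lambda>a. [a]) ` \<Sigma>" using E_seq by (simp add: E_sequence_def)
  then have "N 0 = card \<Sigma>" by (simp add: card_image inj_on_def)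
  then have "1 * 54 ^ (2 ^ (0 + 7)) \<le> N 0 - 1" using alphabet_large by simp
  finally show ?case .
next
  case (Suc n)
  let ?bad = "\<lambda>x y. \<not> good n x y"
  obtain u where u: "u \<in> free n" "w = concat (full n u)" using Suc.prems unfolding W_Suc_eq by blast
  \<comment> \<open>\<open>m\<close> is the least chain length that \<open>good_Suc\<close> does not
    tolerate; \<open>d\<close> bounds the number of free blocks that are bad for a fixed
    n-block.\<close>
  define m where "m = k n div 2 ^ (n + 7) + 1"
  define M where "M = N n - 1"
  define d where "d = M div 54 ^ (2 ^ (n + 7))"
  have M: "M > 0" using N_ge[of n] by (simp add: M_def)
  let ?V = "{v. set v \<subseteq> free_blocks n \<and> length v = free_length n \<and> m \<le> rlcs ?bad (full n u) v}"
  define x where "x = card {v \<in> W (Suc n). \<not> good (Suc n) w v}"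
  have finV: "finite ?V"
    by (rule finite_subset[OF _ finite_lists_length_eq[of "free_blocks n" "free_length n"]]) auto
  have "{v \<in> W (Suc n). \<not> good (Suc n) w v} \<subseteq> (\<lambda>v. concat (full n v)) ` ?V"
  proof
    fix v' assume v': "v' \<in> {v \<in> W (Suc n). \<not> good (Suc n) w v}"
    then obtain v where v: "v \<in> free n" "v' = concat (full n v)" unfolding W_Suc_eq by blast
    have "\<not> rlcs ?bad (full n u) v * 2 ^ (n + 7) \<le> k n"
      using good_Suc[OF u(1) v(1)] v' u(2) v(2) by blast
    then have "k n div 2 ^ (n + 7) < rlcs ?bad (full n u) v"
      by (simp add: div_less_iff_less_mult)
    then show "v' \<in> (\<lambda>v. concat (full n v)) ` ?V"
      using v by (auto simp: m_def free_parts_def)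
  qed
  then have "x \<le> card ((\<lambda>v. concat (full n v)) ` ?V)"
    unfolding x_def using finV by (intro card_mono) auto
  then have "x \<le> card ?V" using card_image_le[OF finV] le_trans by blast
  moreover have "card ?V * M ^ m \<le> 3 ^ (length (full n u) + free_length n) * d ^ m * M ^ free_length n"
  proof -
    have "card {y \<in> free_blocks n. ?bad x y} \<le> d" if "x \<in> set (full n u)" for x
    proof -
      have "card {y \<in> free_blocks n. ?bad x y} \<le> card {y \<in> W n. ?bad x y}"
        by (rule card_mono) (use free_blocks_subset[of n] in auto)
      also have "\<dots> \<le> d"
        using Suc.IH[of x] set_full[OF u(1)] that by (auto simp: d_def M_def less_eq_div_iff_mult_less_eq)
      finally show ?thesis .
    qed
    then show ?thesis
      using card_rlcs_ge[of "free_blocks n" "full n u" ?bad d "free_length n" m]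
      unfolding card_free_blocks M_def by simp
  qed
  ultimately have "x * M ^ m \<le> 3 ^ (length (full n u) + free_length n) * d ^ m * M ^ free_length n"
    by (meson mult_right_mono le_trans zero_le)
  also have "\<dots> \<le> 3 ^ (2 * k n) * d ^ m * (N (Suc n) * 3 ^ k n)"
  proof (intro mult_mono order_refl)
    show "(3 :: nat) ^ (length (full n u) + free_length n) \<le> 3 ^ (2 * k n)"
      using length_full[OF u(1)] free_length_le[of n] by (intro power_increasing) auto
    show "M ^ free_length n \<le> N (Suc n) * 3 ^ k n" unfolding M_def by (rule N_Suc_ge)
  qed simp_all
  also have "\<dots> = d ^ m * N (Suc n) * 27 ^ k n"
    by (simp add: power_mult power_mult_distrib[symmetric])
  finally have 1: "x * M ^ m \<le> d ^ m * N (Suc n) * 27 ^ k n" .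
  \<comment> \<open>The rounding in \<open>m\<close> goes the right way:
    \<open>2 ^ (n + 7) * m \<ge> k n\<close>. Of the factor \<open>54 ^ k n\<close> thus gained,
    \<open>27 ^ k n\<close> is used up and \<open>2 ^ k n\<close> is left.\<close>
  have "54 ^ k n \<le> (54 :: nat) ^ (2 ^ (n + 7) * m)"
  proof (rule power_increasing)
    have "k n mod 2 ^ (n + 7) < 2 ^ (n + 7)" by simp
    moreover have "2 ^ (n + 7) * (k n div 2 ^ (n + 7)) + k n mod 2 ^ (n + 7) = k n"
      by (rule mult_div_mod_eq)
    ultimately have "k n < 2 ^ (n + 7) * (k n div 2 ^ (n + 7)) + 2 ^ (n + 7)" by linarith
    then show "k n \<le> 2 ^ (n + 7) * m" by (simp add: m_def)
  qed simp
  then have "x * M ^ m * 54 ^ k n \<le> x * M ^ m * 54 ^ (2 ^ (n + 7) * m)"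
    by (rule mult_left_mono) simp
  also have "\<dots> \<le> d ^ m * N (Suc n) * 27 ^ k n * 54 ^ (2 ^ (n + 7) * m)"
    by (rule mult_right_mono[OF 1]) simp
  also have "\<dots> = (d * 54 ^ (2 ^ (n + 7))) ^ m * N (Suc n) * 27 ^ k n"
    unfolding power_mult power_mult_distrib by (simp only: mult_ac)
  also have "\<dots> \<le> M ^ m * N (Suc n) * 27 ^ k n"
    by (intro mult_right_mono power_mono) (auto simp: d_def)
  finally have "M ^ m * 27 ^ k n * (x * 2 ^ k n) \<le> M ^ m * 27 ^ k n * N (Suc n)"
  proof -
    assume *: "x * M ^ m * 54 ^ k n \<le> M ^ m * N (Suc n) * 27 ^ k n"
    have "(54 :: nat) ^ k n = 27 ^ k n * 2 ^ k n" by (simp flip: power_mult_distrib)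
    then show ?thesis using * by (simp add: mult_ac)
  qed
  then have 2: "x * 2 ^ k n \<le> N (Suc n)" using M by simp
  \<comment> \<open>The surplus covers the proportion of level \<open>n + 1\<close>, as
    \<open>54 < 2 ^ 6\<close>. The extra factor 2 absorbs the passage from \<open>N (Suc n)\<close>
    to \<open>N (Suc n) - 1\<close>.\<close>
  have "(54 :: nat) ^ (2 ^ (Suc n + 7)) * 2 \<le> (2 ^ 6) ^ (2 ^ (Suc n + 7)) * 2 ^ 1"
    by (intro mult_mono power_mono) auto
  also have "\<dots> = 2 ^ (6 * 2 ^ (Suc n + 7) + 1)"
    by (simp only: power_mult power_add)
  also have "\<dots> \<le> 2 ^ k n"
  proof (rule power_increasing)
    have "(1::nat) \<le> 2 ^ n" by simp
    then have "6 * 2 ^ (Suc n + 7) + 1 \<le> (2 :: nat) ^ (n + 12)" by (simp add: power_add)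
    then show "6 * 2 ^ (Suc n + 7) + 1 \<le> k n" using k_large[of n] by linarith
  qed simp
  finally have "x * (54 ^ (2 ^ (Suc n + 7)) * 2) \<le> N (Suc n)"
    using 2 by (meson le_trans mult_left_mono zero_le)
  then have "x * 54 ^ (2 ^ (Suc n + 7)) * 2 \<le> N (Suc n)" by (simp only: mult.assoc)
  then show ?case using N_ge[of "Suc n"] unfolding x_def by linarith
qed

end

section \<open>Averages over windows\<close>

text \<open>The unnormalised empirical average over the words of length \<open>K\<close> inside
  \<open>w\<close>. With indicator functions it yields frequencies; nested, it yields the mean of
  \<open>fbar\<close> over pairs of windows.\<close>

definition window_sum :: "nat \<Rightarrow> ('a list \<Rightarrow> real) \<Rightarrow> 'a list \<Rightarrow> real" where
  "window_sum K F w = (\<Sum>p | p + K \<le> length w. F (take K (drop p w)))"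

lemma finite_windows [simp]: "finite {p. p + K \<le> (m :: nat)}"
  by (rule finite_subset[of _ "{..m}"]) auto

lemma card_windows: "card {p. p + K \<le> (m :: nat)} = m + 1 - K"
proof -
  have "{p. p + K \<le> m} = {..<m + 1 - K}" by auto
  then show ?thesis by simp
qed

lemma window_sum_nonneg: "(\<And>u. F u \<ge> 0) \<Longrightarrow> window_sum K F w \<ge> 0"
  unfolding window_sum_def by (intro sum_nonneg) auto

text \<open>Windows across the junction are discarded, which is harmless for lower bounds because
  \<open>F\<close> is non-negative.\<close>

lemma window_sum_append:
  assumes "\<And>u. F u \<ge> 0" "K > 0"
  shows "window_sum K F v + window_sum K F w \<le> window_sum K F (v @ w)"
proof -
  let ?I = "{p. p + K \<le> length v}" and ?J = "(\<lambda>p. p + length v) ` {p. p + K \<le> length w}"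
  have "window_sum K F v = (\<Sum>p\<in>?I. F (take K (drop p (v @ w))))"
    unfolding window_sum_def by (intro sum.cong refl) auto
  moreover have "window_sum K F w = (\<Sum>p\<in>?J. F (take K (drop p (v @ w))))"
    unfolding window_sum_def by (subst sum.reindex) (auto simp: inj_on_def)
  moreover have "?I \<inter> ?J = {}" using assms(2) by auto
  ultimately have "window_sum K F v + window_sum K F w = (\<Sum>p\<in>?I \<union> ?J. F (take K (drop p (v @ w))))"
    by (simp add: sum.union_disjoint)
  also have "\<dots> \<le> window_sum K F (v @ w)"
    unfolding window_sum_def by (rule sum_mono2) (use assms in auto)
  finally show ?thesis .
qed

lemma window_sum_concat:
  assumes "\<And>u. F u \<ge> 0" "K > 0"
  shows "(\<Sum>v\<leftarrow>vs. window_sum K F v) \<le> window_sum K F (concat vs)"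
proof (induction vs)
  case Nil
  then show ?case using window_sum_nonneg[OF assms(1)] by simp
next
  case (Cons v vs)
  then show ?case using window_sum_append[where F = F and K = K and v = v and w = "concat vs"] assms by simp
qed

lemma nth_concat_replicate:
  "i < t * length x \<Longrightarrow> concat (replicate t x) ! i = x ! (i mod length x)"
proof (induction t arbitrary: i)
  case (Suc t)
  then show ?case by (auto simp: nth_append le_mod_geq)
qed simp

lemma q_window_periodic:
  assumes "p + (length x + 1) \<le> t * length x"
  shows "take (length x + 1) (drop p (concat (replicate t x))) ! 0 =
    take (length x + 1) (drop p (concat (replicate t x))) ! length x"
proof -
  have "length (concat (replicate t x)) = t * length x"
    using length_concat_const[of "replicate t x" "length x"] by auto
  then show ?thesis using assms by (simp add: nth_concat_replicate)
qed

section \<open>Windows in circular words\<close>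

context E_system
begin

lemma sum_full:
  fixes f :: "'a list \<Rightarrow> real"
  assumes "u \<in> free n"
  shows "(\<Sum>w\<leftarrow>full n u. f w) = real (k n div N n) * (\<Sum>w\<in>W n. f w)"
proof -
  have "(\<Sum>w\<leftarrow>full n u. f w) = (\<Sum>w\<in>W n. real (count_list (full n u) w) * f w)"
    by (rule sum_list_map_eq_sum_count_list[OF finite_W set_full[OF assms]])
  also have "\<dots> = (\<Sum>w\<in>W n. real (k n div N n) * f w)"
    by (intro sum.cong refl) (simp only: count_full[OF assms])
  finally show ?thesis by (simp only: sum_distrib_left)
qed

text \<open>An (n+1)-block makes \<open>q n\<close> passes through its n-blocks; only windows inside
  a single run are kept.\<close>

lemma window_sum_c_Suc:
  assumes "\<And>u. F u \<ge> 0" "K > 0" "u \<in> free n"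
  shows "real (q n) * (\<Sum>w\<leftarrow>full n u. window_sum K F (run n w)) \<le>
    window_sum K F (c (Suc n) (concat (full n u)))"
proof -
  let ?ws = "map (c n) (full n u)"
  have pass: "(\<Sum>w\<leftarrow>full n u. window_sum K F (run n w)) \<le> window_sum K F (circ_pass k l n i ?ws)" for i
  proof -
    let ?g = "\<lambda>w. replicate (q n - j_index k l n i) Spacer_b @ run n w @
        replicate (j_index k l n i) Spacer_e"
    have "window_sum K F (run n w) \<le> window_sum K F (?g w)" for w
      using window_sum_append[of F K "replicate (q n - j_index k l n i) Spacer_b"
          "run n w @ replicate (j_index k l n i) Spacer_e"]
        window_sum_append[of F K "run n w" "replicate (j_index k l n i) Spacer_e"]
        window_sum_nonneg[of F K] assms(1,2)
      by (smt (verit))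
    then have "(\<Sum>w\<leftarrow>full n u. window_sum K F (run n w)) \<le>
        (\<Sum>w\<leftarrow>map ?g (full n u). window_sum K F w)"
      unfolding map_map comp_def by (intro sum_list_mono)
    also have "\<dots> \<le> window_sum K F (concat (map ?g (full n u)))"
      by (rule window_sum_concat[OF assms(1,2)])
    also have "concat (map ?g (full n u)) = circ_pass k l n i ?ws"
      unfolding circ_pass_def map_map comp_def ..
    finally show ?thesis .
  qed
  have "real (q n) * (\<Sum>w\<leftarrow>full n u. window_sum K F (run n w)) =
      (\<Sum>i\<leftarrow>[0..<q n]. (\<Sum>w\<leftarrow>full n u. window_sum K F (run n w)))"
    by (simp add: sum_list_triv)
  also have "\<dots> \<le> (\<Sum>v\<leftarrow>map (\<lambda>i. circ_pass k l n i ?ws) [0..<q n]. window_sum K F v)"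
    unfolding map_map comp_def by (intro sum_list_mono pass)
  also have "\<dots> \<le> window_sum K F (concat (map (\<lambda>i. circ_pass k l n i ?ws) [0..<q n]))"
    by (rule window_sum_concat[OF assms(1,2)])
  also have "concat (map (\<lambda>i. circ_pass k l n i ?ws) [0..<q n]) = c (Suc n) (concat (full n u))"
    unfolding c_Suc[OF assms(3)]
    by (rule circ_op_eq_passes[symmetric]) (use length_full[OF assms(3)] in simp)
  finally show ?thesis .
qed

lemma inverse_l_le: "1 / real (l n) \<le> 1 / 2 ^ (n + 10)"
proof -
  have "real (2 ^ (n + 10)) \<le> real (l n)" using l_large[of n] by (intro of_nat_mono) simp
  then show ?thesis by (intro divide_left_mono) (auto simp: l_ge)
qed

text \<open>A lower bound for the number of runs of a fixed n-block per symbol of a later block. An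
  (n+1)-block contains \<open>q n * (k n div N n)\<close> such runs among \<open>q (Suc n)\<close>
  symbols, a proportion of \<open>1 / (N n * l n * q n)\<close>; the numerator allows for the
  spacers of all later levels.\<close>

definition density :: "nat \<Rightarrow> real" where
  "density n = (1 - 1 / 2 ^ (n + 10)) / (real (N n) * real (l n) * real (q n))"

lemma density_nonneg: "density n \<ge> 0"
  unfolding density_def by (intro divide_nonneg_nonneg) (auto simp: field_simps)

text \<open>Each later level \<open>m\<close> dilutes the blocks by the factor
  \<open>1 - 1 / l m\<close>, and \<open>1 / l m \<le> 1 / 2 ^ (m + 10)\<close>. Over all
  \<open>m > n\<close> these losses add up to at most \<open>1 / 2 ^ (n + 10)\<close>.\<close>

lemma window_sum_blocks_ge:
  assumes F: "\<And>u. F u \<ge> 0" "K > 0" and "n < m" "A \<in> W m"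
  shows "real (q m) * (density n * (\<Sum>w\<in>W n. window_sum K F (run n w))) \<le> window_sum K F (c m A)"
proof -
  define S where "S = (\<Sum>w\<in>W n. window_sum K F (run n w))"
  define R where "R = S / (real (N n) * real (l n) * real (q n))"
  have S: "S \<ge> 0" unfolding S_def by (intro sum_nonneg window_sum_nonneg F)
  then have R: "R \<ge> 0" by (simp add: R_def)
  \<comment> \<open>\<open>?r (Suc n) = 1\<close>, and passing from \<open>m\<close> to
    \<open>Suc m\<close> lowers \<open>?r\<close> by exactly \<open>1 / 2 ^ (m + 10)\<close>, so no
    infinite product appears.\<close>
  let ?r = "\<lambda>m. 1 - 1 / 2 ^ (n + 10) + 1 / 2 ^ (m + 9) :: real"
  have "real (q m) * (R * ?r m) \<le> window_sum K F (c m A)"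
    using \<open>n < m\<close> \<open>A \<in> W m\<close>
  proof (induction m arbitrary: A)
    case (Suc m)
    then obtain u where u: "u \<in> free m" "A = concat (full m u)" unfolding W_Suc_eq by blast
    show ?case
    proof (cases "m = n")
      case True
      obtain j where j: "k n = N n * j" using N_dvd by (auto simp: dvd_def)
      have N0: "N n > 0" using N_ge[of n] by simp
      have "real (q (Suc n)) * R = real (q n) * (real (k n div N n) * S)"
      proof -
        define D where "D = real (N n) * real (l n) * real (q n)"
        have "D \<noteq> 0" using W_nonempty[of n] l_ge[of n] q_pos[of n] by (simp add: D_def)
        have "real (q (Suc n)) = real (q n) * real j * D"
          unfolding q_Suc j D_def by simp
        then have "real (q (Suc n)) * R = real (q n) * real j * D * (S / D)"
          by (simp only: R_def D_def)
        moreover have "k n div N n = j" using N0 by (subst j) simp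
        ultimately show ?thesis using \<open>D \<noteq> 0\<close> by simp
      qed
      also have "\<dots> \<le> window_sum K F (c (Suc m) A)"
      proof -
        have u': "u \<in> free n" using u(1) True by simp
        show ?thesis
          using window_sum_c_Suc[of F K u n, OF F u'] unfolding sum_full[OF u'] u(2) True S_def .
      qed
      also have "real (q (Suc n)) * R = real (q (Suc m)) * (R * ?r (Suc m))"
      proof -
        have "?r (Suc m) = 1" using True by (simp add: add.commute)
        then show ?thesis by (simp only: True mult_1_right)
      qed
      finally show ?thesis .
    next
      case False
      then have "n < m" using Suc.prems by simp
      have "window_sum K F (run m w) \<ge> real (l m - 1) * (real (q m) * (R * ?r m))" if "w \<in> W m" for w
      proof -
        have "real (l m - 1) * (real (q m) * (R * ?r m)) \<le> real (l m - 1) * window_sum K F (c m w)"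
          using Suc.IH[OF \<open>n < m\<close> that] by (intro mult_left_mono) auto
        also have "\<dots> = (\<Sum>v\<leftarrow>replicate (l m - 1) (c m w). window_sum K F v)"
          by (simp add: sum_list_replicate)
        also have "\<dots> \<le> window_sum K F (run m w)" by (rule window_sum_concat[OF F])
        finally show ?thesis .
      qed
      then have "(\<Sum>w\<leftarrow>full m u. real (l m - 1) * (real (q m) * (R * ?r m))) \<le>
          (\<Sum>w\<leftarrow>full m u. window_sum K F (run m w))"
        using set_full[OF u(1)] by (intro sum_list_mono) blast
      then have "real (q m) * (real (k m) * (real (l m - 1) * (real (q m) * (R * ?r m)))) \<le>
          real (q m) * (\<Sum>w\<leftarrow>full m u. window_sum K F (run m w))"
        unfolding sum_list_triv length_full[OF u(1)] by (intro mult_left_mono) auto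
      also have "\<dots> \<le> window_sum K F (c (Suc m) A)"
        using window_sum_c_Suc[of F K u m, OF F u(1)] unfolding u(2) .
      finally have 1: "real (q m) * (real (k m) * (real (l m - 1) * (real (q m) * (R * ?r m)))) \<le>
          window_sum K F (c (Suc m) A)" .
      have "?r m \<le> 1" "?r m \<ge> 0"
      proof -
        have "(2::real) ^ (n + 10) \<le> 2 ^ (m + 9)"
          using \<open>n < m\<close> by (intro power_increasing) auto
        then have "1 / 2 ^ (m + 9) \<le> (1::real) / 2 ^ (n + 10)" by (intro divide_left_mono) auto
        then show "?r m \<le> 1" by simp
        have "1 / 2 ^ (n + 10) \<le> (1::real)" by simp
        then show "?r m \<ge> 0" by (smt (verit) zero_le_divide_1_iff zero_le_power)
      qed
      have "?r (Suc m) = ?r m - 1 / 2 ^ (m + 10)" by (simp add: field_simps power_add)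
      also have "\<dots> \<le> ?r m - ?r m * (1 / real (l m))"
      proof -
        have "?r m * (1 / real (l m)) \<le> 1 * (1 / 2 ^ (m + 10))"
          using \<open>?r m \<le> 1\<close> inverse_l_le[of m] by (intro mult_mono) auto
        then show ?thesis by simp
      qed
      also have "\<dots> = ?r m * (real (l m - 1) / real (l m))"
        using l_ge[of m] by (simp add: of_nat_diff field_simps)
      finally have "real (q (Suc m)) * (R * ?r (Suc m)) \<le>
          real (q (Suc m)) * (R * (?r m * (real (l m - 1) / real (l m))))"
        using R by (intro mult_left_mono) auto
      also have "\<dots> = real (q m) * (real (k m) * (real (l m - 1) * (real (q m) * (R * ?r m))))"
        using l_ge[of m] unfolding q_Suc by simp
      finally show ?thesis using 1 by linarith
    qed
  qed simp
  moreover have "real (q m) * (density n * S) \<le> real (q m) * (R * ?r m)"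
  proof (intro mult_left_mono)
    have "density n * S = R * (1 - 1 / 2 ^ (n + 10))" by (simp add: density_def R_def)
    also have "\<dots> \<le> R * ?r m" using R by (intro mult_left_mono) auto
    finally show "density n * S \<le> R * ?r m" .
  qed simp
  ultimately show ?thesis unfolding S_def by linarith
qed

text \<open>Inside a run every window of length \<open>q n + 1\<close> has equal ends, and a run
  contains \<open>(l n - 2) * q n\<close> of them. One third of the loss comes from
  \<open>density\<close>, the other two from the factor \<open>1 - 2 / l n\<close>.\<close>

lemma count_periodic_windows_ge:
  assumes "n < m" "A \<in> W m"
  shows "(1 - 3 / 2 ^ (n + 10)) * real (q m) \<le>
    window_sum (q n + 1) (\<lambda>u. if u ! 0 = u ! q n then 1 else 0) (c m A)"
proof -
  let ?F = "\<lambda>u :: 'a circ_symbol list. if u ! 0 = u ! q n then 1 else 0 :: real"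
  have L: "real (l n) > 0" "real (N n) > 0" "real (q n) > 0"
    using l_ge[of n] N_ge[of n] q_pos[of n] by auto
  have "window_sum (q n + 1) ?F (run n w) = (real (l n) - 2) * real (q n)" if w: "w \<in> W n" for w
  proof -
    have "window_sum (q n + 1) ?F (run n w) = (\<Sum>p | p + (q n + 1) \<le> (l n - 1) * q n. 1)"
      unfolding window_sum_def length_run[OF w]
    proof (intro sum.cong refl)
      fix p assume "p \<in> {p. p + (q n + 1) \<le> (l n - 1) * q n}"
      then show "?F (take (q n + 1) (drop p (run n w))) = 1"
        using q_window_periodic[of p "c n w" "l n - 1"] length_c[OF w] by simp
    qed
    also have "\<dots> = real ((l n - 1) * q n + 1 - (q n + 1))"
      unfolding sum_constant card_windows by simp
    also have "(l n - 1) * q n + 1 - (q n + 1) = (l n - 2) * q n"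
    proof -
      obtain j where "l n = j + 2" using l_ge(1)[of n] by (metis le_add_diff_inverse2)
      then show ?thesis by simp
    qed
    also have "real \<dots> = (real (l n) - 2) * real (q n)"
      using l_ge(1)[of n] by (simp add: of_nat_diff)
    finally show ?thesis .
  qed
  then have S: "(\<Sum>w\<in>W n. window_sum (q n + 1) ?F (run n w)) = real (N n) * ((real (l n) - 2) * real (q n))"
    by simp
  have "(1 - 3 / 2 ^ (n + 10)) \<le> (1 - 1 / 2 ^ (n + 10)) * (1 - 2 / real (l n))"
  proof -
    have "1 - 3 * x \<le> (1 - x) * (1 - 2 * x)" for x :: real
      by (simp add: algebra_simps)
    from this[of "1 / 2 ^ (n + 10)"]
    have "1 - 3 / 2 ^ (n + 10) \<le> (1 - 1 / 2 ^ (n + 10)) * (1 - 2 * (1 / 2 ^ (n + 10)) :: real)" by simp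
    also have "\<dots> \<le> (1 - 1 / 2 ^ (n + 10)) * (1 - 2 * (1 / real (l n)))"
      using inverse_l_le[of n] by (intro mult_left_mono) (auto simp: field_simps)
    finally show ?thesis by simp
  qed
  also have "\<dots> = density n * (real (N n) * ((real (l n) - 2) * real (q n)))"
  proof -
    have "x / (a * b * z) * (a * ((b - 2) * z)) = x * (1 - 2 / b)" if "a > 0" "b > 0" "z > 0" for x a b z :: real
      using that by (simp add: field_simps)
    then show ?thesis unfolding density_def using L by metis
  qed
  finally have "(1 - 3 / 2 ^ (n + 10)) * real (q m) \<le>
      real (q m) * (density n * (real (N n) * ((real (l n) - 2) * real (q n))))"
    by (simp add: mult.commute mult_left_mono)
  also have "\<dots> \<le> window_sum (q n + 1) ?F (c m A)"
    unfolding S[symmetric] by (rule window_sum_blocks_ge) (use assms in auto)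
  finally show ?thesis .
qed

text \<open>Only windows inside runs of good pairs of n-blocks are counted. Their common
  subsequences have at most \<open>2 * K / 16 + q n \<le> 3 * K / 16\<close> entries, so
  \<open>fbar\<close> is at least 13/16. At most 1/54 of the pairs of blocks are not good, and a run
  has room for at least \<open>(l n - 18) * q n\<close> windows.\<close>

lemma fbar_windows_ge:
  assumes "n < m" "A \<in> W m" and K: "16 * q n \<le> K" "K \<le> 17 * q n"
  shows "real (q m) ^ 2 / 2 \<le>
    window_sum K (\<lambda>u. window_sum K (\<lambda>v. fbar u v) (c m A)) (c m A)"
proof -
  define L Q M where "L = real (l n)" and "Q = real (q n)" and "M = real (N n)"
  have pos: "L > 0" "Q > 0" "M > 0" using l_ge[of n] N_ge[of n] q_pos[of n]
    by (auto simp: L_def Q_def M_def)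
  have K0: "K > 0" using K(1) q_pos[of n] by linarith
  have L1024: "L \<ge> 1024"
  proof -
    have "(2::nat) ^ 10 \<le> 2 ^ (n + 10)" by (rule power_increasing) auto
    then have "l n \<ge> 1024" using l_large[of n] by simp
    then show ?thesis by (simp add: L_def)
  qed
  define I where "I w v = window_sum K (\<lambda>u. window_sum K (\<lambda>u'. fbar u u') (run n v)) (run n w)" for w v
  have I_nonneg: "I w v \<ge> 0" for w v
    unfolding I_def by (intro window_sum_nonneg fbar_nonneg)
  have I_good: "I w v \<ge> ((L - 18) * Q)\<^sup>2 * (13 / 16)" if w: "w \<in> W n" and v: "v \<in> W n" and g: "good n w v" for w v
  proof -
    let ?J = "{p. p + K \<le> (l n - 1) * q n}"
    have "fbar (take K (drop p (run n w))) (take K (drop p' (run n v))) \<ge> 13 / 16"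
      if p: "p \<in> ?J" "p' \<in> ?J" for p p'
    proof -
      let ?a = "take K (drop p (run n w))" and ?b = "take K (drop p' (run n v))"
      have len: "length ?a = K" "length ?b = K"
        using p length_run[OF w] length_run[OF v] by auto
      have "sublist ?a (run n w)" "sublist ?b (run n v)"
        by (metis sublist_drop sublist_take sublist_order.order_trans)+
      then have "real (rlcs (=) ?a ?b) \<le> sep_rate n * real (length ?a + length ?b) + real (q n)"
        using g unfolding good_def separated_def by blast
      also have "\<dots> \<le> 1 / 16 * real (K + K) + real K / 16"
        unfolding len using sep_rate_bounds[of n] K(1) by (intro add_mono mult_right_mono) auto
      finally have "real (rlcs (=) ?a ?b) / real K \<le> 3 / 16" using K0 by (simp add: field_simps)
      then show ?thesis unfolding fbar_eq_rlcs len by simp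
    qed
    then have "(\<Sum>p\<in>?J. \<Sum>p'\<in>?J. 13 / 16) \<le> I w v"
      unfolding I_def window_sum_def length_run[OF w] length_run[OF v] by (intro sum_mono) auto
    moreover have "(\<Sum>p\<in>?J. \<Sum>p'\<in>?J. 13 / 16) = real ((l n - 1) * q n + 1 - K) ^ 2 * (13 / 16)"
      by (simp only: sum_constant card_windows power2_eq_square mult.assoc)
    moreover have "(L - 18) * Q \<le> real ((l n - 1) * q n + 1 - K)"
    proof -
      have "18 \<le> l n" using L1024 unfolding L_def by linarith
      then obtain j where j: "l n = 18 + j" using le_Suc_ex by blast
      have "j * q n \<le> (l n - 1) * q n + 1 - K"
        using K(2) unfolding j by (simp add: algebra_simps)
      moreover have "(L - 18) * Q = real (j * q n)" by (simp add: L_def Q_def j)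
      ultimately show ?thesis by (simp only: of_nat_le_iff)
    qed
    then have "((L - 18) * Q)\<^sup>2 \<le> real ((l n - 1) * q n + 1 - K) ^ 2"
      using L1024 pos by (intro power_mono) auto
    ultimately show ?thesis by linarith
  qed
  have row: "(\<Sum>v\<in>W n. I w v) \<ge> M * (53 / 54) * (((L - 18) * Q)\<^sup>2 * (13 / 16))" if w: "w \<in> W n" for w
  proof -
    let ?B = "{v \<in> W n. \<not> good n w v}"
    have "card ?B * 54 \<le> card ?B * 54 ^ (2 ^ (n + 7))"
      by (intro mult_left_mono self_le_power) auto
    also have "\<dots> \<le> N n" using card_bad_le[OF w] by simp
    finally have "real (card ?B) * 54 \<le> M" unfolding M_def by linarith
    moreover have "N n = card ?B + card (W n - ?B)"
      using card_mono[of "W n" ?B] by (subst card_Diff_subset) auto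
    ultimately have "M * (53 / 54) \<le> real (card (W n - ?B))" by (simp add: M_def)
    then have "M * (53 / 54) * (((L - 18) * Q)\<^sup>2 * (13 / 16)) \<le>
        real (card (W n - ?B)) * (((L - 18) * Q)\<^sup>2 * (13 / 16))"
      by (intro mult_right_mono) auto
    also have "\<dots> = (\<Sum>v\<in>W n - ?B. ((L - 18) * Q)\<^sup>2 * (13 / 16))" by simp
    also have "\<dots> \<le> (\<Sum>v\<in>W n - ?B. I w v)" using I_good[OF w] by (intro sum_mono) auto
    also have "\<dots> \<le> (\<Sum>v\<in>W n. I w v)" by (intro sum_mono2) (auto simp: I_nonneg)
    finally show ?thesis .
  qed
  \<comment> \<open>\<open>G u\<close> bounds the inner sum over the second window from below;
    summing \<open>G\<close> over the first window applies \<open>window_sum_blocks_ge\<close> once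
    more.\<close>
  define G where "G u = real (q m) * (density n * (\<Sum>v\<in>W n. window_sum K (\<lambda>v'. fbar u v') (run n v)))" for u
  have G_nonneg: "G u \<ge> 0" for u unfolding G_def
    by (intro mult_nonneg_nonneg density_nonneg sum_nonneg window_sum_nonneg fbar_nonneg) auto
  have G_run: "window_sum K G (run n w) = real (q m) * (density n * (\<Sum>v\<in>W n. I w v))" for w
  proof -
    have "(\<Sum>v\<in>W n. I w v) = window_sum K (\<lambda>u. \<Sum>v\<in>W n. window_sum K (\<lambda>v'. fbar u v') (run n v)) (run n w)"
      unfolding I_def window_sum_def by (rule sum.swap)
    then show ?thesis unfolding G_def window_sum_def[of K _ "run n w"] by (simp add: sum_distrib_left)
  qed
  have d: "density n * (M * (L * Q)) = 1 - 1 / 2 ^ (n + 10)"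
    using pos W_nonempty[of n] by (simp add: density_def L_def Q_def M_def)
  have "1 - 1 / 2 ^ (n + 10) \<ge> (1023 / 1024 :: real)"
  proof -
    have "(2::real) ^ 10 \<le> 2 ^ (n + 10)" by (rule power_increasing) auto
    then have "1 / (2::real) ^ (n + 10) \<le> 1 / 2 ^ 10" by (intro divide_left_mono) auto
    then show ?thesis by simp
  qed
  then have d2: "(density n * (M * (L * Q)))\<^sup>2 \<ge> (1023 / 1024)\<^sup>2"
    unfolding d by (intro power_mono) auto
  \<comment> \<open>The product is about 0.77. The bound 1/2 only has to exceed the 7/16 of the
    opposite estimate.\<close>
  have "1 / 2 \<le> (1023 / 1024)\<^sup>2 * ((1006 / 1024)\<^sup>2 * (53 / 54 * (13 / 16)) :: real)"
    by (simp add: power2_eq_square)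
  also have "\<dots> \<le> (density n * (M * (L * Q)))\<^sup>2 * (((L - 18) / L)\<^sup>2 * (53 / 54 * (13 / 16)))"
  proof (intro mult_mono d2 mult_right_mono power_mono)
    show "1006 / 1024 \<le> (L - 18) / L" using L1024 by (simp add: field_simps)
  qed auto
  also have "\<dots> = density n * (M * (density n * (M * (53 / 54) * (((L - 18) * Q)\<^sup>2 * (13 / 16)))))"
    using pos by (simp add: power2_eq_square power_divide field_simps)
  also have "\<dots> = density n * (\<Sum>w\<in>W n. density n * (M * (53 / 54) * (((L - 18) * Q)\<^sup>2 * (13 / 16))))"
    by (simp add: M_def)
  also have "\<dots> \<le> density n * (\<Sum>w\<in>W n. density n * (\<Sum>v\<in>W n. I w v))"
    using row by (intro mult_left_mono sum_mono density_nonneg) auto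
  finally have "real (q m) * (real (q m) * (1 / 2)) \<le>
      real (q m) * (real (q m) * (density n * (\<Sum>w\<in>W n. density n * (\<Sum>v\<in>W n. I w v))))"
    by (intro mult_left_mono) auto
  also have "\<dots> = real (q m) * (density n * (\<Sum>w\<in>W n. window_sum K G (run n w)))"
    unfolding G_run by (simp add: sum_distrib_left mult_ac)
  also have "\<dots> \<le> window_sum K G (c m A)"
    by (rule window_sum_blocks_ge[OF G_nonneg K0 assms(1,2)])
  also have "\<dots> \<le> window_sum K (\<lambda>u. window_sum K (\<lambda>v. fbar u v) (c m A)) (c m A)"
    unfolding window_sum_def[of K _ "c m A"]
  proof (intro sum_mono)
    fix p
    show "G (take K (drop p (c m A))) \<le>
        (\<Sum>p' | p' + K \<le> length (c m A). fbar (take K (drop p (c m A))) (take K (drop p' (c m A))))"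
      using window_sum_blocks_ge[of "fbar (take K (drop p (c m A)))" K n m A, OF fbar_nonneg K0 assms(1,2)]
      unfolding G_def window_sum_def[of K _ "c m A"] .
  qed
  finally show ?thesis by (simp add: power2_eq_square)
qed

end

text \<open>Cut both windows into \<open>r\<close> pieces of length \<open>K\<close>. A pair of
  pieces in \<open>U\<close> contributes less than \<open>e\<close> and any other pair at most 1.
  For a fixed index the pieces start at distinct positions of \<open>w\<close>, so \<open>b\<close>
  bounds the number of those outside \<open>U\<close>; it counts twice, as either piece may be the
  bad one.\<close>

lemma fbar_windows_le:
  fixes e b :: real
  assumes U: "\<And>u v. u \<in> U \<Longrightarrow> v \<in> U \<Longrightarrow> fbar u v < e"
    and bad: "window_sum K (\<lambda>u. if u \<in> U then 0 else 1) w \<le> b"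
    and "K > 0" "r > 0" "e \<ge> 0"
  shows "window_sum (r * K) (\<lambda>u. window_sum (r * K) (\<lambda>v. fbar u v) w) w \<le>
    e * real (length w) ^ 2 + 2 * real (length w) * b"
proof -
  let ?L = "length w" and ?I = "{p. p + r * K \<le> length w}"
  let ?B = "\<lambda>p. if take K (drop p w) \<in> U then 0 else 1 :: real"
  have cardI: "real (card ?I) \<le> real ?L"
  proof -
    have "r * K > 0" using assms by simp
    then have "card ?I \<le> ?L" unfolding card_windows by linarith
    then show ?thesis by simp
  qed
  have Bsum: "(\<Sum>p\<in>?I. ?B (p + i * K)) \<le> b" if "i < r" for i
  proof -
    have "i * K + K \<le> r * K" using that by (metis Suc_leI add.commute mult_Suc mult_le_mono1)
    have "(\<Sum>p\<in>?I. ?B (p + i * K)) = (\<Sum>p\<in>(\<lambda>p. p + i * K) ` ?I. ?B p)"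
      by (subst sum.reindex) (auto simp: inj_on_def)
    also have "\<dots> \<le> (\<Sum>p | p + K \<le> ?L. ?B p)"
      using \<open>i * K + K \<le> r * K\<close> by (intro sum_mono2) auto
    also have "\<dots> \<le> b" using bad by (simp add: window_sum_def)
    finally show ?thesis .
  qed
  have b: "b \<ge> 0" using Bsum[OF \<open>r > 0\<close>] by (rule order_trans[rotated]) (auto intro: sum_nonneg)
  have pair: "fbar (take (r * K) (drop p w)) (take (r * K) (drop p' w)) \<le>
      (\<Sum>i<r. e + ?B (p + i * K) + ?B (p' + i * K)) / real r" if "p \<in> ?I" "p' \<in> ?I" for p p'
  proof -
    let ?u = "take (r * K) (drop p w)" and ?v = "take (r * K) (drop p' w)"
    have "fbar ?u ?v \<le> (\<Sum>i<r. fbar (take K (drop (i * K) ?u)) (take K (drop (i * K) ?v))) / real r"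
      by (rule fbar_le_average) (use that assms in auto)
    also have "\<dots> \<le> (\<Sum>i<r. e + ?B (p + i * K) + ?B (p' + i * K)) / real r"
    proof (intro divide_right_mono sum_mono)
      fix i assume "i \<in> {..<r}"
      then have "i * K + K \<le> r * K" by (metis Suc_leI add.commute lessThan_iff mult_Suc mult_le_mono1)
      then have "take K (drop (i * K) (take (r * K) (drop p w))) = take K (drop (p + i * K) w)" for p
        by (simp add: drop_take min_def add.commute)
      then show "fbar (take K (drop (i * K) ?u)) (take K (drop (i * K) ?v)) \<le>
          e + ?B (p + i * K) + ?B (p' + i * K)"
        using U[of "take K (drop (p + i * K) w)" "take K (drop (p' + i * K) w)"]
          fbar_le_1[of "take K (drop (p + i * K) w)" "take K (drop (p' + i * K) w)"] \<open>e \<ge> 0\<close> by auto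
    qed simp
    finally show ?thesis .
  qed
  have "window_sum (r * K) (\<lambda>u. window_sum (r * K) (\<lambda>v. fbar u v) w) w \<le>
      (\<Sum>p\<in>?I. \<Sum>p'\<in>?I. (\<Sum>i<r. e + ?B (p + i * K) + ?B (p' + i * K)) / real r)"
    unfolding window_sum_def using pair by (intro sum_mono) auto
  also have "\<dots> = (\<Sum>i<r. \<Sum>p\<in>?I. \<Sum>p'\<in>?I. e + ?B (p + i * K) + ?B (p' + i * K)) / real r"
    unfolding sum_divide_distrib[symmetric] sum.swap[of _ "{..<r}" ?I] ..
  also have "\<dots> \<le> (\<Sum>i<r. e * real ?L ^ 2 + 2 * real ?L * b) / real r"
  proof (intro divide_right_mono sum_mono)
    fix i assume "i \<in> {..<r}"
    let ?S = "\<Sum>p\<in>?I. ?B (p + i * K)"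
    have "(\<Sum>p\<in>?I. \<Sum>p'\<in>?I. e + ?B (p + i * K) + ?B (p' + i * K)) =
        e * real (card ?I) ^ 2 + real (card ?I) * ?S + real (card ?I) * ?S"
      by (simp only: sum.distrib sum_constant sum_distrib_left[symmetric] power2_eq_square mult_ac)
    also have "\<dots> \<le> e * real ?L ^ 2 + real ?L * b + real ?L * b"
      using Bsum \<open>i \<in> {..<r}\<close> cardI \<open>e \<ge> 0\<close> b
      by (intro add_mono mult_left_mono mult_mono power_mono) (auto intro: sum_nonneg)
    also have "\<dots> = e * real ?L ^ 2 + 2 * real ?L * b" by simp
    finally show "(\<Sum>p\<in>?I. \<Sum>p'\<in>?I. e + ?B (p + i * K) + ?B (p' + i * K)) \<le>
        e * real ?L ^ 2 + 2 * real ?L * b" .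
  qed simp
  also have "\<dots> = e * real ?L ^ 2 + 2 * real ?L * b" using \<open>r > 0\<close> by simp
  finally show ?thesis .
qed

section \<open>The invariant measure\<close>

locale E_measure = E_system +
  fixes \<nu> :: "(int \<Rightarrow> 'a circ_symbol) measure"
  assumes sys: "system_measure (circular_sequence k l W) \<nu>"
begin

sublocale prob_space \<nu>
  using sys by (simp add: system_measure_def)

abbreviation S :: "(int \<Rightarrow> 'a circ_symbol) set" where
  "S \<equiv> symbolic_system (circular_sequence k l W)"

definition letters :: "'a circ_symbol set" where
  "letters = Letter ` \<Sigma> \<union> {Spacer_b, Spacer_e}"

lemma finite_letters [simp]: "finite letters"
  by (simp add: letters_def fin_alphabet)

lemma sets_nu: "sets \<nu> = sets (restrict_space (\<Pi>\<^sub>M i\<in>UNIV. count_space UNIV) S)"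
  using sys by (simp add: system_measure_def)

lemma space_nu: "space \<nu> = S"
  using sets_eq_imp_space_eq[OF sets_nu] by (simp add: space_restrict_space space_PiM)

lemma set_c: "w \<in> W n \<Longrightarrow> set (c n w) \<subseteq> letters"
proof (induction n arbitrary: w)
  case 0
  then show ?case using E_seq by (auto simp: E_sequence_def letters_def)
next
  case (Suc n)
  then obtain u where u: "u \<in> free n" "w = concat (full n u)" unfolding W_Suc_eq by blast
  have IH: "set (c n x) \<subseteq> letters" if "x \<in> set (full n u)" for x
    using Suc.IH set_full[OF u(1)] that by blast
  have "set (circ_pass k l n i (map (c n) (full n u))) \<subseteq> letters" for i
  proof -
    have "set (replicate (q n - j_index k l n i) Spacer_b @ concat (replicate (l n - 1) x) @
        replicate (j_index k l n i) Spacer_e) \<subseteq> letters" if "x \<in> set (map (c n) (full n u))" for x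
    proof -
      from that obtain v where "v \<in> set (full n u)" "x = c n v" unfolding set_map by blast
      then have "set x \<subseteq> letters" using IH by blast
      then have "set (concat (replicate (l n - 1) x)) \<subseteq> letters" by auto
      then show ?thesis by (auto simp: letters_def)
    qed
    then show ?thesis unfolding circ_pass_def set_concat set_map by blast
  qed
  then have "set (concat (map (\<lambda>i. circ_pass k l n i (map (c n) (full n u))) [0..<q n])) \<subseteq> letters"
    unfolding set_concat set_map by blast
  moreover have "c (Suc n) w = concat (map (\<lambda>i. circ_pass k l n i (map (c n) (full n u))) [0..<q n])"
    unfolding u(2) c_Suc[OF u(1)] by (rule circ_op_eq_passes) (use length_full[OF u(1)] in simp)
  ultimately show ?case by (simp only:)
qed

lemma S_letters: "x \<in> S \<Longrightarrow> x i \<in> letters"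
proof -
  assume "x \<in> S"
  then obtain n w where "w \<in> circular_sequence k l W n" "sublist (map (\<lambda>j. x (i + int j)) [0..<1]) w"
    unfolding symbolic_system_def by blast
  then have "x i \<in> set w" "\<exists>v\<in>W n. w = c n v"
    by (auto simp: circular_sequence_def dest: set_mono_sublist)
  then show ?thesis using set_c by blast
qed

lemma shift_in_S: "x \<in> S \<Longrightarrow> (\<lambda>i. x (i + a)) \<in> S"
proof -
  assume x: "x \<in> S"
  show ?thesis
    unfolding symbolic_system_def
  proof (intro CollectI allI)
    fix b m
    have "\<exists>n. \<exists>w\<in>circular_sequence k l W n. sublist (map (\<lambda>i. x (b + a + int i)) [0..<m]) w"
      using x unfolding symbolic_system_def by blast
    then show "\<exists>n. \<exists>w\<in>circular_sequence k l W n. sublist (map (\<lambda>i. x (b + int i + a)) [0..<m]) w"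
      by (simp add: add_ac)
  qed
qed

lemma coordinate_sets: "{x \<in> space \<nu>. x i = a} \<in> events"
proof -
  have "(\<lambda>x. x i) \<in> measurable (restrict_space (\<Pi>\<^sub>M i\<in>UNIV. count_space UNIV) S) (count_space UNIV)"
    by (intro measurable_restrict_space1 measurable_component_singleton) auto
  then have "(\<lambda>x. x i) \<in> measurable \<nu> (count_space UNIV)"
    by (simp add: measurable_cong_sets[OF sets_nu refl])
  then have "(\<lambda>x. x i) -` {a} \<inter> space \<nu> \<in> events" by (rule measurable_sets) simp
  moreover have "(\<lambda>x. x i) -` {a} \<inter> space \<nu> = {x \<in> space \<nu>. x i = a}" by auto
  ultimately show ?thesis by simp
qed

lemma cylinder_sets: "{x \<in> space \<nu>. map x J = u} \<in> events"
proof (induction J arbitrary: u)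
  case Nil
  then show ?case by (cases u) auto
next
  case (Cons j J)
  show ?case
  proof (cases u)
    case (Cons a v)
    have "{x \<in> space \<nu>. map x (j # J) = u} = {x \<in> space \<nu>. x j = a} \<inter> {x \<in> space \<nu>. map x J = v}"
      using Cons by auto
    then show ?thesis using coordinate_sets Cons.IH by auto
  qed simp
qed

section \<open>Events depending on finitely many coordinates\<close>

abbreviation words :: "nat \<Rightarrow> 'a circ_symbol list set" where
  "words K \<equiv> {u. set u \<subseteq> letters \<and> length u = K}"

lemma word_in_words: "x \<in> space \<nu> \<Longrightarrow> map x J \<in> words (length J)"
  using S_letters by (auto simp: space_nu)

text \<open>As the alphabet is finite, such an event is a finite union of cylinders, whose measures
  are known as limiting frequencies.\<close>

lemma word_event_eq:
  "{x \<in> space \<nu>. P (map x J)} = (\<Union>u\<in>{u \<in> words (length J). P u}. {x \<in> space \<nu>. map x J = u})"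
  using word_in_words by auto

lemma finite_words [simp]: "finite {u \<in> words K. P u}"
  by (rule finite_subset[OF _ finite_lists_length_eq[OF finite_letters, of K]]) auto

lemma word_event: "{x \<in> space \<nu>. P (map x J)} \<in> events"
  unfolding word_event_eq by (intro sets.finite_UN finite_words cylinder_sets)

lemma prob_word_event:
  "prob {x \<in> space \<nu>. P (map x J)} = (\<Sum>u | u \<in> words (length J) \<and> P u. prob {x \<in> space \<nu>. map x J = u})"
  unfolding word_event_eq
  by (rule finite_measure_finite_Union[OF finite_words]) (auto simp: disjoint_family_on_def cylinder_sets)

lemma prob_shift_Suc:
  "prob {x \<in> space \<nu>. P (map (\<lambda>j. x (j + 1)) J)} = prob {x \<in> space \<nu>. P (map x J)}"
proof -
  have meas: "left_shift \<in> measurable \<nu> \<nu>" and d: "distr \<nu> \<nu> left_shift = \<nu>"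
    using sys by (auto simp: system_measure_def)
  have "prob {x \<in> space \<nu>. P (map x J)} = measure (distr \<nu> \<nu> left_shift) {x \<in> space \<nu>. P (map x J)}"
    by (simp add: d)
  also have "\<dots> = prob (left_shift -` {x \<in> space \<nu>. P (map x J)} \<inter> space \<nu>)"
    by (rule measure_distr[OF meas word_event])
  also have "left_shift -` {x \<in> space \<nu>. P (map x J)} \<inter> space \<nu> =
      {x \<in> space \<nu>. P (map (\<lambda>j. x (j + 1)) J)}"
    using measurable_space[OF meas] by (auto simp: left_shift_def[abs_def])
  finally show ?thesis by simp
qed

lemma prob_shift_nat:
  "prob {x \<in> space \<nu>. P (map (\<lambda>j. x (j + int m)) J)} = prob {x \<in> space \<nu>. P (map x J)}"
proof (induction m)
  case (Suc m)
  have "prob {x \<in> space \<nu>. P (map (\<lambda>j. x (j + 1)) (map (\<lambda>j. j + int m) J))} =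
      prob {x \<in> space \<nu>. P (map x (map (\<lambda>j. j + int m) J))}"
    by (rule prob_shift_Suc)
  then show ?case using Suc by (simp add: comp_def add_ac)
qed simp

text \<open>A negative shift is undone by a positive one applied to the coordinates already moved by
  \<open>a\<close>.\<close>

lemma prob_shift:
  "prob {x \<in> space \<nu>. P (map (\<lambda>j. x (j + a)) J)} = prob {x \<in> space \<nu>. P (map x J)}"
proof (cases "a \<ge> 0")
  case True
  then show ?thesis using prob_shift_nat[of P "nat a" J] by simp
next
  case False
  then have "prob {x \<in> space \<nu>. P (map (\<lambda>j. x (j + int (nat (- a)))) (map (\<lambda>j. j + a) J))} =
      prob {x \<in> space \<nu>. P (map x (map (\<lambda>j. j + a) J))}"
    using prob_shift_nat by blast
  then show ?thesis using False by (simp add: comp_def)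
qed

lemma sum_frequency:
  assumes "set w \<subseteq> letters"
  shows "(\<Sum>u | u \<in> words K \<and> P u. frequency u w) =
    window_sum K (\<lambda>u. if P u then 1 else 0) w / real (length w)"
proof -
  let ?I = "{p. p + K \<le> length w}"
  have "(\<Sum>u | u \<in> words K \<and> P u. frequency u w) =
      (\<Sum>u | u \<in> words K \<and> P u. \<Sum>p\<in>?I. if take K (drop p w) = u then 1 / real (length w) else 0)"
  proof (intro sum.cong refl)
    fix u assume u: "u \<in> {u. u \<in> words K \<and> P u}"
    have "(\<Sum>p\<in>?I. if take K (drop p w) = u then 1 / real (length w) else 0) =
        (\<Sum>p\<in>{p \<in> ?I. take K (drop p w) = u}. 1 / real (length w))"
      by (rule sum.inter_filter[symmetric]) simp
    then show "frequency u w = (\<Sum>p\<in>?I. if take K (drop p w) = u then 1 / real (length w) else 0)"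
      using u by (simp add: frequency_def)
  qed
  also have "\<dots> = (\<Sum>p\<in>?I. \<Sum>u | u \<in> words K \<and> P u. if take K (drop p w) = u then 1 / real (length w) else 0)"
    by (rule sum.swap)
  also have "\<dots> = (\<Sum>p\<in>?I. (if P (take K (drop p w)) then 1 else 0) / real (length w))"
  proof (intro sum.cong refl)
    fix p assume p: "p \<in> ?I"
    then have "take K (drop p w) \<in> words K"
      using assms set_take_subset[of K "drop p w"] set_drop_subset[of p w] by auto
    then show "(\<Sum>u | u \<in> words K \<and> P u. if take K (drop p w) = u then 1 / real (length w) else 0) =
        (if P (take K (drop p w)) then 1 else 0) / real (length w)"
      using finite_words[of K P] by (subst sum.delta') auto
  qed
  finally show ?thesis by (simp add: window_sum_def sum_divide_distrib)
qed

text \<open>The passage from counting in blocks to the measure: frequencies converge for each of the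
  finitely many words, hence for every set of words of length \<open>K\<close>.\<close>

lemma window_frequency_tendsto:
  assumes "\<And>m. A m \<in> W m"
  shows "(\<lambda>m. window_sum K (\<lambda>u. if P u then 1 else 0) (c m (A m)) / real (q m)) \<longlonglongrightarrow>
    prob {x \<in> space \<nu>. P (map x (map int [0..<K]))}"
proof -
  have "(\<lambda>m. frequency u (c m (A m))) \<longlonglongrightarrow> prob {x \<in> space \<nu>. map x (map int [0..<K]) = u}"
    if "u \<in> {u. u \<in> words K \<and> P u}" for u
  proof -
    have "\<forall>n. c n (A n) \<in> circular_sequence k l W n"
      using assms by (auto simp: circular_sequence_def)
    then show ?thesis
      using sys that unfolding system_measure_def by (auto simp: comp_def)
  qed
  then have lim: "(\<lambda>m. \<Sum>u | u \<in> words K \<and> P u. frequency u (c m (A m))) \<longlonglongrightarrow>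
      (\<Sum>u | u \<in> words K \<and> P u. prob {x \<in> space \<nu>. map x (map int [0..<K]) = u})"
    by (rule tendsto_sum)
  have "(\<Sum>u | u \<in> words K \<and> P u. frequency u (c m (A m))) =
      window_sum K (\<lambda>u. if P u then 1 else 0) (c m (A m)) / real (q m)" for m
    unfolding sum_frequency[OF set_c[OF assms]] length_c[OF assms] ..
  then show ?thesis using lim unfolding prob_word_event[of P] by simp
qed

definition some_word :: "nat \<Rightarrow> 'a list" where "some_word m = (SOME w. w \<in> W m)"

lemma some_word: "some_word m \<in> W m"
  unfolding some_word_def using W_nonempty[of m] by (simp add: some_in_eq)

lemma prob_periodic_ge: "prob {x \<in> space \<nu>. x i = x (i + int (q n))} \<ge> 1 - 3 / 2 ^ (n + 10)"
proof -
  let ?P = "\<lambda>u. u ! 0 = u ! q n" and ?J = "map int [0..<q n + 1]"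
  have "1 - 3 / 2 ^ (n + 10) \<le> prob {x \<in> space \<nu>. ?P (map x ?J)}"
  proof (rule LIMSEQ_le_const[OF window_frequency_tendsto[OF some_word]], intro exI allI impI)
    fix m assume "Suc n \<le> m"
    then show "1 - 3 / 2 ^ (n + 10) \<le>
        window_sum (q n + 1) (\<lambda>u. if ?P u then 1 else 0) (c m (some_word m)) / real (q m)"
      using count_periodic_windows_ge[OF _ some_word, of n m] q_pos[of m] by (simp add: pos_le_divide_eq)
  qed
  also have "\<dots> = prob {x \<in> space \<nu>. ?P (map (\<lambda>j. x (j + i)) ?J)}"
    by (rule prob_shift[symmetric])
  also have "\<dots> = prob {x \<in> space \<nu>. x i = x (i + int (q n))}"
    by (simp add: add.commute del: upt_Suc)
  finally show ?thesis .
qed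

section \<open>Iterates of the shift and atoms of the past\<close>

lemma iterate_left_shift: "(left_shift ^^ i) x = (\<lambda>j. x (j + int i))"
  by (induction i) (auto simp: left_shift_def add_ac)

text \<open>The space is closed under shifts in both directions, so \<open>inv_into\<close> is the
  right shift on it.\<close>

lemma iterate_nonpos:
  assumes "x \<in> space \<nu>" "i \<le> 0"
  shows "iterate \<nu> left_shift i x = (\<lambda>j. x (j + i))"
proof -
  have inj: "inj_on left_shift (space \<nu>)"
  proof (rule inj_onI)
    fix x y :: "int \<Rightarrow> 'a circ_symbol" assume eq: "left_shift x = left_shift y"
    show "x = y"
    proof
      fix i show "x i = y i" using fun_cong[OF eq, of "i - 1"] by (simp add: left_shift_def)
    qed
  qed
  have inv: "inv_into (space \<nu>) left_shift y = (\<lambda>j. y (j - 1))" if "y \<in> space \<nu>" for y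
    by (rule inv_into_f_eq[OF inj]) (use shift_in_S[of y "-1"] that in \<open>auto simp: space_nu left_shift_def\<close>)
  have "(inv_into (space \<nu>) left_shift ^^ m) x = (\<lambda>j. x (j - int m))" for m
  proof (induction m)
    case (Suc m)
    have "(\<lambda>j. x (j - int m)) \<in> space \<nu>"
      using shift_in_S[of x "- int m"] assms(1) by (simp add: space_nu)
    then show ?case using Suc inv by (simp add: algebra_simps)
  qed simp
  from this[of "nat (- i)"] show ?thesis using assms(2) by (auto simp: iterate_def)
qed

text \<open>For an injective labelling of the zeroth coordinate the atoms are cylinders: measurable,
  finite in number, and disjoint when distinct.\<close>

lemma past_atoms_subset:
  assumes "inj f"
  shows "past_atoms \<nu> left_shift (\<lambda>x. f (x 0)) m \<subseteq>
    (\<lambda>u. {x \<in> space \<nu>. map x [- int m..0] = u}) ` words (length [- int m..0])"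
proof
  fix A assume "A \<in> past_atoms \<nu> left_shift (\<lambda>x. f (x 0)) m"
  then obtain d x where A: "A = {x \<in> space \<nu>. \<forall>i \<in> {- int m..0}. f (iterate \<nu> left_shift i x 0) = d i}"
    and x: "x \<in> A" unfolding past_atoms_def by blast
  have A': "A = {x \<in> space \<nu>. \<forall>i \<in> {- int m..0}. f (x i) = d i}"
    unfolding A by (auto simp: iterate_nonpos)
  then have "\<And>i. i \<in> {- int m..0} \<Longrightarrow> d i = f (x i)" using x by auto
  then have "A = {y \<in> space \<nu>. map y [- int m..0] = map x [- int m..0]}"
    unfolding A' using assms by (auto simp: inj_eq)
  moreover have "x \<in> space \<nu>" using x A' by blast
  ultimately show "A \<in> (\<lambda>u. {x \<in> space \<nu>. map x [- int m..0] = u}) ` words (length [- int m..0])"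
    using word_in_words by blast
qed

lemma finite_partition_zero:
  "finite_partition \<nu> (\<lambda>x. f (x 0) :: nat)"
  unfolding finite_partition_def
proof
  show "finite ((\<lambda>x. f (x 0)) ` space \<nu>)"
    by (rule finite_subset[OF _ finite_imageI[OF finite_letters, of f]])
      (use S_letters in \<open>auto simp: space_nu\<close>)
  show "(\<lambda>x. f (x 0)) \<in> measurable \<nu> (count_space UNIV)"
  proof (rule measurableI)
    fix B :: "nat set"
    have "{x \<in> space \<nu>. f (x 0) \<in> B} \<in> events"
      using word_event[of "\<lambda>u. f (hd u) \<in> B" "[0]"] by simp
    moreover have "{x \<in> space \<nu>. f (x 0) \<in> B} = (\<lambda>x. f (x 0)) -` B \<inter> space \<nu>" by auto
    ultimately show "(\<lambda>x. f (x 0)) -` B \<inter> space \<nu> \<in> events" by simp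
  qed simp
qed

end

section \<open>Points with close names from close measures\<close>

lemma (in prob_space) three_large_events_meet:
  assumes "A \<in> events" "B \<in> events" "C \<in> events" "prob A + prob B + prob C > 2"
  shows "A \<inter> B \<inter> C \<noteq> {}"
proof
  assume empty: "A \<inter> B \<inter> C = {}"
  have "prob (A \<union> B) = prob A + prob B - prob (A \<inter> B)"
    using assms by (intro measure_Un3) (auto simp: fmeasurable_eq_sets)
  moreover have "prob (A \<inter> B \<union> C) = prob (A \<inter> B) + prob C"
    using assms empty by (intro finite_measure_Union) auto
  ultimately show False
    using assms prob_le_1[of "A \<union> B"] prob_le_1[of "A \<inter> B \<union> C"] by linarith
qed

text \<open>Three events meet: \<open>C\<close>, the points sent into \<open>D\<close>, and the set
  \<open>G\<close> of points with close images. Their measures add up to more than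
  \<open>(1 + e) + (1 - e) = 2\<close>.\<close>

lemma fbar_measures_less_point:
  assumes less: "fbar_measures_less T P K \<nu> \<omega> e" and "prob_space \<nu>"
    and "C \<in> sets \<nu>" "D \<in> sets \<omega>" "measure \<nu> C + measure \<omega> D > 1 + e"
  obtains x y where "x \<in> C" "y \<in> D" "fbar_name T P K x y < e"
proof -
  interpret prob_space \<nu> by fact
  obtain \<phi> X Y G where G: "G \<in> sets \<nu>" "prob G > 1 - e" "\<And>x. x \<in> G \<Longrightarrow> fbar_name T P K x (\<phi> x) < e"
    and mp: "\<And>B. B \<in> sets \<omega> \<Longrightarrow> emeasure \<nu> (\<phi> -` B \<inter> X) = emeasure \<omega> B"
    using less unfolding fbar_measures_less_def invertible_measure_preserving_def by blast
  let ?D = "\<phi> -` D \<inter> X"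
  have m: "prob ?D = measure \<omega> D" using mp[OF assms(4)] by (simp add: measure_def)
  have "prob C \<le> 1" by simp
  moreover have "prob G \<le> 1" by simp
  ultimately have "prob ?D \<noteq> 0" using m assms(5) G(2) by linarith
  \<comment> \<open>\<open>measure\<close> is 0 on sets that are not measurable, so a nonzero value
    shows that \<open>?D\<close> is an event.\<close>
  then have D: "?D \<in> events" using measure_notin_sets by blast
  have "C \<inter> ?D \<inter> G \<noteq> {}"
    by (rule three_large_events_meet) (use assms(3,5) G D m in auto)
  then obtain x where "x \<in> C" "\<phi> x \<in> D" "x \<in> G" by blast
  then show ?thesis using that G(3) by blast
qed

section \<open>Failure of the loosely Bernoulli property\<close>

context E_measure
begin

lemma prob_not_periodic_le:
  "prob {x \<in> space \<nu>. \<not> (\<forall>i\<in>{1..K}. x (int i) = x (int i - int (q n)))} \<le> real K * (3 / 2 ^ (n + 10))"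
proof -
  let ?D = "\<lambda>i. {x \<in> space \<nu>. x (int i - int (q n)) = x (int i - int (q n) + int (q n))}"
  have D: "?D i \<in> events" for i
    using word_event[of "\<lambda>u. u ! 0 = u ! 1" "[int i - int (q n), int i - int (q n) + int (q n)]"] by simp
  have "{x \<in> space \<nu>. \<not> (\<forall>i\<in>{1..K}. x (int i) = x (int i - int (q n)))} =
      (\<Union>i\<in>{1..K}. space \<nu> - ?D i)"
    by force
  also have "prob \<dots> \<le> (\<Sum>i\<in>{1..K}. prob (space \<nu> - ?D i))"
    by (rule finite_measure_subadditive_finite) (use D in auto)
  also have "\<dots> \<le> (\<Sum>i\<in>{1..K}. 3 / 2 ^ (n + 10))"
  proof (rule sum_mono)
    fix i
    have "prob (space \<nu> - ?D i) = 1 - prob (?D i)" by (rule prob_compl[OF D])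
    then show "prob (space \<nu> - ?D i) \<le> 3 / 2 ^ (n + 10)"
      using prob_periodic_ge[where i = "int i - int (q n)" and n = n] by simp
  qed
  finally show ?thesis by simp
qed

lemma q_ge_power: "2 ^ n \<le> q n"
proof (induction n)
  case (Suc n)
  have "pass_length n \<ge> 2 * 1"
  proof -
    have "(2::nat) ^ 1 \<le> 2 ^ (n + 12)" by (rule power_increasing) auto
    then have "k n \<ge> 2" using k_large[of n] by simp
    moreover have "l n * q n \<ge> 1" using l_ge[of n] q_pos[of n] by simp
    ultimately show ?thesis by (rule mult_le_mono)
  qed
  then have "2 ^ n * 2 \<le> q n * pass_length n" using Suc by (intro mult_le_mono) auto
  then show ?case unfolding q_Suc by simp
qed simp

text \<open>Each atom \<open>A\<close> of the past of length \<open>q n \<ge> K\<close> predicts the \<open>K\<close>-name by \<open>x i = x (i - q n)\<close>.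
  For two atoms on which the prediction mostly succeeds, the map between their conditional measures
  sends some correctly predicted point to a correctly predicted one, so that the two predicted
  names are close.\<close>

lemma close_names:
  fixes f :: "'a circ_symbol \<Rightarrow> nat"
  assumes LB: "loosely_Bernoulli_process \<nu> left_shift (\<lambda>x. f (x 0))" and f: "inj f"
    and e: "0 < e" "e \<le> 1 / 4"
  obtains K H where "K > 0" "H \<subseteq> space \<nu>" "H \<in> events" "prob H \<ge> 1 - 2 * e"
    "\<And>x y. x \<in> H \<Longrightarrow> y \<in> H \<Longrightarrow>
      fbar (map x (map int [1..<Suc K])) (map y (map int [1..<Suc K])) < e"
proof -
  let ?P = "\<lambda>x :: int \<Rightarrow> 'a circ_symbol. f (x 0)"
  let ?Q = "\<lambda>K m \<G>. prob (\<Union>\<G>) > 1 - e \<and> (\<forall>A\<in>\<G>. \<forall>B\<in>\<G>. prob A > 0 \<and> prob B > 0 \<longrightarrow>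
        fbar_measures_less left_shift ?P K (uniform_measure \<nu> A) (uniform_measure \<nu> B) e)"
  have "\<exists>K>0. \<forall>m>0. \<exists>\<G>\<subseteq>past_atoms \<nu> left_shift ?P m. ?Q K m \<G>"
    using spec[OF iffD1[OF loosely_Bernoulli_process_def LB], of e] e(1) by (rule mp)
  then obtain K where "K > 0" and K: "\<forall>m>0. \<exists>\<G>\<subseteq>past_atoms \<nu> left_shift ?P m. ?Q K m \<G>"
    by (elim exE conjE)
  \<comment> \<open>\<open>K\<close> was fixed before the length of the past, so \<open>n\<close>
    may depend on it. This choice gives \<open>K \<le> q n\<close> and lets the prediction fail with
    probability at most \<open>e / 5\<close>; five such portions are spent, one on the failures and
    four on the atoms outside \<open>\<H>\<close>.\<close>
  obtain n where n: "real K * 15 / e < 2 ^ n" using real_arch_pow[of 2] by auto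
  have "real K * 1 \<le> real K * (15 / e)"
    using e by (intro mult_left_mono) (auto simp: field_simps)
  then have "real K \<le> real K * 15 / e" by simp
  then have "real K < real (2 ^ n)" using n unfolding of_nat_power of_nat_numeral by linarith
  then have Kq: "K \<le> q n" using q_ge_power[of n] unfolding of_nat_less_iff by linarith
  have small: "real K * (3 / 2 ^ (n + 10)) \<le> e / 5"
  proof -
    have "real K * 15 \<le> e * 2 ^ n" using n e(1) by (simp add: field_simps)
    also have "\<dots> \<le> e * 2 ^ (n + 10)" using e(1) by (intro mult_left_mono power_increasing) auto
    finally show ?thesis by (simp add: field_simps)
  qed
  let ?m = "q n" and ?J = "[- int (q n)..0]"
  obtain \<G> where G: "\<G> \<subseteq> past_atoms \<nu> left_shift ?P ?m" "prob (\<Union>\<G>) > 1 - e"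
    "\<And>A B. A \<in> \<G> \<Longrightarrow> B \<in> \<G> \<Longrightarrow> prob A > 0 \<Longrightarrow> prob B > 0 \<Longrightarrow>
        fbar_measures_less left_shift ?P K (uniform_measure \<nu> A) (uniform_measure \<nu> B) e"
  proof -
    from K q_pos[of n] obtain \<G> where "\<G> \<subseteq> past_atoms \<nu> left_shift ?P ?m" "?Q K ?m \<G>" by meson
    then show ?thesis using that by blast
  qed
  let ?at = "\<lambda>u. {x \<in> space \<nu>. map x ?J = u}"
  have atoms: "\<G> \<subseteq> ?at ` words (length ?J)"
    using G(1) past_atoms_subset[OF f] by (rule order_trans)
  have atom: "\<exists>u. A = ?at u" if "A \<in> \<G>" for A
    using subsetD[OF atoms that] by (rule imageE) (rule exI)
  have "finite (words (length ?J))" using finite_words[of "length ?J" "\<lambda>_. True"] by simp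
  then have fin: "finite \<G>" using atoms by (rule finite_surj)
  have G_events: "A \<in> events" if "A \<in> \<G>" for A
    using atom[OF that] by (elim exE) (simp only: cylinder_sets)
  have disj: "A \<inter> B = {}" if "A \<in> \<G>" "B \<in> \<G>" "A \<noteq> B" for A B
  proof -
    obtain u v where "A = ?at u" "B = ?at v"
      using atom[OF \<open>A \<in> \<G>\<close>] atom[OF \<open>B \<in> \<G>\<close>] by (elim exE) (rule that)
    then show ?thesis using \<open>A \<noteq> B\<close> by auto
  qed
  define E where "E = {x \<in> space \<nu>. \<forall>i\<in>{1..K}. x (int i) = x (int i - int ?m)}"
  have E: "E \<in> events"
  proof -
    have "{x \<in> space \<nu>. x (int i) = x (int i - int ?m)} \<in> events" for i
      using word_event[of "\<lambda>u. u ! 0 = u ! 1" "[int i, int i - int ?m]"] by simp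
    then show ?thesis unfolding E_def by (intro sets.sets_Collect_finite_All) auto
  qed
  have compl: "prob (space \<nu> - E) \<le> e / 5"
  proof -
    have "space \<nu> - E = {x \<in> space \<nu>. \<not> (\<forall>i\<in>{1..K}. x (int i) = x (int i - int ?m))}"
      by (auto simp: E_def)
    then show ?thesis using prob_not_periodic_le[of K n] small by simp
  qed
  \<comment> \<open>Given such an atom, the prediction succeeds with probability above 3/4. For two
    atoms these probabilities exceed \<open>1 + e\<close> in total, because
    \<open>e \<le> 1 / 4\<close>.\<close>
  define \<H> where "\<H> = {A \<in> \<G>. 4 * prob (A - E) < prob A}"
  define H where "H = (\<Union>A\<in>\<H>. A \<inter> E)"
  have fin\<H>: "finite \<H>" "\<H> \<subseteq> \<G>" using fin by (auto simp: \<H>_def)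
  have H: "H \<in> events" unfolding H_def using fin\<H> G_events E by (intro sets.finite_UN) auto
  have "prob (\<Union>\<G>) \<le> prob (H \<union> ((space \<nu> - E) \<union> \<Union>(\<G> - \<H>)))"
  proof (rule finite_measure_mono)
    show "\<Union>\<G> \<subseteq> H \<union> ((space \<nu> - E) \<union> \<Union>(\<G> - \<H>))"
      using G_events sets.sets_into_space by (fastforce simp: H_def)
    show "H \<union> ((space \<nu> - E) \<union> \<Union>(\<G> - \<H>)) \<in> events"
      using H E G_events fin by (intro sets.Un sets.Diff sets.finite_Union) auto
  qed
  also have "\<dots> \<le> prob H + prob ((space \<nu> - E) \<union> \<Union>(\<G> - \<H>))"
    using H E G_events fin
    by (intro measure_Un_le sets.Un sets.Diff sets.finite_Union) auto
  also have "prob ((space \<nu> - E) \<union> \<Union>(\<G> - \<H>)) \<le> prob (space \<nu> - E) + prob (\<Union>(\<G> - \<H>))"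
    using E G_events fin
    by (intro measure_Un_le sets.Un sets.Diff sets.finite_Union) auto
  \<comment> \<open>Markov's inequality: an atom outside \<open>\<H>\<close> has at least a quarter
    of its measure in the complement of \<open>E\<close>.\<close>
  also have "prob (\<Union>(\<G> - \<H>)) \<le> 4 * prob (space \<nu> - E)"
  proof -
    have "prob (\<Union>A\<in>\<G> - \<H>. A) \<le> (\<Sum>A\<in>\<G> - \<H>. prob A)"
      using fin G_events by (intro finite_measure_subadditive_finite) auto
    also have "\<dots> \<le> (\<Sum>A\<in>\<G> - \<H>. 4 * prob (A - E))"
      by (intro sum_mono) (auto simp: \<H>_def)
    also have "\<dots> = 4 * (\<Sum>A\<in>\<G> - \<H>. prob (A - E))" by (simp only: sum_distrib_left)
    also have "(\<Sum>A\<in>\<G> - \<H>. prob (A - E)) = prob (\<Union>A\<in>\<G> - \<H>. A - E)"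
      using fin G_events E disj
      by (intro finite_measure_finite_Union[symmetric]) (auto simp: disjoint_family_on_def)
    also have "\<dots> \<le> prob (space \<nu> - E)"
      using E G_events sets.sets_into_space by (intro finite_measure_mono) fastforce+
    finally show ?thesis by simp
  qed
  finally have prob_H: "prob H \<ge> 1 - 2 * e" using G(2) compl by linarith
  have close: "fbar (map x (map int [1..<Suc K])) (map y (map int [1..<Suc K])) < e"
    if "x \<in> H" "y \<in> H" for x y
  proof -
    from that obtain A B where A: "A \<in> \<H>" "x \<in> A" "x \<in> E" and B: "B \<in> \<H>" "y \<in> B" "y \<in> E"
      by (auto simp: H_def)
    have *: "prob A > 0" "A \<in> events" "prob_space (uniform_measure \<nu> A)"
      "measure (uniform_measure \<nu> A) (A \<inter> E) > 3 / 4" if "A \<in> \<H>" for A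
    proof -
      have A: "A \<in> \<G>" "4 * prob (A - E) < prob A" using that by (auto simp: \<H>_def)
      have "prob (A - E) \<ge> 0" by simp
      then show pos: "prob A > 0" using A(2) by linarith
      show ev: "A \<in> events" using A G_events by blast
      have "emeasure \<nu> A \<noteq> 0" using pos by (auto simp: measure_def)
      then show "prob_space (uniform_measure \<nu> A)" by (intro prob_space_uniform_measure) auto
      have "prob A = prob (A \<inter> E) + prob (A - E)"
        using ev E by (subst finite_measure_Union[symmetric]) (auto simp: Un_Diff_Int Int_commute intro: arg_cong[where f = prob])
      then have "3 / 4 * prob A < prob (A \<inter> E)" using A(2) by linarith
      then have "3 / 4 < prob (A \<inter> E) / prob A" using pos by (simp only: pos_less_divide_eq)
      moreover have "measure (uniform_measure \<nu> A) (A \<inter> E) = prob (A \<inter> E) / prob A"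
        using \<open>emeasure \<nu> A \<noteq> 0\<close> ev E by (subst measure_uniform_measure) auto
      ultimately show "measure (uniform_measure \<nu> A) (A \<inter> E) > 3 / 4" by linarith
    qed
    have "fbar_measures_less left_shift ?P K (uniform_measure \<nu> A) (uniform_measure \<nu> B) e"
      using G(3) *(1) A(1) B(1) fin\<H>(2) by blast
    then obtain x' y' where x': "x' \<in> A \<inter> E" and y': "y' \<in> B \<inter> E"
      and less: "fbar_name left_shift ?P K x' y' < e"
    proof (rule fbar_measures_less_point)
      show "prob_space (uniform_measure \<nu> A)" using *(3) A(1) .
      show "A \<inter> E \<in> sets (uniform_measure \<nu> A)" "B \<inter> E \<in> sets (uniform_measure \<nu> B)"
        using *(2) A(1) B(1) E by auto
      show "1 + e < measure (uniform_measure \<nu> A) (A \<inter> E) + measure (uniform_measure \<nu> B) (B \<inter> E)"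
        using *(4)[OF A(1)] *(4)[OF B(1)] e by linarith
    qed
    have same: "map x (map int [1..<Suc K]) = map x' (map int [1..<Suc K])"
      if A: "A \<in> \<G>" and x: "x \<in> A" "x \<in> E" "x' \<in> A" "x' \<in> E" for A x x'
    proof -
      obtain u where u: "A = ?at u" using atom[OF A] by (elim exE)
      have past: "x i = x' i" if "i \<in> {- int ?m..0}" for i
      proof -
        have "map x ?J = map x' ?J" using x u by auto
        then show ?thesis using that by auto
      qed
      have "x (int i) = x' (int i)" if "i \<in> {1..K}" for i
      proof -
        have "x (int i) = x (int i - int ?m)" "x' (int i) = x' (int i - int ?m)"
          using x that by (auto simp: E_def)
        \<comment> \<open>\<open>K \<le> q n\<close> places \<open>i - q n\<close> in the observed
          past from \<open>- q n\<close> to 0.\<close>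
        moreover have "x (int i - int ?m) = x' (int i - int ?m)"
          using past that Kq by auto
        ultimately show ?thesis by simp
      qed
      then show ?thesis by auto
    qed
    have "fbar_name left_shift ?P K x' y' =
        fbar (map f (map x' (map int [1..<Suc K]))) (map f (map y' (map int [1..<Suc K])))"
      unfolding fbar_name_def iterate_left_shift map_map comp_def by simp
    also have "\<dots> = fbar (map x' (map int [1..<Suc K])) (map y' (map int [1..<Suc K]))"
      by (rule fbar_map_inj[OF f])
    also have "map x' (map int [1..<Suc K]) = map x (map int [1..<Suc K])"
      using same[of A x x'] A x' fin\<H>(2) by auto
    also have "map y' (map int [1..<Suc K]) = map y (map int [1..<Suc K])"
      using same[of B y y'] B y' fin\<H>(2) by auto
    finally show ?thesis using less by simp
  qed
  show ?thesis
    by (rule that[OF \<open>K > 0\<close> sets.sets_into_space[OF H] H prob_H close])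
qed

lemma not_loosely_Bernoulli_process:
  fixes f :: "'a circ_symbol \<Rightarrow> nat"
  assumes "inj f"
  shows "\<not> loosely_Bernoulli_process \<nu> left_shift (\<lambda>x. f (x 0))"
proof
  assume LB: "loosely_Bernoulli_process \<nu> left_shift (\<lambda>x. f (x 0))"
  obtain K H where K: "K > 0" and H: "H \<subseteq> space \<nu>" "H \<in> events" "prob H \<ge> 1 - 2 * (1 / 16)"
    and close: "\<And>x y. x \<in> H \<Longrightarrow> y \<in> H \<Longrightarrow>
      fbar (map x (map int [1..<Suc K])) (map y (map int [1..<Suc K])) < 1 / 16"
    by (rule close_names[OF LB assms, of "1 / 16"]) auto
  define U where "U = (\<lambda>x. map x (map int [1..<Suc K])) ` H"
  have close_U: "fbar u v < 1 / 16" if "u \<in> U" "v \<in> U" for u v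
    using that close by (auto simp: U_def)
  \<comment> \<open>Names start at time 1, windows at position 0; invariance of the measure bridges
    the difference.\<close>
  have shift: "map x (map int [1..<Suc K]) = map (\<lambda>j. x (j + 1)) (map int [0..<K])" for x :: "int \<Rightarrow> 'a circ_symbol"
    by (simp only: map_Suc_upt[symmetric] One_nat_def map_map comp_def of_nat_Suc add.commute)
  have "prob H \<le> prob {x \<in> space \<nu>. map (\<lambda>j. x (j + 1)) (map int [0..<K]) \<in> U}"
  proof (rule finite_measure_mono)
    show "H \<subseteq> {x \<in> space \<nu>. map (\<lambda>j. x (j + 1)) (map int [0..<K]) \<in> U}"
      using H(1) unfolding U_def shift by blast
    show "{x \<in> space \<nu>. map (\<lambda>j. x (j + 1)) (map int [0..<K]) \<in> U} \<in> events"
      using word_event[of "\<lambda>u. u \<in> U" "map (\<lambda>j. j + 1) (map int [0..<K])"] by (simp add: comp_def)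
  qed
  also have "\<dots> = prob {x \<in> space \<nu>. map x (map int [0..<K]) \<in> U}"
    by (rule prob_shift[of "\<lambda>u. u \<in> U"])
  \<comment> \<open>\<open>prob H\<close> is at least 14/16. Lowering this to 13/16 makes the
    inequality strict, so that it passes to the frequencies in all sufficiently late blocks.\<close>
  finally have "1 - 3 / 16 < prob {x \<in> space \<nu>. map x (map int [0..<K]) \<in> U}" using H(3) by simp
  then have ev: "\<forall>\<^sub>F m in sequentially. 1 - 3 / 16 <
      window_sum K (\<lambda>u. if u \<in> U then 1 else 0) (c m (some_word m)) / real (q m)"
    by (rule order_tendstoD(1)[OF window_frequency_tendsto[OF some_word, of K "\<lambda>u. u \<in> U"]])
  have "K \<le> q K" using q_ge_power[of K] less_exp[of K] by linarith
  \<comment> \<open>The level is taken to be \<open>K\<close> itself, since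
    \<open>K \<le> q K\<close>. The least multiple of \<open>K\<close> above \<open>16 * q K\<close>
    is then at most \<open>17 * q K\<close>.\<close>
  define r where "r = 16 * q K div K + 1"
  have "16 * q K < r * K" "r * K \<le> 17 * q K"
  proof -
    have "16 * q K = K * (16 * q K div K) + 16 * q K mod K" by simp
    moreover have "16 * q K mod K < K" using K by simp
    moreover have "r * K = K * (16 * q K div K) + K" by (simp add: r_def)
    ultimately show "16 * q K < r * K" "r * K \<le> 17 * q K" using \<open>K \<le> q K\<close> by linarith+
  qed
  obtain m where m: "K < m" "1 - 3 / 16 <
      window_sum K (\<lambda>u. if u \<in> U then 1 else 0) (c m (some_word m)) / real (q m)"
    using eventually_happens[OF eventually_conj[OF ev eventually_gt_at_top[of K]]] by auto
  let ?w = "c m (some_word m)"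
  have len: "length ?w = q m" by (rule length_c[OF some_word])
  have "window_sum K (\<lambda>u. if u \<in> U then 1 else 0) ?w + window_sum K (\<lambda>u. if u \<in> U then 0 else 1) ?w =
      (\<Sum>p | p + K \<le> length ?w. 1)"
    unfolding window_sum_def sum.distrib[symmetric] by (intro sum.cong) auto
  also have "\<dots> = real (q m + 1 - K)" unfolding sum_constant card_windows len by simp
  also have "\<dots> \<le> real (q m)" using K by simp
  finally have bad: "window_sum K (\<lambda>u. if u \<in> U then 0 else 1) ?w \<le> 3 / 16 * real (q m)"
    using m(2) q_pos[of m] by (simp add: field_simps)
  have "real (q m) ^ 2 / 2 \<le> window_sum (r * K) (\<lambda>u. window_sum (r * K) (\<lambda>v. fbar u v) ?w) ?w"
    by (rule fbar_windows_ge[OF m(1) some_word])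
      (use \<open>16 * q K < r * K\<close> \<open>r * K \<le> 17 * q K\<close> in auto)
  also have "\<dots> \<le> 1 / 16 * real (length ?w) ^ 2 + 2 * real (length ?w) * (3 / 16 * real (q m))"
    by (rule fbar_windows_le[where U = U]) (use close_U bad K in \<open>auto simp: r_def\<close>)
  \<comment> \<open>The close pairs account for 1/16 and the windows outside \<open>U\<close> for
    twice 3/16; the sum is below the lower bound 1/2.\<close>
  also have "\<dots> = 7 / 16 * real (q m) ^ 2" unfolding len by (simp add: power2_eq_square)
  finally show False using q_pos[of m] by simp
qed

lemma not_loosely_Bernoulli:
  fixes f :: "'a circ_symbol \<Rightarrow> nat"
  assumes "inj f"
  shows "\<not> loosely_Bernoulli \<nu> left_shift"
  using not_loosely_Bernoulli_process[OF assms] finite_partition_zero[of f]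
  unfolding loosely_Bernoulli_def by blast

end

theorem theorem2:
  shows "\<exists>(S\<^sub>0 :: nat) (\<kappa> :: nat \<Rightarrow> nat \<Rightarrow> real list \<Rightarrow> nat list \<Rightarrow> nat list \<Rightarrow> nat).
    \<forall>(\<Sigma> :: nat set) (\<epsilon> :: nat \<Rightarrow> real) (k :: nat \<Rightarrow> nat) (l :: nat \<Rightarrow> nat)
      (y :: nat \<Rightarrow> nat \<Rightarrow> nat list) (W :: nat \<Rightarrow> nat list set)
      (\<nu> :: (int \<Rightarrow> nat circ_symbol) measure).
      finite \<Sigma> \<and>
      E_sequence \<Sigma> \<epsilon> k y W \<and>
      E_parameters \<epsilon> k (\<lambda>n. card (W n)) \<and>
      (\<forall>n. l n > 2 ^ (n + 10)) \<and>
      card \<Sigma> \<ge> S\<^sub>0 \<and>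
      (\<forall>n. k n \<ge> \<kappa> n (card \<Sigma>) (map \<epsilon> [0..<Suc n]) (map l [0..<Suc n]) (map k [0..<n])) \<and>
      system_measure (circular_sequence k l W) \<nu>
      \<longrightarrow> \<not> loosely_Bernoulli \<nu> left_shift"
proof -
  \<comment> \<open>Partitions are labelled by natural numbers, so the symbols are coded
    injectively; the zeroth coordinate then gives the partition that refutes the property.\<close>
  define f :: "nat circ_symbol \<Rightarrow> nat" where
    "f s = (case s of Letter a \<Rightarrow> a + 2 | Spacer_b \<Rightarrow> 0 | Spacer_e \<Rightarrow> 1)" for s
  have "inj f" by (auto simp: inj_def f_def split: circ_symbol.splits)
  have "\<not> loosely_Bernoulli \<nu> left_shift"
    if "finite \<Sigma>" "E_sequence \<Sigma> \<epsilon> k y W" "E_parameters \<epsilon> k (\<lambda>n. card (W n))"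
      "\<forall>n. l n > 2 ^ (n + 10)" "card \<Sigma> \<ge> 54 ^ 128 + 1" "\<forall>n. k n \<ge> 2 ^ (n + 12)"
      "system_measure (circular_sequence k l W) \<nu>"
    for \<Sigma> :: "nat set" and \<epsilon> k l y W and \<nu> :: "(int \<Rightarrow> nat circ_symbol) measure"
  proof -
    interpret E_measure \<Sigma> \<epsilon> k l y W \<nu> using that by unfold_locales auto
    show ?thesis by (rule not_loosely_Bernoulli[OF \<open>inj f\<close>])
  qed
  then show ?thesis
    by (intro exI[of _ "54 ^ 128 + 1"] exI[of _ "\<lambda>n _ _ _ _. 2 ^ (n + 12)"]) blast
qed

end
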